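(* Let $k$ be a natural number. Suppose that a finite group $G=AB$ is the product of nilpotent subgroups $A$ and $B$. If $A$ and $B$ are $k$-submodular in $G$, then $G$ is supersoluble and every Sylow subgroup of $G$ is $k$-submodular in $G$.
   Context: All groups are finite; natural numbers are positive integers. $\mathrm{Core}_G(H)$ denotes the intersection of all conjugates of $H$ in $G$. For a natural number $n$, a subgroup $H$ of $G$ is $n$-modularly embedded in $G$ if either $H\unlhd G$, or $G/\mathrm{Core}_G(H)$ is a non-nilpotent group of order $pq^n$ with $|G:H|=p$ for some primes $p$ and $q$. For a natural number $k$, a subgroup $H$ of $G$ is $k$-submodular in $G$ if there is a chain of subgroups $H=H_0\le H_1\le\cdots\le H_m=G$ such that for every $i=1,\dots,m$, $H_{i-1}$ is $n_i$-modularly embedded in $H_i$ for some natural number $n_i\le k$. *)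

theory Defs
  imports "HOL-Algebra.Sylow" "HOL-Algebra.Elementary_Groups"
begin

definition group_centre :: "('a, 'b) monoid_scheme \<Rightarrow> 'a set" where
  "group_centre G = {z \<in> carrier G. \<forall>x \<in> carrier G. z \<otimes>\<^bsub>G\<^esub> x = x \<otimes>\<^bsub>G\<^esub> z}"

definition nilpotent_group :: "('a, 'b) monoid_scheme \<Rightarrow> bool" where
  "nilpotent_group G \<longleftrightarrow>
     (\<exists>(K :: nat \<Rightarrow> 'a set) n. K 0 = {\<one>\<^bsub>G\<^esub>} \<and> K n = carrier G \<and>
        (\<forall>i\<le>n. K i \<lhd> G) \<and>
        (\<forall>i<n. K i \<subseteq> K (Suc i) \<and>
           carrier ((G\<lparr>carrier := K (Suc i)\<rparr>) Mod K i) \<subseteq> group_centre (G Mod K i)))"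

definition supersoluble_group :: "('a, 'b) monoid_scheme \<Rightarrow> bool" where
  "supersoluble_group G \<longleftrightarrow>
     (\<exists>(K :: nat \<Rightarrow> 'a set) n. K 0 = {\<one>\<^bsub>G\<^esub>} \<and> K n = carrier G \<and>
        (\<forall>i\<le>n. K i \<lhd> G) \<and>
        (\<forall>i<n. K i \<subseteq> K (Suc i) \<and> cyclic_group ((G\<lparr>carrier := K (Suc i)\<rparr>) Mod K i)))"

definition normal_core :: "('a, 'b) monoid_scheme \<Rightarrow> 'a set \<Rightarrow> 'a set" where
  "normal_core G H = (\<Inter>g \<in> carrier G. (g <#\<^bsub>G\<^esub> H) #>\<^bsub>G\<^esub> (inv\<^bsub>G\<^esub> g))"

definition sylow_subgroup :: "('a, 'b) monoid_scheme \<Rightarrow> nat \<Rightarrow> 'a set \<Rightarrow> bool" where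
  "sylow_subgroup G p P \<longleftrightarrow>
     prime p \<and> subgroup P G \<and> card P = p ^ multiplicity p (order G)"

definition modularly_embedded :: "nat \<Rightarrow> ('a, 'b) monoid_scheme \<Rightarrow> 'a set \<Rightarrow> bool" where
  "modularly_embedded n G H \<longleftrightarrow> subgroup H G \<and>
     (H \<lhd> G \<or>
      (\<exists>p q :: nat. prime p \<and> prime q \<and>
         \<not> nilpotent_group (G Mod normal_core G H) \<and>
         order (G Mod normal_core G H) = p * q ^ n \<and>
         card (rcosets\<^bsub>G\<^esub> H) = p))"

text \<open>The bound \<open>1 \<le> n\<close> below is explicit because natural numbers are understood to be
  positive.\<close>

definition submodular :: "nat \<Rightarrow> ('a, 'b) monoid_scheme \<Rightarrow> 'a set \<Rightarrow> bool" where
  "submodular k G H \<longleftrightarrow>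
     (\<exists>(C :: nat \<Rightarrow> 'a set) m. C 0 = H \<and> C m = carrier G \<and>
        (\<forall>i\<le>m. subgroup (C i) G) \<and>
        (\<forall>i<m. C i \<subseteq> C (Suc i) \<and>
           (\<exists>n. 1 \<le> n \<and> n \<le> k \<and> modularly_embedded n (G\<lparr>carrier := C (Suc i)\<rparr>) (C i))))"

end

theory Submission
  imports Defs "HOL-Algebra.Group_Action" "HOL-Number_Theory.Residues"
begin

text \<open>
  By downward induction on normal subgroups, supersolubility reduces to finding a normal subgroup of
  prime order when all proper quotients of \<open>G\<close> have chief factors of prime order. Let \<open>r\<close> be the
  largest prime divisor of \<open>|G|\<close>. In a non-normal step of type \<open>p q\<^sup>n\<close> one has
  \<open>q < p\<close>, so \<open>r \<noteq> q\<close>; hence the Sylow \<open>r\<close>-subgroups of \<open>A\<close> and \<open>B\<close> lie in \<open>O\<^sub>r(G)\<close>,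
  and \<open>R = A\<^sub>r B\<^sub>r\<close> is a normal Sylow subgroup.

  If \<open>R\<close> is minimal normal, write a generator of a normal subgroup of prime order of \<open>G/C(R)\<close> as
  \<open>ab\<close> with \<open>a\<close> in \<open>A\<close> and \<open>b\<close> in \<open>B\<close>. Nilpotency makes \<open>R \<inter> B = [R, a]\<close> invariant under \<open>G\<close>,
  so \<open>R\<close> lies in \<open>A\<close> or in \<open>B\<close>, and modularity of the other factor forces \<open>|R| = r\<close>. If \<open>R\<close> is not
  minimal normal, all top factors \<open>R/M\<close> have order \<open>r\<close>, so by coprime action the commutators of
  \<open>G\<close> act trivially on a minimal normal subgroup \<open>V \<le> Z(R)\<close>. Then \<open>A\<close> and \<open>B\<close> act on \<open>V\<close> by power
  maps, and \<open>|V| = r\<close>.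

  For a Sylow \<open>p\<close>-subgroup \<open>P = A\<^sub>p B\<^sub>p\<close> the chain of products \<open>P K\<^sub>i\<close> along a chief series works:
  \<open>P\<close> acts on a factor of prime order as a cyclic group, hence with the same image as \<open>A\<^sub>p\<close> or as
  \<open>B\<^sub>p\<close>, whose image has order at most \<open>p\<^sup>k\<close> because \<open>A\<close> and \<open>B\<close> are \<open>k\<close>-submodular.\<close>

no_notation subset_mset (infix \<open><#\<close> 50)

section \<open>Conjugation, normalising subgroups and orders of products\<close>

text \<open>A modular chain need not stay modular when intersected with an arbitrary subgroup, so
  chains enter the supersolubility argument mainly through one device: if \<open>H\<close> is
  maximal in \<open>U\<close>, some single step of a chain from \<open>H\<close> to \<open>G\<close>
  takes the intersection with \<open>U\<close> from \<open>H\<close> to \<open>U\<close>, and that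
  step makes \<open>H < U\<close> itself modular. If \<open>A\<close> acts irreducibly on
  \<open>V\<close> and meets it trivially, \<open>A\<close> is maximal in \<open>AV\<close> with
  index \<open>|V|\<close>, so the action is trivial or \<open>|V|\<close> is prime. The same device
  applied to \<open>HL < HK\<close>, for a factor \<open>K / L\<close> of prime order, turns the
  bound \<open>k\<close> into a bound for the group that \<open>H\<close> induces there.

  The inequality \<open>q < p\<close> is a matter of counting. In a step \<open>X < Y\<close> that
  is not normal, \<open>X\<close> is its own normaliser; modulo \<open>q\<close> the index
  \<open>p\<close> is congruent to the index of \<open>X\<close> in its normaliser, which is 1.

  The action on a factor of prime order \<open>r\<close> is recorded by exponents between 1 and
  \<open>r - 1\<close>. That they commute modulo \<open>r\<close>, are fewer than \<open>r\<close>,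
  and include at most \<open>n\<close> roots of unity of exponent \<open>n\<close> is all that is
  used.

  Normality, nilpotency and modularity are stated for subsets of one fixed group, often over a
  bottom subgroup \<open>C\<close>, so that most sections of \<open>G\<close> need no
  quotient.\<close>

definition normalizes :: "('a, 'b) monoid_scheme \<Rightarrow> 'a set \<Rightarrow> 'a set \<Rightarrow> bool" where
  "normalizes G H K \<longleftrightarrow> (\<forall>h\<in>H. \<forall>x\<in>K. h \<otimes>\<^bsub>G\<^esub> x \<otimes>\<^bsub>G\<^esub> inv\<^bsub>G\<^esub> h \<in> K)"

locale finite_group = group +
  assumes fin [simp, intro]: "finite (carrier G)"

context group
begin

definition cj :: "'a \<Rightarrow> 'a \<Rightarrow> 'a" where
  "cj g x = g \<otimes> x \<otimes> inv g"

lemma l_cancel_inv [simp]: "\<lbrakk>x \<in> carrier G; y \<in> carrier G\<rbrakk> \<Longrightarrow> x \<otimes> (inv x \<otimes> y) = y"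
  by (simp add: m_assoc [symmetric])

lemma l_inv_cancel [simp]: "\<lbrakk>x \<in> carrier G; y \<in> carrier G\<rbrakk> \<Longrightarrow> inv x \<otimes> (x \<otimes> y) = y"
  by (simp add: m_assoc [symmetric])

lemmas group_word_simps = m_assoc inv_mult_group

lemma cj_closed [simp, intro]: "\<lbrakk>g \<in> carrier G; x \<in> carrier G\<rbrakk> \<Longrightarrow> cj g x \<in> carrier G"
  by (simp add: cj_def)

lemma cj_mult_left:
  "\<lbrakk>g \<in> carrier G; h \<in> carrier G; x \<in> carrier G\<rbrakk> \<Longrightarrow> cj (g \<otimes> h) x = cj g (cj h x)"
  by (simp add: cj_def group_word_simps)

lemma cj_mult:
  "\<lbrakk>g \<in> carrier G; x \<in> carrier G; y \<in> carrier G\<rbrakk> \<Longrightarrow> cj g (x \<otimes> y) = cj g x \<otimes> cj g y"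
  by (simp add: cj_def group_word_simps)

lemma cj_inv:
  "\<lbrakk>g \<in> carrier G; x \<in> carrier G\<rbrakk> \<Longrightarrow> cj g (inv x) = inv (cj g x)"
  by (simp add: cj_def group_word_simps)

lemma cj_one_left [simp]: "x \<in> carrier G \<Longrightarrow> cj \<one> x = x"
  by (simp add: cj_def)

lemma cj_one [simp]: "g \<in> carrier G \<Longrightarrow> cj g \<one> = \<one>"
  by (simp add: cj_def)

lemma cj_inv_cj [simp]:
  "\<lbrakk>g \<in> carrier G; x \<in> carrier G\<rbrakk> \<Longrightarrow> cj (inv g) (cj g x) = x"
  by (simp add: cj_mult_left [symmetric])

lemma cj_cj_inv [simp]:
  "\<lbrakk>g \<in> carrier G; x \<in> carrier G\<rbrakk> \<Longrightarrow> cj g (cj (inv g) x) = x"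
  by (simp add: cj_mult_left [symmetric])

lemma cj_eq_iff:
  "\<lbrakk>g \<in> carrier G; x \<in> carrier G; y \<in> carrier G\<rbrakk> \<Longrightarrow> cj g x = cj g y \<longleftrightarrow> x = y"
  by (metis cj_inv_cj)

lemma cj_eq_self_iff:
  "\<lbrakk>g \<in> carrier G; x \<in> carrier G\<rbrakk> \<Longrightarrow> cj g x = x \<longleftrightarrow> g \<otimes> x = x \<otimes> g"
  by (metis cj_def inv_solve_right' m_closed)

lemma cj_cj:
  "\<lbrakk>g \<in> carrier G; h \<in> carrier G; x \<in> carrier G\<rbrakk> \<Longrightarrow> cj g (cj h x) = cj (cj g h) (cj g x)"
  by (simp add: cj_def group_word_simps)

lemma normalizes_iff: "normalizes G H K \<longleftrightarrow> (\<forall>h\<in>H. \<forall>x\<in>K. cj h x \<in> K)"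
  by (simp add: normalizes_def cj_def)

lemma normalizesD: "\<lbrakk>normalizes G H K; h \<in> H; x \<in> K\<rbrakk> \<Longrightarrow> cj h x \<in> K"
  by (auto simp: normalizes_iff)

lemma normalizes_self: "subgroup H G \<Longrightarrow> normalizes G H H"
  by (auto simp: normalizes_def subgroup_def)

lemma normal_iff_normalizes: "N \<lhd> G \<longleftrightarrow> subgroup N G \<and> normalizes G (carrier G) N"
  by (auto simp: normal_inv_iff normalizes_def)

lemma subgroup_int: "\<lbrakk>subgroup H G; subgroup K G\<rbrakk> \<Longrightarrow> subgroup (H \<inter> K) G"
  by (rule subgroups_Inter_pair)

lemma normalizes_mono: "\<lbrakk>normalizes G H K; H' \<subseteq> H\<rbrakk> \<Longrightarrow> normalizes G H' K"
  by (auto simp: normalizes_def)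

lemma normalizes_int: "\<lbrakk>normalizes G H K; normalizes G H L\<rbrakk> \<Longrightarrow> normalizes G H (K \<inter> L)"
  by (auto simp: normalizes_def)

lemma subgroup_fixator:
  assumes "subgroup H G" "U \<subseteq> carrier G"
  shows "subgroup {g \<in> H. \<forall>u\<in>U. cj g u = u} G"
proof -
  interpret H: subgroup H G by fact
  have U: "u \<in> carrier G" if "u \<in> U" for u using that assms(2) by auto
  show ?thesis
  proof
    fix x assume x: "x \<in> {g \<in> H. \<forall>u\<in>U. cj g u = u}"
    have "cj (inv x) u = u" if "u \<in> U" for u
    proof -
      have "cj (inv x) (cj x u) = u" using x U[OF that] by simp
      then show ?thesis using x that by simp
    qed
    with x show "inv x \<in> {g \<in> H. \<forall>u\<in>U. cj g u = u}" by simp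
  next
    fix x y assume "x \<in> {g \<in> H. \<forall>u\<in>U. cj g u = u}" "y \<in> {g \<in> H. \<forall>u\<in>U. cj g u = u}"
    then show "x \<otimes> y \<in> {g \<in> H. \<forall>u\<in>U. cj g u = u}" using U by (simp add: cj_mult_left)
  qed (use U in auto)
qed

lemma subgroup_fixed_points:
  assumes "subgroup U G" "H \<subseteq> carrier G"
  shows "subgroup {u \<in> U. \<forall>h\<in>H. cj h u = u} G"
proof -
  interpret U: subgroup U G by fact
  have H: "h \<in> carrier G" if "h \<in> H" for h using that assms(2) by auto
  show ?thesis
    by standard (use H in \<open>auto simp: cj_mult cj_inv\<close>)
qed

lemma subgroup_normalizer:
  assumes "subgroup H G" "X \<subseteq> carrier G"
  shows "subgroup {g \<in> H. cj g ` X = X} G"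
proof -
  interpret H: subgroup H G by fact
  have X: "x \<in> carrier G" if "x \<in> X" for x using that assms(2) by auto
  show ?thesis
  proof
    fix x y assume *: "x \<in> {g \<in> H. cj g ` X = X}" "y \<in> {g \<in> H. cj g ` X = X}"
    have "cj (x \<otimes> y) ` X = cj x ` cj y ` X"
      unfolding image_image using * X by (intro image_cong) (auto simp: cj_mult_left)
    then show "x \<otimes> y \<in> {g \<in> H. cj g ` X = X}" using * by simp
  next
    have "cj \<one> ` X = (\<lambda>x. x) ` X"
      using X by (intro image_cong) auto
    then show "\<one> \<in> {g \<in> H. cj g ` X = X}" by simp
  next
    fix x assume x: "x \<in> {g \<in> H. cj g ` X = X}"
    have "cj (inv x) ` cj x ` X = (\<lambda>x. x) ` X"
      unfolding image_image using x X by (intro image_cong) auto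
    with x show "inv x \<in> {g \<in> H. cj g ` X = X}" by simp
  qed auto
qed

lemma card_cj_image:
  assumes "g \<in> carrier G" "X \<subseteq> carrier G"
  shows "card (cj g ` X) = card X"
proof -
  have "x \<in> carrier G" if "x \<in> X" for x using that assms(2) by auto
  then have "inj_on (cj g) X"
    using assms(1) cj_eq_iff by (intro inj_onI) blast
  then show ?thesis by (rule card_image)
qed

lemma cj_image_eq:
  assumes "g \<in> carrier G" "X \<subseteq> carrier G" "finite X" "cj g ` X \<subseteq> X"
  shows "cj g ` X = X"
  using assms card_cj_image by (intro card_subset_eq) auto

lemma subgroup_cj_image:
  assumes "g \<in> carrier G" "subgroup H G"
  shows "subgroup (cj g ` H) G"
proof -
  interpret H: subgroup H G by fact
  show ?thesis
  proof
    fix x y assume "x \<in> cj g ` H" "y \<in> cj g ` H"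
    then show "x \<otimes> y \<in> cj g ` H"
      using assms(1) by (auto simp: cj_mult [symmetric])
  next
    show "\<one> \<in> cj g ` H" using assms(1) by (auto intro: image_eqI [of _ _ \<one>])
  qed (use assms(1) in \<open>auto simp: cj_inv [symmetric]\<close>)
qed

lemma set_mult_iff: "x \<in> H <#> K \<longleftrightarrow> (\<exists>h\<in>H. \<exists>k\<in>K. x = h \<otimes> k)"
  by (auto simp: set_mult_def)

lemma set_multI: "\<lbrakk>h \<in> H; k \<in> K\<rbrakk> \<Longrightarrow> h \<otimes> k \<in> H <#> K"
  by (auto simp: set_mult_iff)

lemma subgroup_set_mult:
  assumes "subgroup H G" "subgroup N G" "normalizes G H N"
  shows "subgroup (H <#> N) G"
proof -
  interpret H: subgroup H G by fact
  interpret N: subgroup N G by fact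
  show ?thesis
  proof
    fix x y assume "x \<in> H <#> N" "y \<in> H <#> N"
    then obtain h n h' n' where *: "h \<in> H" "n \<in> N" "h' \<in> H" "n' \<in> N" "x = h \<otimes> n" "y = h' \<otimes> n'"
      by (auto simp: set_mult_iff)
    have "cj (inv h') n \<in> N" using * assms(3) by (auto intro: normalizesD)
    moreover have "x \<otimes> y = (h \<otimes> h') \<otimes> (cj (inv h') n \<otimes> n')"
      using * by (simp add: cj_def group_word_simps)
    ultimately show "x \<otimes> y \<in> H <#> N"
      using * by (auto simp: set_mult_iff)
  next
    fix x assume "x \<in> H <#> N"
    then obtain h n where *: "h \<in> H" "n \<in> N" "x = h \<otimes> n" by (auto simp: set_mult_iff)
    have "cj h (inv n) \<in> N" using * assms(3) by (auto intro: normalizesD)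
    moreover have "inv x = inv h \<otimes> cj h (inv n)"
      using * by (simp add: cj_def group_word_simps)
    ultimately show "inv x \<in> H <#> N" using set_multI[of "inv h" H _ N] * by auto
  next
    show "\<one> \<in> H <#> N" using set_multI[of \<one> H \<one> N] by simp
  next
    show "H <#> N \<subseteq> carrier G" by (intro setmult_subset_G H.subset N.subset)
  qed
qed

lemma set_mult_superset_left:
  assumes "subgroup H G" "subgroup N G"
  shows "H \<subseteq> H <#> N"
proof
  fix h assume "h \<in> H"
  then show "h \<in> H <#> N"
    using set_multI[of h H \<one> N] assms by (simp add: subgroup.one_closed subgroup.mem_carrier)
qed

lemma set_mult_superset_right:
  assumes "subgroup H G" "subgroup N G"
  shows "N \<subseteq> H <#> N"
proof
  fix n assume "n \<in> N"
  then show "n \<in> H <#> N"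
    using set_multI[of \<one> H n N] assms by (simp add: subgroup.one_closed subgroup.mem_carrier)
qed

lemma set_mult_subset: "\<lbrakk>subgroup K G; H \<subseteq> K; N \<subseteq> K\<rbrakk> \<Longrightarrow> H <#> N \<subseteq> K"
  by (auto simp: set_mult_iff intro!: subgroup.m_closed)

lemma normalizes_set_mult:
  assumes "L \<subseteq> carrier G" "H \<subseteq> carrier G" "N \<subseteq> carrier G" "normalizes G L H" "normalizes G L N"
  shows "normalizes G L (H <#> N)"
  unfolding normalizes_iff
proof (intro ballI)
  fix l x assume l: "l \<in> L" and "x \<in> H <#> N"
  then obtain h n where *: "h \<in> H" "n \<in> N" "x = h \<otimes> n" by (auto simp: set_mult_iff)
  then have "cj l x = cj l h \<otimes> cj l n"
    using subsetD[OF assms(1) l] subsetD[OF assms(2) *(1)] subsetD[OF assms(3) *(2)] by (simp add: cj_mult)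
  then show "cj l x \<in> H <#> N"
    using set_multI[OF normalizesD[OF assms(4) l *(1)] normalizesD[OF assms(5) l *(2)]] by simp
qed

lemma card_subgroup_dvd:
  assumes "subgroup H G" "subgroup K G" "H \<subseteq> K"
  shows "card H dvd card K"
proof -
  have "card (rcosets\<^bsub>G\<lparr>carrier := K\<rparr>\<^esub> H) * card H = card K"
    using group.lagrange[OF subgroup_imp_group[OF assms(2)] subgroup_incl[OF assms]]
    unfolding order_def by simp
  then show ?thesis by (rule dvdI[OF trans[OF sym mult.commute]])
qed

end

context finite_group
begin

lemma finite_subgroup [simp, intro]: "subgroup H G \<Longrightarrow> finite H"
  by (rule finite_subset[OF subgroup.subset fin])

lemma card_subgroup_pos: "subgroup H G \<Longrightarrow> 0 < card H"
  by (rule subgroup.finite_imp_card_positive[OF _ fin])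

lemma card_eq_imp_eq: "\<lbrakk>subgroup K G; H \<subseteq> K; card H = card K\<rbrakk> \<Longrightarrow> H = K"
  by (rule card_subset_eq[OF finite_subgroup])

lemma card_one_iff: "subgroup H G \<Longrightarrow> card H = 1 \<longleftrightarrow> H = {\<one>}"
  by (auto simp: card_1_singleton_iff dest: subgroup.one_closed)

text \<open>Two factorisations of the same element differ by an element of
  \<open>H \<inter> K\<close>. Once a factorisation \<open>s y\<close> is fixed for each product
  \<open>y\<close>, the pairs in \<open>H \<times> K\<close> correspond to a product together with
  such an element.\<close>

lemma card_set_mult:
  assumes "subgroup H G" "subgroup K G"
  shows "card (H <#> K) * card (H \<inter> K) = card H * card K"
proof -
  interpret H: subgroup H G by fact
  interpret K: subgroup K G by fact
  define s where "s y = (SOME p. fst p \<in> H \<and> snd p \<in> K \<and> y = fst p \<otimes> snd p)" for y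
  have s: "fst (s y) \<in> H" "snd (s y) \<in> K" "y = fst (s y) \<otimes> snd (s y)" if "y \<in> H <#> K" for y
  proof -
    have "\<exists>p. fst p \<in> H \<and> snd p \<in> K \<and> y = fst p \<otimes> snd p"
      using that by (auto simp: set_mult_iff)
    then have "fst (s y) \<in> H \<and> snd (s y) \<in> K \<and> y = fst (s y) \<otimes> snd (s y)"
      unfolding s_def by (rule someI_ex)
    then show "fst (s y) \<in> H" "snd (s y) \<in> K" "y = fst (s y) \<otimes> snd (s y)" by auto
  qed
  define f where "f = (\<lambda>(y, d). (fst (s y) \<otimes> d, inv d \<otimes> snd (s y)))"
  have f: "fst (f (y, d)) \<otimes> snd (f (y, d)) = y" if "y \<in> H <#> K" "d \<in> H \<inter> K" for y d
    using s[OF that(1)] that(2) by (simp add: f_def group_word_simps)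
  have "bij_betw f ((H <#> K) \<times> (H \<inter> K)) (H \<times> K)"
    unfolding bij_betw_def
  proof
    show "inj_on f ((H <#> K) \<times> (H \<inter> K))"
    proof (rule inj_onI, clarify)
      fix y d y' d' assume *: "y \<in> H <#> K" "d \<in> H" "d \<in> K" "y' \<in> H <#> K" "d' \<in> H" "d' \<in> K"
        "f (y, d) = f (y', d')"
      then have "y = y'" using f by (metis IntI)
      moreover have "d = d'"
      proof -
        have "fst (s y) \<otimes> d = fst (s y) \<otimes> d'" using * \<open>y = y'\<close> by (simp add: f_def)
        then show ?thesis using s(1)[OF *(1)] * by auto
      qed
      ultimately show "y = y' \<and> d = d'" by simp
    qed
  next
    show "f ` ((H <#> K) \<times> (H \<inter> K)) = H \<times> K"
    proof
      show "f ` ((H <#> K) \<times> (H \<inter> K)) \<subseteq> H \<times> K"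
        using s by (auto simp: f_def)
      show "H \<times> K \<subseteq> f ` ((H <#> K) \<times> (H \<inter> K))"
      proof clarify
        fix h k assume hk: "h \<in> H" "k \<in> K"
        define y where "y = h \<otimes> k"
        have y: "y \<in> H <#> K" using hk by (auto simp: set_mult_iff y_def)
        note sy = s[OF y]
        define d where "d = inv (fst (s y)) \<otimes> h"
        have car: "fst (s y) \<in> carrier G" "snd (s y) \<in> carrier G" "h \<in> carrier G" "k \<in> carrier G"
          "d \<in> carrier G"
          using sy hk by (auto simp: d_def)
        have "d \<otimes> k = inv (fst (s y)) \<otimes> y" using car by (simp add: d_def y_def m_assoc)
        also have "\<dots> = inv (fst (s y)) \<otimes> (fst (s y) \<otimes> snd (s y))" using sy(3) by simp
        also have "\<dots> = snd (s y)" using car by simp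
        finally have dk: "snd (s y) = d \<otimes> k" by simp
        then have "d = snd (s y) \<otimes> inv k" using car by (simp add: m_assoc)
        then have "d \<in> K" using sy hk by simp
        moreover have "d \<in> H" using sy hk d_def by auto
        moreover have "fst (s y) \<otimes> d = h" using car by (simp add: d_def)
        moreover have "inv d \<otimes> snd (s y) = k" using car by (simp add: dk)
        then have "f (y, d) = (h, k)" using \<open>fst (s y) \<otimes> d = h\<close> by (simp add: f_def)
        ultimately show "(h, k) \<in> f ` ((H <#> K) \<times> (H \<inter> K))"
          using y by (auto intro!: image_eqI [of _ _ "(y, d)"])
      qed
    qed
  qed
  then have "card ((H <#> K) \<times> (H \<inter> K)) = card (H \<times> K)" by (rule bij_betw_same_card)
  then show ?thesis by (simp add: card_cartesian_product)
qed

text \<open>The quotient of \<open>H\<close> by \<open>H \<inter> C\<close> embeds in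
  \<open>X / C\<close>; comparing orders through \<open>HC\<close> avoids forming either
  quotient.\<close>

lemma card_dvd_index_mult:
  assumes "subgroup H G" "subgroup X G" "H \<subseteq> X" "subgroup C G" "C \<subseteq> X" "normalizes G X C"
    "card X = n * card C"
  shows "card H dvd n * card (H \<inter> C)"
proof -
  have sub: "subgroup (H <#> C) G"
    using assms by (intro subgroup_set_mult) (auto intro: normalizes_mono)
  then have "card (H <#> C) dvd card X"
    using assms by (intro card_subgroup_dvd set_mult_subset) auto
  then obtain e where e: "card X = card (H <#> C) * e" by auto
  have "card H * card C * e = n * card C * card (H \<inter> C)"
    using card_set_mult[OF assms(1,4)] e assms(7) by (metis mult.assoc mult.commute)
  then have "card H * e = n * card (H \<inter> C)"
    using card_subgroup_pos[OF assms(4)] by auto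
  then show ?thesis by (metis dvd_triv_left)
qed

lemma coset_card:
  assumes "subgroup H G" "subgroup K G" "H \<subseteq> K"
  obtains n where "card K = n * card H" "0 < n"
proof -
  obtain n where "card K = card H * n" using card_subgroup_dvd[OF assms] by auto
  moreover have "0 < n" using card_subgroup_pos[OF assms(2)] calculation by (cases n) auto
  ultimately show ?thesis using that by (metis mult.commute)
qed

text \<open>Every stabiliser contains \<open>C\<close>, so orbit lengths divide
  \<open>q ^ m\<close>, and an orbit that is not a fixed point has length divisible by
  \<open>q\<close>. The subgroup \<open>C\<close> allows actions that factor through a
  \<open>q\<close>-group.\<close>

lemma card_fixed_points_mod:
  assumes "finite E" "subgroup D G"
    and closed: "\<And>d e. \<lbrakk>d \<in> D; e \<in> E\<rbrakk> \<Longrightarrow> act d e \<in> E"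
    and one: "\<And>e. e \<in> E \<Longrightarrow> act \<one> e = e"
    and mult: "\<And>d d' e. \<lbrakk>d \<in> D; d' \<in> D; e \<in> E\<rbrakk> \<Longrightarrow> act (d \<otimes> d') e = act d (act d' e)"
    and C: "subgroup C G" "C \<subseteq> D" "\<And>c e. \<lbrakk>c \<in> C; e \<in> E\<rbrakk> \<Longrightarrow> act c e = e"
    and q: "prime q" "card D = q ^ m * card C"
  shows "card E mod q = card {e \<in> E. \<forall>d\<in>D. act d e = e} mod q"
proof -
  interpret D: subgroup D G by fact
  let ?D = "G\<lparr>carrier := D\<rparr>"
  \<comment> \<open>The members of \<open>BijGroup E\<close> are \<open>undefined\<close> outside
    \<open>E\<close>, hence the restriction.\<close>
  let ?\<phi> = "\<lambda>g. restrict (act g) E"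
  have gD: "group ?D" using assms(2) by (rule subgroup_imp_group)
  have inv_act: "act (inv d) (act d e) = e" "act d (act (inv d) e) = e" if "d \<in> D" "e \<in> E" for d e
    using that one mult[of "inv d" d e] mult[of d "inv d" e] by auto
  have bij: "?\<phi> d \<in> Bij E" if "d \<in> D" for d
  proof -
    have "bij_betw (act d) E E"
      by (rule bij_betw_byWitness[where f' = "act (inv d)"]) (use that inv_act closed in auto)
    then show ?thesis
      by (auto simp: Bij_def intro: bij_betw_cong [THEN iffD1, rotated])
  qed
  have "?\<phi> \<in> hom ?D (BijGroup E)"
  proof (rule homI)
    fix x y assume "x \<in> carrier ?D" "y \<in> carrier ?D"
    then show "?\<phi> (x \<otimes>\<^bsub>?D\<^esub> y) = ?\<phi> x \<otimes>\<^bsub>BijGroup E\<^esub> ?\<phi> y"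
      using bij closed by (auto simp: BijGroup_def compose_def mult fun_eq_iff restrict_def)
  qed (use bij in \<open>auto simp: BijGroup_def\<close>)
  then have "group_hom ?D (BijGroup E) ?\<phi>"
    by (simp add: group_hom_def group_hom_axioms_def gD group_BijGroup)
  then interpret A: group_action ?D E ?\<phi> by (simp add: group_action_def)
  define F where "F = {e \<in> E. \<forall>d\<in>D. act d e = e}"
  define O' where "O' = {orbit ?D ?\<phi> e | e. e \<in> E - F}"
  have orb: "orbit ?D ?\<phi> e = (\<lambda>d. act d e) ` D" if "e \<in> E" for e
    using that by (auto simp: orbit_def)
  have dvd: "q dvd card (orbit ?D ?\<phi> e)" if e: "e \<in> E - F" for e
  proof -
    have st: "stabilizer ?D ?\<phi> e = {d \<in> D. act d e = e}"
      using e by (auto simp: stabilizer_def)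
    then have "subgroup {d \<in> D. act d e = e} ?D"
      using e A.stabilizer_subgroup[of e] by auto
    then have sub: "subgroup {d \<in> D. act d e = e} G"
      using assms(2) incl_subgroup by blast
    have os: "card (orbit ?D ?\<phi> e) * card {d \<in> D. act d e = e} = card D"
      using A.orbit_stabilizer_theorem[of e] e st by (simp add: order_def)
    have "C \<subseteq> {d \<in> D. act d e = e}" using C e by auto
    then obtain n where n: "card {d \<in> D. act d e = e} = n * card C"
      using coset_card[OF C(1) sub] by blast
    have "card (orbit ?D ?\<phi> e) * n = q ^ m"
      using os n q(2) card_subgroup_pos[OF C(1)] by (simp add: mult.assoc [symmetric])
    then have "card (orbit ?D ?\<phi> e) dvd q ^ m" by (metis dvd_triv_left)
    then obtain j where j: "card (orbit ?D ?\<phi> e) = q ^ j"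
      using q(1) divides_primepow_nat by blast
    have "j \<noteq> 0"
    proof
      assume "j = 0"
      then obtain a where a: "orbit ?D ?\<phi> e = {a}" using j by (auto simp: card_1_singleton_iff)
      have "act d e = e" if "d \<in> D" for d
      proof -
        have "act d e \<in> {a}" "act \<one> e \<in> {a}" using a e that orb[of e] by auto
        then show ?thesis using e one[of e] by auto
      qed
      then show False using e F_def by auto
    qed
    then show ?thesis using j by (simp add: dvd_power)
  qed
  have Un: "\<Union>O' = E - F"
  proof
    show "E - F \<subseteq> \<Union>O'" using A.orbit_refl by (auto simp: O'_def)
    show "\<Union>O' \<subseteq> E - F"
    proof clarify
      fix x X assume "x \<in> X" "X \<in> O'"
      then obtain e d where ed: "e \<in> E" "e \<notin> F" "d \<in> D" "x = act d e"
        using orb by (auto simp: O'_def)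
      then have "x \<in> E" using closed by auto
      moreover have "x \<notin> F"
      proof
        assume "x \<in> F"
        then have "act (inv d) x = x" using ed by (auto simp: F_def)
        then have "x = e" using ed inv_act by auto
        with \<open>x \<in> F\<close> ed show False by simp
      qed
      ultimately show "x \<in> E - F" by simp
    qed
  qed
  have "q dvd card (\<Union>O')"
  proof (rule dvd_partition)
    show "finite (\<Union>O')" using Un assms(1) by simp
    show "\<forall>c\<in>O'. q dvd card c" using dvd by (auto simp: O'_def)
    have "O' \<subseteq> orbits ?D E ?\<phi>" by (auto simp: O'_def orbits_def)
    then show "\<forall>c1\<in>O'. \<forall>c2\<in>O'. c1 \<noteq> c2 \<longrightarrow> c1 \<inter> c2 = {}"
      using A.disjoint_union by blast
  qed
  then have "q dvd card (E - F)" using Un by simp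
  then obtain l where "card (E - F) = q * l" by auto
  moreover have "F \<subseteq> E" by (auto simp: F_def)
  then have "card E = card (E - F) + card F"
    using assms(1) by (simp add: card_Diff_subset finite_subset card_mono)
  ultimately show ?thesis by (simp add: F_def)
qed

end

section \<open>Fixed cosets, normalisers and Sylow subgroups\<close>

lemma prime_power_dvd_cases:
  fixes p q :: nat
  assumes "prime p" "prime q" "p \<noteq> q" "d dvd p ^ a" "d dvd q ^ b"
  shows "d = 1"
proof -
  have "coprime (p ^ a) (q ^ b)" using assms(1-3) by (simp add: primes_coprime)
  then show ?thesis using assms(4,5) coprime_common_divisor_nat by blast
qed

context group
begin

lemma lcoset_eq_iff:
  assumes "subgroup X G" "y \<in> carrier G" "z \<in> carrier G"
  shows "y <# X = z <# X \<longleftrightarrow> inv y \<otimes> z \<in> X"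
proof -
  interpret X: subgroup X G by fact
  have mem: "z \<in> y <# X \<longleftrightarrow> inv y \<otimes> z \<in> X"
  proof
    assume "z \<in> y <# X"
    then obtain x where "x \<in> X" "z = y \<otimes> x" by (auto simp: l_coset_def)
    then show "inv y \<otimes> z \<in> X" using assms(2) by simp
  next
    assume "inv y \<otimes> z \<in> X"
    moreover have "z = y \<otimes> (inv y \<otimes> z)" using assms by simp
    ultimately show "z \<in> y <# X" unfolding l_coset_def by blast
  qed
  have "z \<in> z <# X" using assms(3) X.one_closed by (force simp: l_coset_def)
  then show ?thesis using mem l_repr_independence[OF _ assms(2,1), of z] by blast
qed

lemma card_lcosets:
  assumes "finite S" "S \<subseteq> carrier G" "subgroup X G"
    and closed: "\<And>s x. \<lbrakk>s \<in> S; x \<in> X\<rbrakk> \<Longrightarrow> s \<otimes> x \<in> S"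
  shows "card S = card ((\<lambda>y. y <# X) ` S) * card X"
proof -
  interpret X: subgroup X G by fact
  have S: "s \<in> carrier G" if "s \<in> S" for s using that assms(2) by auto
  have Un: "\<Union>((\<lambda>y. y <# X) ` S) = S"
  proof
    show "\<Union>((\<lambda>y. y <# X) ` S) \<subseteq> S" using closed by (auto simp: l_coset_def)
    show "S \<subseteq> \<Union>((\<lambda>y. y <# X) ` S)"
    proof
      fix s assume s: "s \<in> S"
      then have "s \<in> s <# X" using S[OF s] X.one_closed by (force simp: l_coset_def)
      then show "s \<in> \<Union>((\<lambda>y. y <# X) ` S)" using s by blast
    qed
  qed
  have card: "card c = card X" if "c \<in> (\<lambda>y. y <# X) ` S" for c
  proof -
    obtain y where y: "y \<in> S" "c = y <# X" using \<open>c \<in> _\<close> by auto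
    then have "c = (\<lambda>x. y \<otimes> x) ` X" by (auto simp: l_coset_def)
    moreover have "inj_on (\<lambda>x. y \<otimes> x) X" using S[OF y(1)] by (auto simp: inj_on_def)
    ultimately show ?thesis by (simp add: card_image)
  qed
  have "pairwise disjnt ((\<lambda>y. y <# X) ` S)"
  proof (rule pairwiseI, clarify)
    fix y z assume yz: "y \<in> S" "z \<in> S" "y <# X \<noteq> z <# X"
    have False if "w \<in> y <# X" "w \<in> z <# X" for w
      using l_repr_independence[OF that(1) S[OF yz(1)] assms(3)]
        l_repr_independence[OF that(2) S[OF yz(2)] assms(3)] yz(3) by simp
    then show "disjnt (y <# X) (z <# X)" by (auto simp: disjnt_def)
  qed
  moreover have "finite c" if "c \<in> (\<lambda>y. y <# X) ` S" for c
    using Un assms(1) that by (metis Sup_upper finite_subset)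
  ultimately have "card (\<Union>((\<lambda>y. y <# X) ` S)) = (\<Sum>c\<in>(\<lambda>y. y <# X) ` S. card c)"
    by (intro card_Union_disjoint) auto
  then show ?thesis using Un card by simp
qed

end

context finite_group
begin

text \<open>\<open>D\<close> acts by left multiplication on the cosets \<open>yX\<close> inside
  \<open>K\<close>, and \<open>yX\<close> is fixed exactly when conjugation by \<open>inv y\<close>
  carries \<open>D\<close> into \<open>X\<close>. With \<open>X\<close> a Sylow subgroup this gives
  Sylow conjugacy, with \<open>D = X\<close> a congruence for the normaliser.\<close>

lemma fixed_lcosets_mod:
  assumes sub: "subgroup D G" "subgroup K G" "subgroup X G" "D \<subseteq> K" "X \<subseteq> K"
    and C: "subgroup C G" "C \<subseteq> D" "\<And>c y. \<lbrakk>c \<in> C; y \<in> K\<rbrakk> \<Longrightarrow> cj (inv y) c \<in> X"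
    and q: "prime q" "card D = q ^ m * card C"
    and n: "card K = n * card X"
  obtains n' where "card {y \<in> K. \<forall>d\<in>D. cj (inv y) d \<in> X} = n' * card X" "n mod q = n' mod q"
proof -
  interpret D: subgroup D G by fact
  interpret K: subgroup K G by fact
  interpret X: subgroup X G by fact
  define F where "F = {y \<in> K. \<forall>d\<in>D. cj (inv y) d \<in> X}"
  let ?c = "\<lambda>y. y <# X"
  have D: "d \<in> K" if "d \<in> D" for d using that sub by auto
  have X: "x \<in> K" if "x \<in> X" for x using that sub by auto
  have fix_iff: "d <# (y <# X) = y <# X \<longleftrightarrow> cj (inv y) d \<in> X" if "d \<in> D" "y \<in> K" for d y
  proof -
    have "d <# (y <# X) = y <# X \<longleftrightarrow> y <# X = (d \<otimes> y) <# X"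
      using that by (auto simp: lcos_m_assoc X.subset)
    also have "\<dots> \<longleftrightarrow> inv y \<otimes> (d \<otimes> y) \<in> X"
      using that by (intro lcoset_eq_iff sub(3)) auto
    also have "inv y \<otimes> (d \<otimes> y) = cj (inv y) d"
      using that by (simp add: cj_def group_word_simps)
    finally show ?thesis .
  qed
  have "card (?c ` K) mod q = card {e \<in> ?c ` K. \<forall>d\<in>D. d <# e = e} mod q"
  proof (rule card_fixed_points_mod[OF _ sub(1) _ _ _ C(1,2) _ q])
    show "finite (?c ` K)" using sub by auto
    show "d <# e \<in> ?c ` K" if "d \<in> D" "e \<in> ?c ` K" for d e
      using that D X.subset by (auto simp: lcos_m_assoc)
    show "\<one> <# e = e" if "e \<in> ?c ` K" for e
      using that X.subset by (auto simp: lcos_m_assoc)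
    show "(d \<otimes> d') <# e = d <# (d' <# e)" if "d \<in> D" "d' \<in> D" "e \<in> ?c ` K" for d d' e
      using that X.subset by (auto simp: lcos_m_assoc m_assoc)
    show "c <# e = e" if "c \<in> C" "e \<in> ?c ` K" for c e
    proof -
      obtain y where y: "y \<in> K" "e = y <# X" using \<open>e \<in> _\<close> by auto
      moreover have "c \<in> D" using that C(2) by auto
      ultimately show ?thesis using fix_iff[of c y] C(3) \<open>c \<in> C\<close> by simp
    qed
  qed
  also have "{e \<in> ?c ` K. \<forall>d\<in>D. d <# e = e} = ?c ` F"
    using fix_iff by (auto simp: F_def)
  finally have mod: "card (?c ` K) mod q = card (?c ` F) mod q" .
  have "card K = card (?c ` K) * card X"
    using sub X by (intro card_lcosets K.subset finite_subgroup) auto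
  then have "n = card (?c ` K)"
    using n card_subgroup_pos[OF sub(3)] by simp
  moreover have "card F = card (?c ` F) * card X"
  proof (rule card_lcosets)
    show "F \<subseteq> carrier G" "finite F" using sub(2) by (auto simp: F_def)
    show "s \<otimes> x \<in> F" if "s \<in> F" "x \<in> X" for s x
    proof -
      have "cj (inv (s \<otimes> x)) d = cj (inv x) (cj (inv s) d)" if "d \<in> D" for d
        using that \<open>s \<in> F\<close> \<open>x \<in> X\<close> by (auto simp: F_def cj_mult_left inv_mult_group)
      moreover have "cj (inv x) z \<in> X" if "z \<in> X" for z
        using normalizesD[OF normalizes_self[OF sub(3)] X.m_inv_closed[OF \<open>x \<in> X\<close>] that] .
      ultimately show ?thesis
        using \<open>s \<in> F\<close> \<open>x \<in> X\<close> X by (auto simp: F_def)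
    qed
  qed (use sub in auto)
  ultimately show ?thesis using mod that by (metis F_def)
qed

lemma subgroup_subset_normalizer:
  assumes "subgroup X G" "X \<subseteq> Y"
  shows "X \<subseteq> {y \<in> Y. cj y ` X = X}"
proof
  fix x assume x: "x \<in> X"
  have "cj x ` X \<subseteq> X" using normalizesD[OF normalizes_self[OF assms(1)] x] by auto
  then have "cj x ` X = X"
    using subgroup.mem_carrier[OF assms(1) x] subgroup.subset[OF assms(1)] assms(1)
    by (intro cj_image_eq) auto
  then show "x \<in> {y \<in> Y. cj y ` X = X}" using x assms(2) by auto
qed

text \<open>For \<open>D = X\<close> the fixed cosets are those inside the normaliser, because by
  finiteness a conjugate of \<open>X\<close> contained in \<open>X\<close> equals it.\<close>

lemma normalizer_index_mod:
  assumes sub: "subgroup X G" "subgroup Y G" "X \<subseteq> Y"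
    and C: "subgroup C G" "C \<subseteq> X" "normalizes G Y C"
    and q: "prime q" "card X = q ^ m * card C"
    and n: "card Y = n * card X"
  obtains n' where "card {y \<in> Y. cj y ` X = X} = n' * card X" "n mod q = n' mod q"
proof -
  interpret X: subgroup X G by fact
  interpret Y: subgroup Y G by fact
  have *: "cj (inv y) c \<in> X" if "c \<in> C" "y \<in> Y" for c y
    using C normalizesD[OF C(3), of "inv y" c] that by auto
  have "{y \<in> Y. \<forall>d\<in>X. cj (inv y) d \<in> X} = {y \<in> Y. cj y ` X = X}"
  proof (intro Collect_cong conj_cong refl)
    fix y assume y: "y \<in> Y"
    have "(\<forall>d\<in>X. cj (inv y) d \<in> X) \<longleftrightarrow> cj (inv y) ` X = X"
      using cj_image_eq[of "inv y" X] y sub X.subset by auto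
    also have "\<dots> \<longleftrightarrow> cj y ` X = X"
    proof
      assume *: "cj (inv y) ` X = X"
      have "cj y ` cj (inv y) ` X = (\<lambda>x. x) ` X"
        unfolding image_image using y by (intro image_cong) auto
      with * show "cj y ` X = X" by simp
    next
      assume *: "cj y ` X = X"
      have "cj (inv y) ` cj y ` X = (\<lambda>x. x) ` X"
        unfolding image_image using y by (intro image_cong) auto
      with * show "cj (inv y) ` X = X" by simp
    qed
    finally show "(\<forall>d\<in>X. cj (inv y) d \<in> X) = (cj y ` X = X)" .
  qed
  with fixed_lcosets_mod[OF sub(1,2,1,3,3) C(1,2) * q n] that show ?thesis by auto
qed

text \<open>The index of \<open>X\<close> in \<open>Y\<close> is a nontrivial power of
  \<open>q\<close>, so the index of \<open>X\<close> in its normaliser is divisible by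
  \<open>q\<close> and cannot be 1.\<close>

lemma normalizer_grows:
  assumes sub: "subgroup X G" "subgroup Y G" "X \<subset> Y"
    and C: "subgroup C G" "C \<subseteq> X" "normalizes G Y C"
    and q: "prime q" "card Y = q ^ m * card C"
  obtains y where "y \<in> Y" "y \<notin> X" "cj y ` X = X"
proof -
  obtain n where n: "card Y = n * card X" using coset_card[OF sub(1,2)] sub(3) by auto
  obtain l where l: "card X = l * card C" using coset_card[OF C(1) sub(1) C(2)] by auto
  have nl: "n * l = q ^ m" using n l q(2) card_subgroup_pos[OF C(1)] by simp
  then have "l dvd q ^ m" "n dvd q ^ m" by (metis dvd_triv_right, metis dvd_triv_left)
  then obtain a b where ab: "l = q ^ a" "n = q ^ b"
    using q(1) divides_primepow_nat by metis
  have "b \<noteq> 0"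
  proof
    assume "b = 0"
    then have "card X = card Y" using n ab by simp
    then show False using card_eq_imp_eq[OF sub(2), of X] sub(3) by auto
  qed
  obtain n' where n': "card {y \<in> Y. cj y ` X = X} = n' * card X" "n mod q = n' mod q"
    using normalizer_index_mod[OF sub(1,2) _ C q(1) _ n, of a] sub(3) l ab by auto
  have "n' \<noteq> 1"
    using n'(2) ab \<open>b \<noteq> 0\<close> prime_gt_1_nat[OF q(1)] by (auto simp: mod_eq_0_iff_dvd dvd_power)
  have "\<not> {y \<in> Y. cj y ` X = X} \<subseteq> X"
  proof
    assume "{y \<in> Y. cj y ` X = X} \<subseteq> X"
    moreover have "X \<subseteq> {y \<in> Y. cj y ` X = X}"
      by (rule subgroup_subset_normalizer[OF sub(1) psubset_imp_subset[OF sub(3)]])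
    ultimately have "{y \<in> Y. cj y ` X = X} = X" by auto
    then show False using n'(1) \<open>n' \<noteq> 1\<close> card_subgroup_pos[OF sub(1)] by auto
  qed
  then show ?thesis using that by auto
qed

lemma subgroup_between_prime_index:
  assumes "subgroup X G" "subgroup Y G" "subgroup Z G" "X \<subseteq> Z" "Z \<subseteq> Y"
    and "prime p" "card Y = p * card X"
  shows "Z = X \<or> Z = Y"
proof -
  obtain l where l: "card Z = l * card X" using coset_card[OF assms(1,3,4)] by auto
  obtain k where k: "card Y = k * card Z" using coset_card[OF assms(3,2,5)] by auto
  have "k * l = p" using k l assms(7) card_subgroup_pos[OF assms(1)] by simp
  then have "k = 1 \<or> l = 1" using assms(6) by (metis prime_product)
  then have "card Z = card Y \<or> card X = card Z" using k l by auto
  then show ?thesis using card_eq_imp_eq[OF assms(2,5)] card_eq_imp_eq[OF assms(3,4)] by blast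
qed

text \<open>Prime index makes \<open>X\<close> maximal in \<open>Y\<close>, and the element
  \<open>y\<close> makes the normaliser strictly larger than \<open>X\<close>.\<close>

lemma prime_index_normalizes:
  assumes sub: "subgroup X G" "subgroup Y G" "X \<subseteq> Y" and "prime p" "card Y = p * card X"
    and y: "y \<in> Y" "y \<notin> X" "cj y ` X = X"
  shows "normalizes G Y X"
proof -
  let ?N = "{y \<in> Y. cj y ` X = X}"
  have X: "X \<subseteq> ?N"
    by (rule subgroup_subset_normalizer[OF sub(1) sub(3)])
  have "?N = X \<or> ?N = Y"
    using subgroup_normalizer[OF sub(2) subgroup.subset[OF sub(1)]] X assms
    by (intro subgroup_between_prime_index[where p = p]) auto
  then have "?N = Y" using y by auto
  then show ?thesis unfolding normalizes_iff by blast
qed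

section \<open>Sylow subgroups and fixed points of \<open>p\<close>-groups\<close>

lemma sylow_exists:
  assumes "subgroup K G" "prime p"
  obtains S where "subgroup S G" "S \<subseteq> K" "card S = p ^ multiplicity p (card K)"
proof -
  have gK: "group (G\<lparr>carrier := K\<rparr>)" using assms(1) by (rule subgroup_imp_group)
  obtain m where "card K = p ^ multiplicity p (card K) * m"
    using multiplicity_dvd by (metis dvdE)
  then have "order (G\<lparr>carrier := K\<rparr>) = p ^ multiplicity p (card K) * m" by (simp add: order_def)
  then obtain S where S: "subgroup S (G\<lparr>carrier := K\<rparr>)" "card S = p ^ multiplicity p (card K)"
    using sylow_thm[OF assms(2) gK] assms(1) by auto
  then show ?thesis
    using that incl_subgroup[OF assms(1) S(1)] subgroup.subset[OF S(1)] by auto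
qed

text \<open>The index of \<open>S\<close> in \<open>K\<close> is prime to \<open>p\<close>, so the
  \<open>p\<close>-group \<open>P\<close> fixes some coset \<open>yS\<close>, which says that
  \<open>P\<close> lies in the conjugate of \<open>S\<close> by \<open>y\<close>.\<close>

lemma sylow_contains_conjugate:
  assumes sub: "subgroup P G" "subgroup S G" "subgroup K G" "P \<subseteq> K" "S \<subseteq> K"
    and "prime p" "card P = p ^ a" "card S = p ^ multiplicity p (card K)"
  obtains g where "g \<in> K" "P \<subseteq> cj g ` S"
proof -
  obtain n where n: "card K = n * card S" using coset_card[OF sub(2,3,5)] by auto
  have np: "\<not> p dvd n"
  proof
    assume "p dvd n"
    then have "p ^ Suc (multiplicity p (card K)) dvd card K"
      using n assms(8) by (metis mult_dvd_mono dvd_refl power_Suc)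
    then show False
      using card_subgroup_pos[OF sub(3)] assms(6) not_prime_unit
      by (metis Suc_n_not_le_n multiplicity_geI neq0_conv)
  qed
  obtain n' where n': "card {y \<in> K. \<forall>d\<in>P. cj (inv y) d \<in> S} = n' * card S" "n mod p = n' mod p"
  proof (rule fixed_lcosets_mod[OF sub(1,3,2,4,5) triv_subgroup _ _ assms(6) _ n])
    show "{\<one>} \<subseteq> P" using sub(1) by (simp add: subgroup.one_closed)
    show "cj (inv y) c \<in> S" if "c \<in> {\<one>}" "y \<in> K" for c y
      using that sub(2) subgroup.mem_carrier[OF sub(3)] by (auto simp: subgroup.one_closed)
    show "card P = p ^ a * card {\<one>}" using assms(7) by simp
  qed
  have "n' \<noteq> 0" using n'(2) np by (metis dvd_eq_mod_eq_0 mod_0)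
  then have "{y \<in> K. \<forall>d\<in>P. cj (inv y) d \<in> S} \<noteq> {}"
    using n'(1) card_subgroup_pos[OF sub(2)] by (metis card.empty mult_is_0 neq0_conv)
  then obtain y where y: "y \<in> K" "\<And>d. d \<in> P \<Longrightarrow> cj (inv y) d \<in> S" by auto
  have "P \<subseteq> cj y ` S"
  proof
    fix d assume d: "d \<in> P"
    have "d = cj y (cj (inv y) d)"
      using y(1) d subgroup.mem_carrier[OF sub(3)] subgroup.mem_carrier[OF sub(1)] by simp
    then show "d \<in> cj y ` S" using y(2)[OF d] by blast
  qed
  then show ?thesis using y(1) that by blast
qed

lemma p_group_fixed_point:
  assumes "subgroup D G" "prime p" "card D = p ^ a"
    and E: "finite E" "E \<subseteq> carrier G" "\<And>d e. \<lbrakk>d \<in> D; e \<in> E\<rbrakk> \<Longrightarrow> cj d e \<in> E"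
  shows "card E mod p = card {e \<in> E. \<forall>d\<in>D. cj d e = e} mod p"
proof (rule card_fixed_points_mod[OF E(1) assms(1) E(3) _ _ triv_subgroup _ _ assms(2)])
  have E': "e \<in> carrier G" if "e \<in> E" for e using that E(2) by auto
  show "{\<one>} \<subseteq> D" using assms(1) by (simp add: subgroup.one_closed)
  show "card D = p ^ a * card {\<one>}" using assms(3) by simp
  show "cj \<one> e = e" if "e \<in> E" for e using E'[OF that] by simp
  show "cj c e = e" if "c \<in> {\<one>}" "e \<in> E" for c e using E' that by simp
  show "cj (d \<otimes> d') e = cj d (cj d' e)" if "d \<in> D" "d' \<in> D" "e \<in> E" for d d' e
    using that E' subgroup.mem_carrier[OF assms(1)] by (simp add: cj_mult_left)
qed

text \<open>The number of fixed points is a multiple of \<open>p\<close>, since \<open>p\<close>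
  divides the order of \<open>V\<close>, so the identity is not the only one.\<close>

lemma p_group_centralizes_nontrivial:
  assumes "subgroup D G" "subgroup V G" "prime p" "card D = p ^ a" "card V = p ^ b" "V \<noteq> {\<one>}"
    and "normalizes G D V"
  obtains v where "v \<in> V" "v \<noteq> \<one>" "\<forall>d\<in>D. cj d v = v"
proof -
  let ?F = "{v \<in> V. \<forall>d\<in>D. cj d v = v}"
  have sub: "subgroup ?F G"
    using subgroup_fixed_points[OF assms(2) subgroup.subset[OF assms(1)]] .
  have "card V mod p = card ?F mod p"
    using p_group_fixed_point[OF assms(1,3,4) finite_subgroup[OF assms(2)] subgroup.subset[OF assms(2)]]
      normalizesD[OF assms(7)] by blast
  moreover have "b \<noteq> 0" using assms(5,6) card_one_iff[OF assms(2)] by (metis power_0)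
  ultimately have "card ?F mod p = 0" using assms(5) by (simp add: mod_eq_0_iff_dvd dvd_power)
  then have "card ?F \<noteq> 1" using prime_gt_1_nat[OF assms(3)] by auto
  then have "?F \<noteq> {\<one>}" using card_one_iff[OF sub] by blast
  then obtain v where "v \<in> ?F" "v \<noteq> \<one>" using subgroup.one_closed[OF sub] by blast
  then show ?thesis using that by blast
qed

text \<open>Every prime power in the order of \<open>A\<close> divides that of \<open>D\<close>.
  When the elements of \<open>A\<close> with some property form a subgroup, this reduces the
  property to one Sylow subgroup for each prime.\<close>

lemma subgroup_eq_by_sylow:
  assumes "subgroup D G" "subgroup A G" "D \<subseteq> A"
    and "\<And>s. prime s \<Longrightarrow> \<exists>S. subgroup S G \<and> S \<subseteq> D \<and> card S = s ^ multiplicity s (card A)"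
  shows "D = A"
proof -
  have "card A dvd card D"
  proof (rule multiplicity_le_imp_dvd)
    show "card A \<noteq> 0" using card_subgroup_pos[OF assms(2)] by simp
    fix s :: nat assume s: "prime s"
    then obtain S where S: "subgroup S G" "S \<subseteq> D" "card S = s ^ multiplicity s (card A)"
      using assms(4) by blast
    then have "s ^ multiplicity s (card A) dvd card D"
      using card_subgroup_dvd[OF S(1) assms(1) S(2)] by simp
    then show "multiplicity s (card A) \<le> multiplicity s (card D)"
      using card_subgroup_pos[OF assms(1)] s not_prime_unit by (intro multiplicity_geI) auto
  qed
  then have "card A = card D"
    using card_subgroup_dvd[OF assms(1-3)] by (simp add: dvd_antisym)
  then show ?thesis using card_eq_imp_eq assms by simp
qed

lemma p_subgroup_subset_normal_sylow:
  assumes "subgroup P G" "subgroup S G" "subgroup K G" "P \<subseteq> K" "S \<subseteq> K"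
    and "prime p" "card P = p ^ a" "card S = p ^ multiplicity p (card K)" "normalizes G K S"
  shows "P \<subseteq> S"
proof -
  obtain g where "g \<in> K" "P \<subseteq> cj g ` S" using sylow_contains_conjugate[OF assms(1-8)] by blast
  then show ?thesis using normalizesD[OF assms(9)] by blast
qed

end

section \<open>Nilpotency relative to a bottom subgroup\<close>

text \<open>The bottom \<open>C\<close> expresses nilpotency of \<open>Y / C\<close> inside
  \<open>G\<close>. Normality of the terms in \<open>Y\<close> is contained in the commutator
  condition: conjugating an element of \<open>K i\<close> changes it by a factor from
  \<open>K i\<close>.\<close>

definition nilpotent_over :: "('a, 'b) monoid_scheme \<Rightarrow> 'a set \<Rightarrow> 'a set \<Rightarrow> bool" where
  "nilpotent_over G C Y \<longleftrightarrow> (\<exists>(K :: nat \<Rightarrow> 'a set) n. K 0 = C \<and> K n = Y \<and>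
     (\<forall>i\<le>n. subgroup (K i) G) \<and>
     (\<forall>i<n. K i \<subseteq> K (Suc i) \<and> (\<forall>x\<in>K (Suc i). \<forall>y\<in>Y. group.cj G y x \<otimes>\<^bsub>G\<^esub> inv\<^bsub>G\<^esub> x \<in> K i)))"

context group
begin

lemma nilpotent_group_imp_over:
  assumes "nilpotent_group G"
  shows "nilpotent_over G {\<one>} (carrier G)"
proof -
  obtain K :: "nat \<Rightarrow> 'a set" and n where *: "K 0 = {\<one>}" "K n = carrier G" "\<forall>i\<le>n. K i \<lhd> G"
    "\<forall>i<n. K i \<subseteq> K (Suc i) \<and>
      carrier ((G\<lparr>carrier := K (Suc i)\<rparr>) Mod K i) \<subseteq> group_centre (G Mod K i)"
    using assms unfolding nilpotent_group_def by (elim exE conjE) (rule that)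
  from *(3) have normal: "K i \<lhd> G" if "i \<le> n" for i using that by simp
  from *(4) have chain: "K i \<subseteq> K (Suc i)"
    "carrier ((G\<lparr>carrier := K (Suc i)\<rparr>) Mod K i) \<subseteq> group_centre (G Mod K i)" if "i < n" for i
    using that by auto
  have "cj y x \<otimes> inv x \<in> K i" if i: "i < n" and x: "x \<in> K (Suc i)" and y: "y \<in> carrier G" for i x y
  proof -
    interpret N: normal "K i" G using normal i by simp
    have xc: "x \<in> carrier G"
      using normal[of "Suc i"] i x by (meson Suc_leI normal_imp_subgroup subgroup.mem_carrier)
    have "K i #> x \<in> carrier ((G\<lparr>carrier := K (Suc i)\<rparr>) Mod K i)"
      using x by (auto simp: FactGroup_def RCOSETS_def)
    then have "K i #> x \<in> group_centre (G Mod K i)" using chain(2)[OF i] by blast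
    moreover have "K i #> y \<in> carrier (G Mod K i)" using y by (auto simp: FactGroup_def RCOSETS_def)
    ultimately have "(K i #> x) <#> (K i #> y) = (K i #> y) <#> (K i #> x)"
      by (simp add: group_centre_def)
    then have "K i #> (x \<otimes> y) = K i #> (y \<otimes> x)" using xc y by (simp add: N.rcos_sum)
    then have "y \<otimes> x \<in> K i #> (x \<otimes> y)"
      using repr_independenceD[OF N.subgroup_axioms, of "y \<otimes> x" "x \<otimes> y"] xc y by auto
    then have "(y \<otimes> x) \<otimes> inv (x \<otimes> y) \<in> K i"
      using N.rcos_module_imp[OF is_group, of "x \<otimes> y" "y \<otimes> x"] xc y by auto
    then show ?thesis using xc y by (simp add: cj_def group_word_simps)
  qed
  then show ?thesis
    unfolding nilpotent_over_def using *(1,2) normal_imp_subgroup[OF normal] chain(1)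
    by (intro exI[of _ K] exI[of _ n]) simp
qed

lemma nilpotent_over_restrict:
  assumes "subgroup A G" "nilpotent_over (G\<lparr>carrier := A\<rparr>) C A"
  shows "nilpotent_over G C A"
proof -
  have gA: "group (G\<lparr>carrier := A\<rparr>)" using assms(1) by (rule subgroup_imp_group)
  have cjA: "group.cj (G\<lparr>carrier := A\<rparr>) y x = cj y x" if "y \<in> A" for x y
    using that assms(1) by (simp add: group.cj_def[OF gA] cj_def)
  obtain K :: "nat \<Rightarrow> 'a set" and n where K: "K 0 = C" "K n = A"
    "\<And>i. i \<le> n \<Longrightarrow> subgroup (K i) (G\<lparr>carrier := A\<rparr>)" "\<And>i. i < n \<Longrightarrow> K i \<subseteq> K (Suc i)"
    "\<And>i x y. \<lbrakk>i < n; x \<in> K (Suc i); y \<in> A\<rbrakk> \<Longrightarrow>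
      group.cj (G\<lparr>carrier := A\<rparr>) y x \<otimes> inv\<^bsub>G\<lparr>carrier := A\<rparr>\<^esub> x \<in> K i"
    using assms(2) unfolding nilpotent_over_def by auto
  have "cj y x \<otimes> inv x \<in> K i" if "i < n" "x \<in> K (Suc i)" "y \<in> A" for i x y
  proof -
    have "x \<in> A" using subgroup.subset[OF K(3)[of "Suc i"]] that by auto
    then show ?thesis using K(5)[OF that] cjA that assms(1) by simp
  qed
  then show ?thesis
    unfolding nilpotent_over_def using K incl_subgroup[OF assms(1)] by (intro exI[of _ K] exI[of _ n]) auto
qed

lemma nilpotent_subgroup_imp_over:
  assumes "subgroup A G" "nilpotent_group (G\<lparr>carrier := A\<rparr>)"
  shows "nilpotent_over G {\<one>} A"
  using group.nilpotent_group_imp_over[OF subgroup_imp_group[OF assms(1)] assms(2)]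
  by (intro nilpotent_over_restrict[OF assms(1)]) simp

text \<open>Let \<open>K i\<close> be the first term not contained in \<open>X\<close>. An element
  of \<open>K i\<close> outside \<open>X\<close> has its commutators with \<open>X\<close> in the
  previous term, hence in \<open>X\<close>, and so it normalises \<open>X\<close>.\<close>

lemma nilpotent_over_normalizer_grows:
  assumes "nilpotent_over G C Y" "subgroup X G" "C \<subseteq> X" "X \<subset> Y"
  obtains y where "y \<in> Y" "y \<notin> X" "\<forall>x\<in>X. cj y x \<in> X"
proof -
  obtain K :: "nat \<Rightarrow> 'a set" and n where K: "K 0 = C" "K n = Y"
    "\<And>i. i \<le> n \<Longrightarrow> subgroup (K i) G" "\<And>i. i < n \<Longrightarrow> K i \<subseteq> K (Suc i)"
    "\<And>i x y. \<lbrakk>i < n; x \<in> K (Suc i); y \<in> Y\<rbrakk> \<Longrightarrow> cj y x \<otimes> inv x \<in> K i"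
    using assms(1) unfolding nilpotent_over_def by auto
  interpret X: subgroup X G by fact
  have n: "\<not> K n \<subseteq> X" using K(2) assms(4) by auto
  then obtain i where "\<not> K i \<subseteq> X" and least: "\<And>j. j < i \<Longrightarrow> K j \<subseteq> X"
    using exists_least_iff[of "\<lambda>i. \<not> K i \<subseteq> X"] by auto
  then have i: "\<not> K i \<subseteq> X" "i \<le> n" using least n by (auto simp: not_less [symmetric])
  have "i \<noteq> 0" using i(1) K(1) assms(3) by auto
  then obtain j where j: "i = Suc j" by (cases i) auto
  have KY: "K i \<subseteq> Y"
  proof -
    have "K (i + d) \<subseteq> Y \<Longrightarrow> i + d \<le> n \<Longrightarrow> K i \<subseteq> Y" for d
    proof (induction d)
      case (Suc d)
      then show ?case using K(4)[of "i + d"] by auto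
    qed simp
    from this[of "n - i"] show ?thesis using i K(2) by simp
  qed
  obtain y where y: "y \<in> K i" "y \<notin> X" using i by auto
  have yc: "y \<in> carrier G" using subgroup.mem_carrier[OF K(3)[OF i(2)] y(1)] .
  have "cj y x \<in> X" if x: "x \<in> X" for x
  proof -
    have "cj (inv x) y \<otimes> inv y \<in> K j"
      using K(5)[of j y "inv x"] i j y x assms(4) by auto
    then have "cj (inv x) y \<otimes> inv y \<in> X" using least[of j] j by auto
    then have "x \<otimes> (cj (inv x) y \<otimes> inv y) \<in> X" using x by simp
    moreover have "x \<otimes> (cj (inv x) y \<otimes> inv y) = cj y x"
      using yc x by (simp add: cj_def group_word_simps)
    ultimately show ?thesis by simp
  qed
  then show ?thesis using that y KY by auto
qed

text \<open>In the first term of the series that meets \<open>V\<close> nontrivially, take a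
  nontrivial \<open>v\<close> from \<open>V\<close>. Its commutators with \<open>A\<close> lie in
  \<open>V\<close> and in the previous term, so they vanish.\<close>

lemma nilpotent_normal_meets_centre:
  assumes "nilpotent_over G {\<one>} A" "subgroup V G" "V \<subseteq> A" "normalizes G A V" "V \<noteq> {\<one>}"
  obtains v where "v \<in> V" "v \<noteq> \<one>" "\<forall>a\<in>A. cj a v = v"
proof -
  obtain K :: "nat \<Rightarrow> 'a set" and n where K: "K 0 = {\<one>}" "K n = A"
    "\<And>i. i \<le> n \<Longrightarrow> subgroup (K i) G"
    "\<And>i x y. \<lbrakk>i < n; x \<in> K (Suc i); y \<in> A\<rbrakk> \<Longrightarrow> cj y x \<otimes> inv x \<in> K i"
    using assms(1) unfolding nilpotent_over_def by auto
  interpret V: subgroup V G by fact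
  have Ac: "subgroup A G" using K(2,3) by auto
  have n: "\<not> V \<inter> K n \<subseteq> {\<one>}" using K(2) assms(3,5) V.one_closed by auto
  then obtain i where i: "\<not> V \<inter> K i \<subseteq> {\<one>}" and least: "\<And>j. j < i \<Longrightarrow> V \<inter> K j \<subseteq> {\<one>}"
    using exists_least_iff[of "\<lambda>i. \<not> V \<inter> K i \<subseteq> {\<one>}"] by auto
  have "i \<le> n" using least n by (meson leI)
  have "i \<noteq> 0" using i K(1) by (metis inf_le2)
  then obtain j where j: "i = Suc j" by (cases i) auto
  obtain v where v: "v \<in> V" "v \<in> K i" "v \<noteq> \<one>" using i by auto
  have "cj a v = v" if a: "a \<in> A" for a
  proof -
    have ac: "a \<in> carrier G" using subgroup.mem_carrier[OF Ac a] .
    have "cj a v \<in> V" using normalizesD[OF assms(4) a v(1)] .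
    then have "cj a v \<otimes> inv v \<in> V \<inter> K j" using K(4)[of j v a] i \<open>i \<le> n\<close> j v a by auto
    then have "cj a v \<otimes> inv v = \<one>" using least[of j] j by auto
    then show ?thesis using v ac by (simp add: inv_equality inv_solve_right' )
  qed
  then show ?thesis using that v by blast
qed

end

context finite_group
begin

text \<open>\<open>S\<close> is normal in its normaliser \<open>?N\<close>, hence contains every
  conjugate of itself that lies in \<open>?N\<close>. Whatever normalises \<open>?N\<close>
  therefore normalises \<open>S\<close>, so \<open>?N\<close> is self-normalising, which nilpotency
  allows only for \<open>A\<close> itself.\<close>

lemma nilpotent_sylow_normal:
  assumes "subgroup A G" "nilpotent_over G {\<one>} A" "prime s"
  obtains S where "subgroup S G" "S \<subseteq> A" "card S = s ^ multiplicity s (card A)" "normalizes G A S"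
proof -
  obtain S where S: "subgroup S G" "S \<subseteq> A" "card S = s ^ multiplicity s (card A)"
    using sylow_exists[OF assms(1,3)] .
  let ?N = "{y \<in> A. cj y ` S = S}"
  have sc: "S \<subseteq> carrier G" using subgroup.subset[OF S(1)] .
  have N: "subgroup ?N G" using subgroup_normalizer[OF assms(1) sc] .
  have SN: "S \<subseteq> ?N"
    by (rule subgroup_subset_normalizer[OF S(1) S(2)])
  have mult: "card S = s ^ multiplicity s (card ?N)"
  proof -
    have "multiplicity s (card S) \<le> multiplicity s (card ?N)"
      using card_subgroup_dvd[OF S(1) N SN] card_subgroup_pos[OF N] by (intro dvd_imp_multiplicity_le) auto
    moreover have "multiplicity s (card ?N) \<le> multiplicity s (card A)"
      using card_subgroup_dvd[OF N assms(1)] card_subgroup_pos[OF assms(1)] by (intro dvd_imp_multiplicity_le) auto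
    moreover have "multiplicity s (card S) = multiplicity s (card A)"
      using S(3) assms(3) by (simp add: multiplicity_same_power prime_gt_0_nat not_prime_unit)
    ultimately have "multiplicity s (card ?N) = multiplicity s (card A)" by linarith
    then show ?thesis using S(3) by simp
  qed
  have "?N = A"
  proof (rule ccontr)
    assume "?N \<noteq> A"
    then have lt: "?N \<subset> A" by auto
    have one: "{\<one>} \<subseteq> ?N" using subgroup.one_closed[OF N] by simp
    obtain y where y: "y \<in> A" "y \<notin> ?N" "\<forall>x\<in>?N. cj y x \<in> ?N"
      by (rule nilpotent_over_normalizer_grows[OF assms(2) N one lt])
    have yc: "y \<in> carrier G" using subgroup.mem_carrier[OF assms(1) y(1)] .
    have "cj y ` S \<subseteq> S"
    proof (rule p_subgroup_subset_normal_sylow[OF _ S(1) N _ SN assms(3) _ mult])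
      show "subgroup (cj y ` S) G" using subgroup_cj_image[OF yc S(1)] .
      show "cj y ` S \<subseteq> ?N" using y(3) SN by blast
      show "card (cj y ` S) = s ^ multiplicity s (card A)" using card_cj_image[OF yc sc] S(3) by simp
      show "normalizes G ?N S" unfolding normalizes_iff by blast
    qed
    then have "cj y ` S = S" using cj_image_eq[OF yc sc] S(1) by auto
    then show False using y by auto
  qed
  then have "normalizes G A S" unfolding normalizes_iff by blast
  then show ?thesis using that S by blast
qed

end

section \<open>Modular steps\<close>

text \<open>The constraint on \<open>C\<close> is weaker than being the core of \<open>X\<close> in \<open>Y\<close>, and non-nilpotency
  is omitted: if \<open>X\<close> is not normalised by \<open>Y\<close>, both are automatic.\<close>

definition modular_step :: "nat \<Rightarrow> ('a, 'b) monoid_scheme \<Rightarrow> 'a set \<Rightarrow> 'a set \<Rightarrow> bool" where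
  "modular_step k G X Y \<longleftrightarrow> subgroup X G \<and> subgroup Y G \<and> X \<subseteq> Y \<and>
     (normalizes G Y X \<or>
      (\<exists>(p :: nat) (q :: nat) m C. prime p \<and> prime q \<and> m \<le> k \<and> card Y = p * card X \<and>
         subgroup C G \<and> C \<subseteq> X \<and> normalizes G Y C \<and> card X = q ^ m * card C))"

abbreviation modular_chain :: "nat \<Rightarrow> ('a, 'b) monoid_scheme \<Rightarrow> 'a set \<Rightarrow> 'a set \<Rightarrow> bool" where
  "modular_chain k G \<equiv> (modular_step k G)\<^sup>*\<^sup>*"

lemma modular_stepE:
  assumes "modular_step k G X Y"
  obtains (normal) "subgroup X G" "subgroup Y G" "X \<subseteq> Y" "normalizes G Y X"
  | (prime_index) p q m C where "subgroup X G" "subgroup Y G" "X \<subseteq> Y" "prime (p :: nat)"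
      "prime (q :: nat)" "m \<le> k" "card Y = p * card X" "subgroup C G" "C \<subseteq> X" "normalizes G Y C"
      "card X = q ^ m * card C"
  using assms unfolding modular_step_def by blast

lemma power_of_prime_divisor:
  fixes q :: nat
  assumes "prime q" "a * b = q ^ m"
  obtains i where "a = q ^ i" "i \<le> m"
proof -
  have "a dvd q ^ m" using assms(2) by (metis dvd_triv_left)
  then show ?thesis using that assms(1) divides_primepow_nat by blast
qed

context finite_group
begin

text \<open>Going up the chain, the intersection with \<open>U\<close> stays \<open>H\<close> until
  it jumps to \<open>U\<close>. The step \<open>X\<close>, \<open>Y\<close> of the jump is
  intersected with \<open>U\<close>: a normal step stays normal, and in the other type the index of
  \<open>H\<close> in \<open>U\<close> is either \<open>p\<close> or a power of
  \<open>q\<close>.\<close>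

lemma maximal_modular_step:
  assumes chain: "modular_chain k G H (carrier G)"
    and sub: "subgroup H G" "subgroup U G" "H \<subset> U"
    and max: "\<And>Z. \<lbrakk>subgroup Z G; H \<subseteq> Z; Z \<subseteq> U\<rbrakk> \<Longrightarrow> Z = H \<or> Z = U"
  shows "modular_step k G H U"
proof -
  have "X \<inter> U = H \<longrightarrow> modular_step k G H U" if "modular_chain k G X (carrier G)" for X
    using that
  proof (induction rule: converse_rtranclp_induct)
    case base
    then show ?case using sub subgroup.subset[OF sub(2)] by auto
  next
    case (step X Y)
    show ?case
    proof
      assume XU: "X \<inter> U = H"
      have XY: "subgroup X G" "subgroup Y G" "X \<subseteq> Y"
        using step.hyps(1) unfolding modular_step_def by auto
      have "Y \<inter> U = H \<or> Y \<inter> U = U"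
        using XU XY(3) by (intro max subgroup_int XY(2) sub(2)) auto
      then show "modular_step k G H U"
      proof
        assume "Y \<inter> U = H"
        then show ?thesis using step.IH by simp
      next
        assume "Y \<inter> U = U"
        then have UY: "U \<subseteq> Y" by auto
        from step.hyps(1) show ?thesis
        proof (cases rule: modular_stepE)
          case normal
          then have "normalizes G U (X \<inter> U)"
            using normalizes_int[OF normalizes_mono[OF normal(4) UY] normalizes_self[OF sub(2)]] by simp
          then show ?thesis using XU sub unfolding modular_step_def by auto
        next
          case (prime_index p q m C)
          let ?C = "H \<inter> C"
          have C: "subgroup ?C G" using sub(1) prime_index(8) by (rule subgroup_int)
          have UC: "U \<inter> C = ?C" using prime_index(9) XU by auto
          have "normalizes G U (U \<inter> C)"
            using normalizes_int[OF normalizes_self[OF sub(2)] normalizes_mono[OF prime_index(10) UY]] .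
          then have nC: "normalizes G U ?C" using UC by simp
          have "card H dvd q ^ m * card ?C"
            using card_dvd_index_mult[OF sub(1) XY(1) _ prime_index(8,9)
                normalizes_mono[OF prime_index(10) XY(3)] prime_index(11)] XU by blast
          moreover obtain l where l: "card H = l * card ?C" using coset_card[OF C sub(1)] by auto
          ultimately have "l dvd q ^ m" using card_subgroup_pos[OF C] by simp
          then obtain j where j: "l = q ^ j" "j \<le> m" using prime_index(5) divides_primepow_nat by blast
          obtain n where n: "card U = n * card H" using coset_card[OF sub(1,2)] sub(3) by auto
          \<comment> \<open>The product set \<open>UX\<close> lies in \<open>Y\<close>, so the index
            of \<open>H\<close> in \<open>U\<close> is at most the index \<open>p\<close> of
            \<open>X\<close> in \<open>Y\<close>.\<close>
          have "card U * card X = card (U <#> X) * card H"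
            using card_set_mult[OF sub(2) XY(1)] XU by (simp add: Int_commute)
          also have "card (U <#> X) \<le> p * card X"
            unfolding prime_index(7)[symmetric]
            using UY XY by (intro card_mono set_mult_subset) auto
          finally have "n * card H * card X \<le> p * card X * card H" using n by (simp add: mult_right_mono)
          then have np: "n \<le> p" using card_subgroup_pos[OF sub(1)] card_subgroup_pos[OF XY(1)] by (simp add: mult.commute)
          show ?thesis
          proof (cases "n = p")
            case True
            then show ?thesis unfolding modular_step_def
              using sub C nC l j n prime_index(4,5,6)
              by (intro conjI disjI2 exI[of _ p] exI[of _ q] exI[of _ j] exI[of _ ?C]) auto
          next
            case False
            \<comment> \<open>An index below \<open>p\<close> is prime to \<open>p\<close> and hence
              a power of \<open>q\<close>. Then \<open>H \<inter> C\<close> has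
              \<open>q\<close>-power index in \<open>U\<close>, the normaliser of \<open>H\<close>
              in \<open>U\<close> grows, and maximality makes \<open>H\<close> normal.\<close>
            have "n \<noteq> 0" using n card_subgroup_pos[OF sub(2)] by auto
            then have "coprime n p"
              using np False prime_imp_coprime[OF prime_index(4), of n] dvd_imp_le[of p n]
              by (metis coprime_commute le_antisym neq0_conv)
            have "card Y = (p * q ^ m) * card C" using prime_index(7,11) by simp
            then have "card U dvd (p * q ^ m) * card (U \<inter> C)"
              using card_dvd_index_mult[OF sub(2) XY(2) UY prime_index(8) _ prime_index(10)]
                prime_index(9) XY(3) by blast
            then have "n * l dvd p * q ^ m" using n l UC card_subgroup_pos[OF C] by simp
            then have "n dvd p * q ^ m" by (metis dvd_mult_left)
            then have "n dvd q ^ m" using \<open>coprime n p\<close> coprime_dvd_mult_right_iff by blast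
            then obtain b where b: "n = q ^ b" using prime_index(5) divides_primepow_nat by blast
            have "card U = q ^ (b + j) * card ?C" using n l b j by (simp add: power_add)
            then obtain y where y: "y \<in> U" "y \<notin> H" "cj y ` H = H"
              using normalizer_grows[OF sub C _ nC prime_index(5)] by auto
            let ?N = "{u \<in> U. cj u ` H = H}"
            have "H \<subseteq> ?N"
              by (rule subgroup_subset_normalizer[OF sub(1) psubset_imp_subset[OF sub(3)]])
            then have "?N = H \<or> ?N = U"
              using subgroup_normalizer[OF sub(2) subgroup.subset[OF sub(1)]] by (intro max) auto
            then have "?N = U" using y by auto
            then have "normalizes G U H" unfolding normalizes_iff by blast
            then show ?thesis using sub unfolding modular_step_def by auto
          qed
        qed
      qed
    qed
  qed
  then show ?thesis using chain sub(3) by auto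
qed

text \<open>This is \<open>O\<^sub>r(Y)\<close>. A normal \<open>r\<close>-subgroup of largest order
  contains all others because the product of two of them is again one.\<close>

lemma largest_normal_p_subgroup:
  assumes "subgroup Y G" "prime r"
  obtains M a where "subgroup M G" "M \<subseteq> Y" "normalizes G Y M" "card M = r ^ a"
    "\<forall>Q b. subgroup Q G \<and> Q \<subseteq> Y \<and> normalizes G Y Q \<and> card Q = r ^ b \<longrightarrow> Q \<subseteq> M"
proof -
  let ?P = "\<lambda>Q. subgroup Q G \<and> Q \<subseteq> Y \<and> normalizes G Y Q \<and> (\<exists>b. card Q = r ^ b)"
  have "?P {\<one>}"
    using triv_subgroup subgroup.one_closed[OF assms(1)] subgroup.mem_carrier[OF assms(1)]
    by (auto simp: normalizes_iff intro: exI[of _ 0])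
  moreover have "\<forall>Q. ?P Q \<longrightarrow> card Q < Suc (card Y)"
    using assms(1) by (auto intro!: le_imp_less_Suc card_mono)
  ultimately have "\<exists>M. ?P M \<and> (\<forall>Q. ?P Q \<longrightarrow> card Q \<le> card M)"
    by (rule ex_has_greatest_nat)
  then obtain M b where M: "subgroup M G" "M \<subseteq> Y" "normalizes G Y M" "card M = r ^ b"
    and max: "\<forall>Q. ?P Q \<longrightarrow> card Q \<le> card M"
    by blast
  have "Q \<subseteq> M" if Q: "subgroup Q G" "Q \<subseteq> Y" "normalizes G Y Q" "card Q = r ^ c" for Q c
  proof -
    have sub: "subgroup (Q <#> M) G"
      using subgroup_set_mult[OF Q(1) M(1) normalizes_mono[OF M(3) Q(2)]] .
    have "normalizes G Y (Q <#> M)"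
      using normalizes_set_mult[OF _ _ _ Q(3) M(3)] assms(1) Q(1) M(1) by (simp add: subgroup.subset)
    moreover have "\<exists>d. card (Q <#> M) = r ^ d"
    proof -
      have "card (Q <#> M) * card (Q \<inter> M) = r ^ (c + b)"
        using card_set_mult[OF Q(1) M(1)] Q(4) M(4) by (simp add: power_add)
      then show ?thesis using power_of_prime_divisor[OF assms(2)] by metis
    qed
    ultimately have "card (Q <#> M) \<le> card M"
      using max sub set_mult_subset[OF assms(1) Q(2) M(2)] by blast
    moreover have MQ: "M \<subseteq> Q <#> M" using set_mult_superset_right[OF Q(1) M(1)] .
    ultimately have "card M = card (Q <#> M)"
      using card_mono[OF finite_subgroup[OF sub] MQ] by simp
    then have "M = Q <#> M" using card_eq_imp_eq[OF sub MQ] by simp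
    then show ?thesis using set_mult_superset_left[OF Q(1) M(1)] by simp
  qed
  then show ?thesis by (intro that[OF M]) blast
qed

text \<open>\<open>O\<^sub>r(C)\<close> serves as \<open>M\<close>: elements of \<open>Y\<close>
  permute the normal \<open>r\<close>-subgroups of \<open>C\<close>, so they preserve the largest
  one.\<close>

lemma normal_p_subgroup_extends:
  assumes "subgroup C G" "subgroup Y G" "C \<subseteq> Y" "normalizes G Y C" "prime r"
    and "subgroup Q G" "Q \<subseteq> C" "normalizes G C Q" "card Q = r ^ b"
  obtains M a where "subgroup M G" "Q \<subseteq> M" "M \<subseteq> C" "normalizes G Y M" "card M = r ^ a"
proof -
  obtain M a where M: "subgroup M G" "M \<subseteq> C" "normalizes G C M" "card M = r ^ a"
    and max: "\<forall>Q b. subgroup Q G \<and> Q \<subseteq> C \<and> normalizes G C Q \<and> card Q = r ^ b \<longrightarrow> Q \<subseteq> M"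
    using largest_normal_p_subgroup[OF assms(1,5)] .
  have "cj y ` M \<subseteq> M" if y: "y \<in> Y" for y
  proof -
    have yc: "y \<in> carrier G" using subgroup.mem_carrier[OF assms(2) y] .
    have Mc: "x \<in> carrier G" if "x \<in> M" for x using subgroup.mem_carrier[OF M(1) that] .
    have Cc: "x \<in> carrier G" if "x \<in> C" for x using subgroup.mem_carrier[OF assms(1) that] .
    have "normalizes G C (cj y ` M)"
      unfolding normalizes_iff
    proof clarify
      fix c x assume c: "c \<in> C" and x: "x \<in> M"
      have "cj c (cj y x) = cj y (cj (cj (inv y) c) x)"
        using yc Mc[OF x] Cc[OF c] by (simp add: cj_def group_word_simps)
      moreover have "cj (inv y) c \<in> C"
        using normalizesD[OF assms(4) _ c] subgroup.m_inv_closed[OF assms(2) y] by blast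
      then have "cj (cj (inv y) c) x \<in> M" using normalizesD[OF M(3) _ x] by blast
      ultimately show "cj c (cj y x) \<in> cj y ` M" by simp
    qed
    moreover have "cj y ` M \<subseteq> C" using normalizesD[OF assms(4) y] M(2) by blast
    ultimately show ?thesis
      using max subgroup_cj_image[OF yc M(1)] card_cj_image[OF yc subgroup.subset[OF M(1)]] M(4) by auto
  qed
  then have "normalizes G Y M" unfolding normalizes_iff by blast
  moreover have "Q \<subseteq> M" using max assms(6-9) by blast
  ultimately show ?thesis using that M by blast
qed

text \<open>The chain is climbed with \<open>H\<close> kept inside a normal
  \<open>r\<close>-subgroup \<open>M\<close> of the current member. At a step that is not normal
  \<open>q \<noteq> r\<close>, so \<open>M\<close> cannot leave the subgroup \<open>C\<close> of
  \<open>q\<close>-power index; since \<open>C\<close> is normal in the next member,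
  \<open>O\<^sub>r(C)\<close> takes over.\<close>

lemma p_subgroup_chain_in_normal:
  assumes chain: "modular_chain k G H (carrier G)" and H: "subgroup H G" "card H = r ^ a"
    and r: "prime r" "\<And>p. \<lbrakk>prime p; p dvd order G\<rbrakk> \<Longrightarrow> p \<le> r"
  obtains M b where "subgroup M G" "H \<subseteq> M" "normalizes G (carrier G) M" "card M = r ^ b"
proof -
  have "\<exists>M b. subgroup M G \<and> H \<subseteq> M \<and> M \<subseteq> X \<and> normalizes G X M \<and> card M = r ^ b"
    if "modular_chain k G H X" for X
    using that
  proof (induction rule: rtranclp_induct)
    case base
    then show ?case using H normalizes_self by blast
  next
    case (step X Y)
    then obtain M b where M: "subgroup M G" "H \<subseteq> M" "M \<subseteq> X" "normalizes G X M" "card M = r ^ b"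
      by blast
    have Y: "subgroup X G" "subgroup Y G" "X \<subseteq> Y"
      using step.hyps(2) unfolding modular_step_def by auto
    have extend: ?case if C: "subgroup C G" "C \<subseteq> X" "normalizes G Y C" "M \<subseteq> C" for C
    proof -
      have "normalizes G C M" using C(2) M(4) by (rule normalizes_mono[rotated])
      then obtain M' a' where "subgroup M' G" "M \<subseteq> M'" "M' \<subseteq> C" "normalizes G Y M'" "card M' = r ^ a'"
        using normal_p_subgroup_extends[OF C(1) Y(2) _ C(3) r(1) M(1) C(4) _ M(5)] C(2) Y(3) by blast
      then show ?thesis using C(2) Y(3) M(2) by (intro exI[of _ M'] exI[of _ a']) auto
    qed
    show ?case
    proof (cases "normalizes G Y X")
      case True
      then show ?thesis using extend Y M by blast
    next
      case False
      with step.hyps(2) obtain p q m C where *: "prime (p :: nat)" "prime (q :: nat)"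
        "card Y = p * card X" "subgroup C G" "C \<subseteq> X" "normalizes G Y C" "card X = q ^ m * card C"
        unfolding modular_step_def by blast
      obtain n where n: "card {y \<in> Y. cj y ` X = X} = n * card X" "p mod q = n mod q"
        using normalizer_index_mod[OF Y *(4,5,6,2,7,3)] .
      have "{y \<in> Y. cj y ` X = X} = X"
      proof
        show "{y \<in> Y. cj y ` X = X} \<subseteq> X"
          using prime_index_normalizes[OF Y *(1,3)] False by blast
        show "X \<subseteq> {y \<in> Y. cj y ` X = X}"
          by (rule subgroup_subset_normalizer[OF Y(1) Y(3)])
      qed
      \<comment> \<open>Self-normalisation turns the congruence into \<open>p mod q = 1\<close>.
        With \<open>p \<le> r\<close> this excludes \<open>q = r\<close>, where
        \<open>p mod q\<close> would be \<open>p\<close> or \<open>0\<close>.\<close>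
      then have "n = 1" using n(1) card_subgroup_pos[OF Y(1)] by simp
      then have pq: "p mod q = 1" using n(2) prime_gt_1_nat[OF *(2)] by simp
      have "p dvd order G"
        using *(3) card_subgroup_dvd[OF Y(2) subgroup_self subgroup.subset[OF Y(2)]]
        by (metis dvd_mult_left order_def)
      then have "p \<le> r" using r(2) *(1) by blast
      have "q \<noteq> r"
      proof
        assume "q = r"
        then have "p < q \<or> p = q" using \<open>p \<le> r\<close> by auto
        then show False using pq prime_gt_1_nat[OF *(1)] by auto
      qed
      have "card M dvd q ^ m * card (M \<inter> C)"
        using card_dvd_index_mult[OF M(1) Y(1) M(3) *(4,5) normalizes_mono[OF *(6) Y(3)] *(7)] .
      moreover have sMC: "subgroup (M \<inter> C) G" using M(1) *(4) by (rule subgroup_int)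
      moreover obtain l where l: "card M = l * card (M \<inter> C)" using coset_card[OF sMC M(1)] by auto
      ultimately have "l * card (M \<inter> C) dvd q ^ m * card (M \<inter> C)" by simp
      then have "l dvd q ^ m" using card_subgroup_pos[OF sMC] by (simp del: card_0_eq)
      moreover have "l dvd r ^ b" using l M(5) by (metis dvd_triv_left)
      ultimately have "l = 1" using prime_power_dvd_cases[OF *(2) r(1) \<open>q \<noteq> r\<close>] by blast
      then have "M \<inter> C = M" using l card_eq_imp_eq[OF M(1), of "M \<inter> C"] by simp
      then show ?thesis using extend *(4-6) by blast
    qed
  qed
  from this[OF chain] show ?thesis using that by blast
qed

end

section \<open>Images and preimages under homomorphisms\<close>

text \<open>\<open>f\<close> is any function whose fibres on \<open>X\<close> are left cosets of
  \<open>N\<close>. This covers homomorphisms as well as the exponent maps below, which are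
  multiplicative only modulo \<open>r\<close>.\<close>

lemma (in finite_group) card_fibres:
  assumes "subgroup X G" "subgroup N G" "N \<subseteq> X"
    and f: "\<And>y z. \<lbrakk>y \<in> X; z \<in> X\<rbrakk> \<Longrightarrow> f y = f z \<longleftrightarrow> inv y \<otimes> z \<in> N"
  shows "card X = card (f ` X) * card N"
proof -
  interpret X: subgroup X G by fact
  let ?c = "\<lambda>y. y <# N"
  have "card X = card (?c ` X) * card N"
    using assms(3) by (intro card_lcosets X.subset finite_subgroup assms(1,2)) auto
  moreover have "bij_betw (\<lambda>c. f (SOME y. y \<in> X \<and> c = ?c y)) (?c ` X) (f ` X)"
  proof -
    have eq: "?c y = ?c z \<longleftrightarrow> f y = f z" if yz: "y \<in> X" "z \<in> X" for y z
      using lcoset_eq_iff[OF assms(2) X.mem_carrier[OF yz(1)] X.mem_carrier[OF yz(2)]] f[OF yz] by simp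
    have some: "f (SOME z. z \<in> X \<and> ?c y = ?c z) = f y" if y: "y \<in> X" for y
    proof -
      have "\<exists>z. z \<in> X \<and> ?c y = ?c z" using y by blast
      then have "(SOME z. z \<in> X \<and> ?c y = ?c z) \<in> X \<and> ?c y = ?c (SOME z. z \<in> X \<and> ?c y = ?c z)"
        by (rule someI_ex)
      then show ?thesis using eq[OF y] by metis
    qed
    show ?thesis unfolding bij_betw_def inj_on_def
      using some eq by (auto simp: image_image)
  qed
  then have "card (?c ` X) = card (f ` X)" by (rule bij_betw_same_card)
  ultimately show ?thesis by simp
qed

locale finite_group_hom = group_hom +
  assumes finG [simp, intro]: "finite (carrier G)"
    and surj: "h ` carrier G = carrier H"
begin

sublocale fG: finite_group G by standard simp

sublocale fH: finite_group H
  by standard (metis finG finite_imageI surj)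

lemma hom_cj: "\<lbrakk>g \<in> carrier G; x \<in> carrier G\<rbrakk> \<Longrightarrow> h (G.cj g x) = H.cj (h g) (h x)"
  by (simp add: G.cj_def H.cj_def)

lemma subgroup_preimage:
  assumes "subgroup X H"
  shows "subgroup {g \<in> carrier G. h g \<in> X} G"
proof -
  interpret X: subgroup X H by fact
  show ?thesis by standard auto
qed

lemma image_preimage:
  assumes "X \<subseteq> carrier H"
  shows "h ` {g \<in> carrier G. h g \<in> X} = X"
proof
  show "X \<subseteq> h ` {g \<in> carrier G. h g \<in> X}"
  proof
    fix x assume "x \<in> X"
    moreover then obtain g where "g \<in> carrier G" "h g = x" using assms surj by (metis imageE subsetD)
    ultimately show "x \<in> h ` {g \<in> carrier G. h g \<in> X}" by blast
  qed
qed auto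

lemma card_image_kernel:
  assumes "subgroup X G"
  shows "card X = card (h ` X) * card (X \<inter> kernel G H h)"
proof -
  interpret X: subgroup X G by fact
  let ?N = "X \<inter> kernel G H h"
  have N: "subgroup ?N G" using assms subgroup_kernel by (rule G.subgroup_int)
  show ?thesis
  proof (rule fG.card_fibres[OF assms N])
    show "h y = h z \<longleftrightarrow> inv\<^bsub>G\<^esub> y \<otimes>\<^bsub>G\<^esub> z \<in> ?N" if yz: "y \<in> X" "z \<in> X" for y z
    proof -
      have "inv\<^bsub>G\<^esub> y \<otimes>\<^bsub>G\<^esub> z \<in> ?N \<longleftrightarrow> h (inv\<^bsub>G\<^esub> y \<otimes>\<^bsub>G\<^esub> z) = \<one>\<^bsub>H\<^esub>"
        using yz by (simp add: kernel_def)
      also have "\<dots> \<longleftrightarrow> h y = h z" using yz by (auto simp: H.inv_solve_left')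
      finally show ?thesis by simp
    qed
  qed simp
qed

lemma card_preimage:
  assumes "subgroup X H"
  shows "card {g \<in> carrier G. h g \<in> X} = card X * card (kernel G H h)"
proof -
  have "{g \<in> carrier G. h g \<in> X} \<inter> kernel G H h = kernel G H h"
    using subgroup.one_closed[OF assms] by (auto simp: kernel_def)
  then show ?thesis
    using card_image_kernel[OF subgroup_preimage[OF assms]] image_preimage[OF subgroup.subset[OF assms]]
    by simp
qed

lemma normalizes_image:
  assumes "subgroup Y G" "X \<subseteq> Y" "normalizes G Y X"
  shows "normalizes H (h ` Y) (h ` X)"
  unfolding H.normalizes_iff
proof clarify
  fix y x assume "y \<in> Y" "x \<in> X"
  moreover then have "H.cj (h y) (h x) = h (G.cj y x)"
    using assms(2) subgroup.mem_carrier[OF assms(1)] by (subst hom_cj) auto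
  ultimately show "H.cj (h y) (h x) \<in> h ` X"
    using G.normalizesD[OF assms(3)] by simp
qed

lemma normalizes_preimage:
  assumes "normalizes H Y X"
  shows "normalizes G {g \<in> carrier G. h g \<in> Y} {g \<in> carrier G. h g \<in> X}"
  unfolding G.normalizes_iff
  using H.normalizesD[OF assms] by (auto simp: hom_cj)

text \<open>Each index is the index of the images times the index of the intersections with the
  kernel. So \<open>p\<close> becomes 1 or \<open>p\<close>, and \<open>q ^ m\<close> becomes a
  power of \<open>q\<close> with exponent at most \<open>m\<close>.\<close>

lemma modular_step_image:
  assumes "modular_step k G X Y"
  shows "modular_step k H (h ` X) (h ` Y)"
  using assms
proof (cases rule: modular_stepE)
  case normal
  then show ?thesis
    using subgroup_img_is_subgroup normalizes_image[OF normal(2,3,4)]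
    unfolding modular_step_def by auto
next
  case (prime_index p q m C)
  let ?D = "kernel G H h"
  have D: "subgroup ?D G" by (rule subgroup_kernel)
  have sub: "subgroup (h ` X) H" "subgroup (h ` Y) H" "h ` X \<subseteq> h ` Y"
    using subgroup_img_is_subgroup prime_index(1,2,3) by auto
  obtain n where n: "card (h ` Y) = n * card (h ` X)" using fH.coset_card[OF sub] .
  have "subgroup (X \<inter> ?D) G" "subgroup (Y \<inter> ?D) G" "subgroup (C \<inter> ?D) G"
    using prime_index D G.subgroup_int by auto
  moreover have "X \<inter> ?D \<subseteq> Y \<inter> ?D" "C \<inter> ?D \<subseteq> X \<inter> ?D" using prime_index by auto
  ultimately obtain n' l' where n': "card (Y \<inter> ?D) = n' * card (X \<inter> ?D)"
    and l': "card (X \<inter> ?D) = l' * card (C \<inter> ?D)"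
    by (metis fG.coset_card)
  have pos: "0 < card X" "0 < card C"
    using fG.card_subgroup_pos[OF prime_index(1)] fG.card_subgroup_pos[OF prime_index(8)] .
  have "n * n' * card X = p * card X"
    using card_image_kernel[OF prime_index(1)] card_image_kernel[OF prime_index(2)] n n' prime_index(7)
    by (auto simp: mult_ac)
  then have nn: "n * n' = p" using pos by simp
  show ?thesis
  proof (cases "n = 1")
    case True
    then have "h ` X = h ` Y" using n fH.card_eq_imp_eq[OF sub(2,3)] by simp
    then show ?thesis using sub H.normalizes_self unfolding modular_step_def by auto
  next
    case False
    then have "n = p" using nn prime_index(4) by (metis prime_nat_iff dvd_triv_left)
    have hC: "subgroup (h ` C) H" "h ` C \<subseteq> h ` X" "normalizes H (h ` Y) (h ` C)"
      using subgroup_img_is_subgroup prime_index normalizes_image by auto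
    obtain l where l: "card (h ` X) = l * card (h ` C)" using fH.coset_card[OF hC(1) sub(1) hC(2)] .
    have "l * l' * card C = q ^ m * card C"
      using card_image_kernel[OF prime_index(1)] card_image_kernel[OF prime_index(8)] l l' prime_index(11)
      by (auto simp: mult_ac)
    then have "l * l' = q ^ m" using pos by simp
    then obtain j where "l = q ^ j" "j \<le> m" using power_of_prime_divisor[OF prime_index(5)] by blast
    then show ?thesis unfolding modular_step_def
      using sub hC n l \<open>n = p\<close> prime_index(4,5,6)
      by (intro conjI disjI2 exI[of _ p] exI[of _ q] exI[of _ j] exI[of _ "h ` C"]) auto
  qed
qed

lemma modular_step_preimage:
  assumes "modular_step k H X Y"
  shows "modular_step k G {g \<in> carrier G. h g \<in> X} {g \<in> carrier G. h g \<in> Y}"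
  using assms
proof (cases rule: modular_stepE)
  case normal
  then show ?thesis
    using subgroup_preimage normalizes_preimage unfolding modular_step_def by auto
next
  case (prime_index p q m C)
  then show ?thesis
    using subgroup_preimage normalizes_preimage card_preimage unfolding modular_step_def
    by (intro conjI disjI2 exI[of _ p] exI[of _ q] exI[of _ m] exI[of _ "{g \<in> carrier G. h g \<in> C}"]) auto
qed

lemma modular_chain_image:
  assumes "modular_chain k G X Y"
  shows "modular_chain k H (h ` X) (h ` Y)"
  using assms
  by (induction rule: rtranclp_induct) (auto intro: rtranclp.rtrancl_into_rtrancl modular_step_image)

lemma modular_chain_preimage:
  assumes "modular_chain k H X Y"
  shows "modular_chain k G {g \<in> carrier G. h g \<in> X} {g \<in> carrier G. h g \<in> Y}"
  using assms
  by (induction rule: rtranclp_induct) (auto intro: rtranclp.rtrancl_into_rtrancl modular_step_preimage)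

lemma nilpotent_over_image:
  assumes "nilpotent_over G {\<one>\<^bsub>G\<^esub>} A"
  shows "nilpotent_over H {\<one>\<^bsub>H\<^esub>} (h ` A)"
proof -
  obtain K :: "nat \<Rightarrow> 'a set" and n where K: "K 0 = {\<one>\<^bsub>G\<^esub>}" "K n = A"
    "\<And>i. i \<le> n \<Longrightarrow> subgroup (K i) G" "\<And>i. i < n \<Longrightarrow> K i \<subseteq> K (Suc i)"
    "\<And>i x y. \<lbrakk>i < n; x \<in> K (Suc i); y \<in> A\<rbrakk> \<Longrightarrow> G.cj y x \<otimes>\<^bsub>G\<^esub> inv\<^bsub>G\<^esub> x \<in> K i"
    using assms unfolding nilpotent_over_def by auto
  have "H.cj (h y) (h x) \<otimes>\<^bsub>H\<^esub> inv\<^bsub>H\<^esub> h x \<in> h ` K i" if "i < n" "x \<in> K (Suc i)" "y \<in> A" for i x y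
  proof -
    have "x \<in> carrier G" "y \<in> carrier G"
      using subgroup.mem_carrier[OF K(3)[of "Suc i"]] subgroup.mem_carrier[OF K(3)[of n]] K(2) that by auto
    then have "H.cj (h y) (h x) \<otimes>\<^bsub>H\<^esub> inv\<^bsub>H\<^esub> h x = h (G.cj y x \<otimes>\<^bsub>G\<^esub> inv\<^bsub>G\<^esub> x)"
      by (simp add: hom_cj)
    then show ?thesis using K(5)[OF that] by simp
  qed
  moreover have "subgroup (h ` K i) H" if "i \<le> n" for i
    using subgroup_img_is_subgroup K(3) that by auto
  moreover have "h ` K i \<subseteq> h ` K (Suc i)" if "i < n" for i
    using K(4)[OF that] by auto
  ultimately show ?thesis
    unfolding nilpotent_over_def using K(1,2)
    by (intro exI[of _ "\<lambda>i. h ` K i"] exI[of _ n]) auto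
qed

lemma nilpotent_over_preimage:
  assumes "nilpotent_over H {\<one>\<^bsub>H\<^esub>} (carrier H)"
  shows "nilpotent_over G (kernel G H h) (carrier G)"
proof -
  obtain K :: "nat \<Rightarrow> 'c set" and n where K: "K 0 = {\<one>\<^bsub>H\<^esub>}" "K n = carrier H"
    "\<And>i. i \<le> n \<Longrightarrow> subgroup (K i) H" "\<And>i. i < n \<Longrightarrow> K i \<subseteq> K (Suc i)"
    "\<And>i x y. \<lbrakk>i < n; x \<in> K (Suc i); y \<in> carrier H\<rbrakk> \<Longrightarrow> H.cj y x \<otimes>\<^bsub>H\<^esub> inv\<^bsub>H\<^esub> x \<in> K i"
    using assms unfolding nilpotent_over_def by auto
  let ?K = "\<lambda>i. {g \<in> carrier G. h g \<in> K i}"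
  have "G.cj y x \<otimes>\<^bsub>G\<^esub> inv\<^bsub>G\<^esub> x \<in> ?K i" if "i < n" "x \<in> ?K (Suc i)" "y \<in> carrier G" for i x y
    using K(5)[OF that(1), of "h x" "h y"] that by (auto simp: hom_cj)
  moreover have "?K i \<subseteq> ?K (Suc i)" if "i < n" for i
    using K(4)[OF that] by auto
  moreover have "?K 0 = kernel G H h" "?K n = carrier G"
    using K(1,2) by (auto simp: kernel_def)
  ultimately show ?thesis
    unfolding nilpotent_over_def using subgroup_preimage[OF K(3)]
    by (intro exI[of _ ?K] exI[of _ n]) auto
qed

end

context finite_group
begin

lemma quotient_hom:
  assumes "subgroup N G" "normalizes G (carrier G) N"
  shows "finite_group_hom G (G Mod N) (\<lambda>a. N #> a)" "kernel G (G Mod N) (\<lambda>a. N #> a) = N"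
proof -
  interpret N: normal N G using assms by (simp add: normal_iff_normalizes)
  show "finite_group_hom G (G Mod N) (\<lambda>a. N #> a)"
    by (intro finite_group_hom.intro group_hom.intro group_hom_axioms.intro finite_group_hom_axioms.intro
        is_group N.factorgroup_is_group N.r_coset_hom_Mod fin) (simp add: carrier_FactGroup)
  show "kernel G (G Mod N) (\<lambda>a. N #> a) = N"
    using coset_join1[OF _ _ N.subgroup_axioms] N.rcos_const[OF is_group]
    by (auto simp: kernel_def)
qed

text \<open>Passing to \<open>G Mod N\<close> and back by preimages turns \<open>X\<close> into
  \<open>XN\<close>, and both passages preserve modular chains.\<close>

lemma modular_chain_set_mult_normal:
  assumes chain: "modular_chain k G X (carrier G)" and X: "subgroup X G"
    and N: "subgroup N G" "normalizes G (carrier G) N"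
  shows "modular_chain k G (X <#> N) (carrier G)"
proof -
  interpret h: finite_group_hom G "G Mod N" "\<lambda>a. N #> a" by (rule quotient_hom[OF N])
  have "modular_chain k (G Mod N) ((\<lambda>a. N #> a) ` X) (carrier (G Mod N))"
    using h.modular_chain_image[OF chain] h.surj by simp
  from h.modular_chain_preimage[OF this]
  have "modular_chain k G {g \<in> carrier G. N #> g \<in> (\<lambda>a. N #> a) ` X} {g \<in> carrier G. N #> g \<in> carrier (G Mod N)}" .
  moreover have "{g \<in> carrier G. N #> g \<in> carrier (G Mod N)} = carrier G" by auto
  moreover have "{g \<in> carrier G. N #> g \<in> (\<lambda>a. N #> a) ` X} = X <#> N"
  proof
    show "{g \<in> carrier G. N #> g \<in> (\<lambda>a. N #> a) ` X} \<subseteq> X <#> N"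
    proof clarify
      fix g x assume g: "g \<in> carrier G" "N #> g = N #> x" "x \<in> X"
      have xc: "x \<in> carrier G" using subgroup.mem_carrier[OF X g(3)] .
      have "g \<in> N #> x" using rcos_self[OF g(1) N(1)] g(2) by simp
      then obtain n where n: "n \<in> N" "g = n \<otimes> x" by (auto simp: r_coset_def)
      have nc: "n \<in> carrier G" using subgroup.mem_carrier[OF N(1) n(1)] .
      have "g = x \<otimes> cj (inv x) n" using n(2) nc xc by (simp add: cj_def group_word_simps)
      then show "g \<in> X <#> N"
        using set_multI[OF g(3), of "cj (inv x) n" N] normalizesD[OF N(2) inv_closed[OF xc] n(1)] by simp
    qed
    show "X <#> N \<subseteq> {g \<in> carrier G. N #> g \<in> (\<lambda>a. N #> a) ` X}"
    proof
      fix g assume "g \<in> X <#> N"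
      then obtain x n where xn: "x \<in> X" "n \<in> N" "g = x \<otimes> n" by (auto simp: set_mult_iff)
      have c: "x \<in> carrier G" "n \<in> carrier G"
        using subgroup.mem_carrier[OF X xn(1)] subgroup.mem_carrier[OF N(1) xn(2)] .
      have "g = cj x n \<otimes> x" using xn(3) c by (simp add: cj_def group_word_simps)
      moreover have "cj x n \<in> N" using normalizesD[OF N(2) c(1) xn(2)] .
      ultimately have "g \<in> N #> x" by (auto simp: r_coset_def)
      then have "N #> g = N #> x" using repr_independence[OF _ c(1) N(1)] by simp
      then show "g \<in> {g \<in> carrier G. N #> g \<in> (\<lambda>a. N #> a) ` X}" using xn c by auto
    qed
  qed
  ultimately show ?thesis by simp
qed

end

section \<open>Comparison with the defining notions\<close>

context finite_group
begin

lemma normal_core_cj: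
  assumes "subgroup Y G" "X \<subseteq> Y"
  shows "normal_core (G\<lparr>carrier := Y\<rparr>) X = {x \<in> Y. \<forall>g\<in>Y. cj g x \<in> X}"
proof -
  interpret Y: subgroup Y G by fact
  have Xc: "x \<in> carrier G" if "x \<in> X" for x using that assms by auto
  have conj: "(g <# X) #> inv\<^bsub>G\<lparr>carrier := Y\<rparr>\<^esub> g = cj g ` X" if "g \<in> Y" for g
    using that assms(1) by (auto simp: l_coset_def r_coset_def cj_def)
  have mem: "x \<in> cj g ` X \<longleftrightarrow> cj (inv g) x \<in> X" if "g \<in> Y" "x \<in> Y" for g x
  proof
    assume "x \<in> cj g ` X"
    then show "cj (inv g) x \<in> X" using that(1) Xc by auto
  next
    assume "cj (inv g) x \<in> X"
    moreover have "x = cj g (cj (inv g) x)" using that by simp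
    ultimately show "x \<in> cj g ` X" by blast
  qed
  have "normal_core (G\<lparr>carrier := Y\<rparr>) X = (\<Inter>g\<in>Y. cj g ` X)"
    unfolding normal_core_def using conj by simp
  also have "\<dots> = {x \<in> Y. \<forall>g\<in>Y. cj g x \<in> X}"
  proof (rule equalityI; rule subsetI)
    fix x assume x: "x \<in> (\<Inter>g\<in>Y. cj g ` X)"
    then have "x \<in> cj \<one> ` X" using Y.one_closed by blast
    then have xY: "x \<in> Y" using Xc assms(2) by auto
    have "cj g x \<in> X" if "g \<in> Y" for g
      using mem[of "inv g" x] x xY that by simp
    then show "x \<in> {x \<in> Y. \<forall>g\<in>Y. cj g x \<in> X}" using xY by simp
  next
    fix x assume x: "x \<in> {x \<in> Y. \<forall>g\<in>Y. cj g x \<in> X}"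
    then show "x \<in> (\<Inter>g\<in>Y. cj g ` X)" using mem by simp
  qed
  finally show ?thesis .
qed

lemma normal_core_props:
  assumes "subgroup Y G" "subgroup X G" "X \<subseteq> Y"
  defines "C \<equiv> normal_core (G\<lparr>carrier := Y\<rparr>) X"
  shows "subgroup C G" "C \<subseteq> X" "normalizes G Y C"
    "\<lbrakk>D \<subseteq> X; normalizes G Y D\<rbrakk> \<Longrightarrow> D \<subseteq> C"
proof -
  interpret Y: subgroup Y G by fact
  interpret X: subgroup X G by fact
  have C: "C = {x \<in> Y. \<forall>g\<in>Y. cj g x \<in> X}" unfolding C_def by (rule normal_core_cj[OF assms(1,3)])
  show "subgroup C G"
    unfolding C by standard (auto simp: cj_mult cj_inv)
  show "C \<subseteq> X"
  proof
    fix x assume "x \<in> C"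
    then show "x \<in> X" using C Y.one_closed cj_one_left[of x] by (metis (mono_tags, lifting) Y.mem_carrier mem_Collect_eq)
  qed
  show "normalizes G Y C"
    unfolding normalizes_iff C
  proof clarify
    fix h x assume h: "h \<in> Y" and x: "x \<in> Y" "\<forall>g\<in>Y. cj g x \<in> X"
    have "cj g (cj h x) \<in> X" if "g \<in> Y" for g
      using x(2) h that x(1) by (simp add: cj_mult_left [symmetric])
    moreover have "cj h x \<in> Y" using x(2) h assms(3) by blast
    ultimately show "cj h x \<in> Y \<and> (\<forall>g\<in>Y. cj g (cj h x) \<in> X)" by blast
  qed
  show "D \<subseteq> C" if "D \<subseteq> X" "normalizes G Y D"
    unfolding C using that assms(3) normalizesD[OF that(2)] by blast
qed

lemma modularly_embedded_imp_step:
  assumes Y: "subgroup Y G" and X: "subgroup X G" "X \<subseteq> Y" and "n \<le> k"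
    and emb: "modularly_embedded n (G\<lparr>carrier := Y\<rparr>) X"
  shows "modular_step k G X Y"
proof -
  let ?Y = "G\<lparr>carrier := Y\<rparr>"
  let ?C = "normal_core ?Y X"
  have gY: "group ?Y" using Y by (rule subgroup_imp_group)
  have idx: "card Y = card (rcosets\<^bsub>?Y\<^esub> Z) * card Z" if "subgroup Z G" "Z \<subseteq> Y" for Z
    using group.lagrange[OF gY subgroup_incl[OF that(1) Y that(2)]] unfolding order_def by simp
  note C = normal_core_props(1-3)[OF Y X]
  from emb consider "X \<lhd> ?Y" | p q where "prime (p :: nat)" "prime (q :: nat)"
    "order (?Y Mod ?C) = p * q ^ n" "card (rcosets\<^bsub>?Y\<^esub> X) = p"
    unfolding modularly_embedded_def by blast
  then show ?thesis
  proof cases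
    case 1
    then have "normalizes ?Y Y X" using group.normal_iff_normalizes[OF gY] by simp
    then have "normalizes G Y X" using Y by (simp add: normalizes_def)
    then show ?thesis using X Y unfolding modular_step_def by simp
  next
    case 2
    have p: "card Y = p * card X" using idx[OF X] 2(4) by simp
    have "card (rcosets\<^bsub>?Y\<^esub> ?C) = p * q ^ n" using 2(3) by (simp add: order_def FactGroup_def)
    then have "p * card X = p * q ^ n * card ?C" using idx[OF C(1)] C(2) X(2) p by simp
    then have "card X = q ^ n * card ?C" using prime_gt_0_nat[OF 2(1)] by simp
    then show ?thesis unfolding modular_step_def
      using X Y p 2(1,2) C assms(4)
      by (intro conjI disjI2 exI[of _ p] exI[of _ q] exI[of _ n] exI[of _ ?C]) auto
  qed
qed

text \<open>In a step that is not normal the core contains \<open>D\<close> and differs from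
  \<open>X\<close>, so its index in \<open>X\<close> is \<open>q ^ j\<close> with
  \<open>0 < j \<le> m\<close>. If the quotient by the core were nilpotent, \<open>X\<close> would
  be smaller than its normaliser, and prime index would make it normal.\<close>

lemma step_imp_modularly_embedded:
  assumes step: "modular_step k G X Y" and "1 \<le> k"
  obtains n where "1 \<le> n" "n \<le> k" "modularly_embedded n (G\<lparr>carrier := Y\<rparr>) X"
proof -
  let ?Y = "G\<lparr>carrier := Y\<rparr>"
  let ?C = "normal_core ?Y X"
  have sub: "subgroup X G" "subgroup Y G" "X \<subseteq> Y" using step unfolding modular_step_def by auto
  have gY: "group ?Y" using sub(2) by (rule subgroup_imp_group)
  interpret fY: finite_group ?Y using gY sub(2) by (simp add: finite_group_def finite_group_axioms_def)
  have idx: "card Y = card (rcosets\<^bsub>?Y\<^esub> Z) * card Z" if "subgroup Z G" "Z \<subseteq> Y" for Z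
    using group.lagrange[OF gY subgroup_incl[OF that(1) sub(2) that(2)]] unfolding order_def by simp
  have XY: "subgroup X ?Y" using subgroup_incl[OF sub] .
  have nrm: "normalizes ?Y Y Z \<longleftrightarrow> normalizes G Y Z" for Z
    using sub(2) by (simp add: normalizes_def)
  show ?thesis
  proof (cases "normalizes G Y X")
    case True
    then have "X \<lhd> ?Y" using XY nrm by (simp add: fY.normal_iff_normalizes)
    \<comment> \<open>A normal subgroup is \<open>n\<close>-modularly embedded for every
      \<open>n\<close>; the choice 1 is within every positive bound \<open>k\<close>.\<close>
    then show ?thesis using that[of 1] assms(2) XY by (simp add: modularly_embedded_def)
  next
    case False
    with step obtain p q m D where *: "prime (p :: nat)" "prime (q :: nat)" "m \<le> k"
      "card Y = p * card X" "subgroup D G" "D \<subseteq> X" "normalizes G Y D" "card X = q ^ m * card D"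
      unfolding modular_step_def by blast
    note C = normal_core_props(1-3)[OF sub(2,1,3)]
    have DC: "D \<subseteq> ?C" using normal_core_props(4)[OF sub(2,1,3) *(6,7)] .
    obtain t where t: "card X = t * card ?C" using coset_card[OF C(1) sub(1) C(2)] .
    obtain l where l: "card ?C = l * card D" using coset_card[OF *(5) C(1) DC] .
    have "t * l = q ^ m" using t l *(8) card_subgroup_pos[OF *(5)] by simp
    then obtain j where j: "t = q ^ j" "j \<le> m" using power_of_prime_divisor[OF *(2)] by blast
    have "j \<noteq> 0"
    proof
      assume "j = 0"
      then have "?C = X" using t j card_eq_imp_eq[OF sub(1) C(2)] by simp
      then show False using False C(3) by simp
    qed
    have "card Y = card (rcosets\<^bsub>?Y\<^esub> ?C) * card ?C" using idx C(1,2) sub(3) by blast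
    then have ord: "order (?Y Mod ?C) = p * q ^ j"
      using *(4) t j card_subgroup_pos[OF C(1)] by (simp add: order_def FactGroup_def)
    have "card (rcosets\<^bsub>?Y\<^esub> X) = p" using idx[OF sub(1,3)] *(4) card_subgroup_pos[OF sub(1)] by simp
    moreover have "\<not> nilpotent_group (?Y Mod ?C)"
    proof
      assume nil: "nilpotent_group (?Y Mod ?C)"
      have CY: "subgroup ?C ?Y" using subgroup_incl[OF C(1) sub(2)] C(2) sub(3) by blast
      have CN: "normalizes ?Y (carrier ?Y) ?C" using C(3) nrm by simp
      interpret q: finite_group_hom ?Y "?Y Mod ?C" "\<lambda>a. ?C #>\<^bsub>?Y\<^esub> a" by (rule fY.quotient_hom[OF CY CN])
      have "nilpotent_over ?Y ?C Y"
        using q.nilpotent_over_preimage[OF q.H.nilpotent_group_imp_over[OF nil]]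
        unfolding fY.quotient_hom(2)[OF CY CN] by simp
      then have "nilpotent_over G ?C Y" by (rule nilpotent_over_restrict[OF sub(2)])
      moreover have "X \<subset> Y" using False normalizes_self[OF sub(1)] sub(3) by blast
      ultimately obtain y where y: "y \<in> Y" "y \<notin> X" "\<forall>x\<in>X. cj y x \<in> X"
        using nilpotent_over_normalizer_grows[OF _ sub(1) C(2)] by blast
      have "cj y ` X = X"
        using y subgroup.mem_carrier[OF sub(2)] subgroup.subset[OF sub(1)] sub(1) by (intro cj_image_eq) auto
      then show False using prime_index_normalizes[OF sub *(1,4) y(1,2)] False by simp
    qed
    ultimately have "modularly_embedded j ?Y X"
      unfolding modularly_embedded_def using XY *(1,2) ord by blast
    then show ?thesis using that[of j] \<open>j \<noteq> 0\<close> j(2) *(3) by simp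
  qed
qed

lemma submodular_imp_chain:
  assumes "submodular k G X"
  shows "modular_chain k G X (carrier G)"
proof -
  obtain C :: "nat \<Rightarrow> 'a set" and m where C: "C 0 = X" "C m = carrier G"
    "\<forall>i\<le>m. subgroup (C i) G"
    "\<forall>i<m. C i \<subseteq> C (Suc i) \<and>
      (\<exists>n. 1 \<le> n \<and> n \<le> k \<and> modularly_embedded n (G\<lparr>carrier := C (Suc i)\<rparr>) (C i))"
    using assms unfolding submodular_def by (elim exE conjE) (rule that)
  have "modular_step k G (C i) (C (Suc i))" if i: "i < m" for i
  proof -
    from C(4) i obtain n where "C i \<subseteq> C (Suc i)" "n \<le> k"
      "modularly_embedded n (G\<lparr>carrier := C (Suc i)\<rparr>) (C i)" by auto
    then show ?thesis using C(3) i by (intro modularly_embedded_imp_step) auto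
  qed
  then have "(modular_step k G ^^ m) X (carrier G)"
    unfolding relpowp_fun_conv using C(1,2) by blast
  then show ?thesis by (rule relpowp_imp_rtranclp)
qed

lemma chain_imp_submodular:
  assumes "modular_chain k G X (carrier G)" "subgroup X G" "1 \<le> k"
  shows "submodular k G X"
proof -
  from assms(1) obtain m where "(modular_step k G ^^ m) X (carrier G)"
    using rtranclp_imp_relpowp by metis
  then obtain C where C: "C 0 = X" "C m = carrier G" "\<forall>i<m. modular_step k G (C i) (C (Suc i))"
    unfolding relpowp_fun_conv by blast
  have "subgroup (C i) G" if "i \<le> m" for i
  proof (cases "i = m")
    case True
    then show ?thesis using C(2) subgroup_self by simp
  next
    case False
    then show ?thesis using C(3) that unfolding modular_step_def by auto
  qed
  moreover have "C i \<subseteq> C (Suc i)" if "i < m" for i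
    using C(3) that unfolding modular_step_def by auto
  moreover have "\<exists>n. 1 \<le> n \<and> n \<le> k \<and> modularly_embedded n (G\<lparr>carrier := C (Suc i)\<rparr>) (C i)"
    if "i < m" for i
    using step_imp_modularly_embedded[of k "C i" "C (Suc i)"] C(3) that assms(3) by blast
  ultimately show ?thesis
    unfolding submodular_def using C(1,2) by (intro exI[of _ C] exI[of _ m]) blast
qed

end

section \<open>Chief factors of prime order\<close>

text \<open>For normal \<open>L\<close> and \<open>K\<close> this is the kernel of the action of
  \<open>G\<close> on \<open>K / L\<close>, written without cosets so that it can be intersected
  directly with subgroups of \<open>G\<close>.\<close>

definition factor_centralizer :: "('a, 'b) monoid_scheme \<Rightarrow> 'a set \<Rightarrow> 'a set \<Rightarrow> 'a set" where
  "factor_centralizer G L K = {g \<in> carrier G. \<forall>x\<in>K. inv\<^bsub>G\<^esub> x \<otimes>\<^bsub>G\<^esub> group.cj G g x \<in> L}"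

context group
begin

lemma cj_pow:
  assumes "g \<in> carrier G" "x \<in> carrier G"
  shows "cj g (x [^] (n :: nat)) = cj g x [^] n"
  using assms by (induction n) (auto simp: cj_mult)

lemma normal_subgroupD: "N \<lhd> G \<Longrightarrow> subgroup N G" "N \<lhd> G \<Longrightarrow> normalizes G (carrier G) N"
  by (simp_all add: normal_iff_normalizes)

lemma normal_cj: "\<lbrakk>N \<lhd> G; g \<in> carrier G; x \<in> N\<rbrakk> \<Longrightarrow> cj g x \<in> N"
  using normal_subgroupD(2) normalizesD by blast

lemma centralizer_normal:
  assumes "U \<lhd> G"
  shows "{g \<in> carrier G. \<forall>u\<in>U. cj g u = u} \<lhd> G"
proof -
  interpret U: normal U G by fact
  have "normalizes G (carrier G) {g \<in> carrier G. \<forall>u\<in>U. cj g u = u}"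
    unfolding normalizes_iff
  proof clarify
    fix h g assume h: "h \<in> carrier G" and g: "g \<in> carrier G" "\<forall>u\<in>U. cj g u = u"
    have "cj (cj h g) u = u" if u: "u \<in> U" for u
    proof -
      have "cj (inv h) u \<in> U" using normal_cj[OF assms _ u] h by simp
      then have "cj h (cj g (cj (inv h) u)) = u" using g h u by simp
      moreover have "cj h (cj g (cj (inv h) u)) = cj (cj h g) (cj h (cj (inv h) u))"
        using h g u by (intro cj_cj) auto
      ultimately show ?thesis using h u by simp
    qed
    then show "cj h g \<in> carrier G \<and> (\<forall>u\<in>U. cj (cj h g) u = u)" using h g by simp
  qed
  then show ?thesis
    using subgroup_fixator[OF subgroup_self U.subset] by (simp add: normal_iff_normalizes)
qed

end

context finite_group
begin

lemma nat_pow_eq_iff: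
  assumes "x \<in> carrier G"
  shows "x [^] (i :: nat) = x [^] j \<longleftrightarrow> i mod ord x = j mod ord x"
proof -
  have "x [^] i = x [^] j \<longleftrightarrow> x [^] int i = x [^] int j" by (simp add: int_pow_int)
  also have "\<dots> \<longleftrightarrow> int j mod int (ord x) = int i mod int (ord x)"
    using int_pow_eq[OF assms] by (simp add: mod_eq_dvd_iff)
  also have "\<dots> \<longleftrightarrow> i mod ord x = j mod ord x"
    by (auto simp flip: of_nat_mod)
  finally show ?thesis .
qed

lemma prime_order_powers:
  assumes "subgroup K G" "prime r" "card K = r" "x \<in> K" "x \<noteq> \<one>"
  shows "ord x = r" "y \<in> K \<Longrightarrow> \<exists>i<r. y = x [^] (i :: nat)"
proof -
  have xc: "x \<in> carrier G" using subgroup.mem_carrier[OF assms(1,4)] .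
  have sub: "subgroup (generate G {x}) G" using xc by (intro generate_is_subgroup) simp
  have "generate G {x} = {\<one>} \<or> generate G {x} = K"
  proof (rule subgroup_between_prime_index[OF triv_subgroup assms(1) sub _ _ assms(2)])
    show "{\<one>} \<subseteq> generate G {x}" using subgroup.one_closed[OF sub] by simp
    show "generate G {x} \<subseteq> K" using generate_subgroup_incl[of "{x}" K] assms by simp
    show "card K = r * card {\<one>}" using assms(3) by simp
  qed
  moreover have "x \<in> generate G {x}" by (simp add: generate.incl)
  ultimately have gen: "generate G {x} = K" using assms(5) by auto
  then show ord: "ord x = r" using generate_pow_card[OF xc] assms(3) by simp
  assume "y \<in> K"
  then obtain k :: nat where k: "y = x [^] k"
    using gen generate_pow_on_finite_carrier[OF fin xc] by auto
  have "x [^] (k mod r) = x [^] k"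
    using nat_pow_eq_iff[OF xc] ord by simp
  then show "\<exists>i<r. y = x [^] i"
    using k prime_gt_0_nat[OF assms(2)] by (metis mod_less_divisor)
qed

text \<open>On a generator \<open>x\<close> of \<open>K\<close>, conjugation by \<open>g\<close> is
  the power with exponent \<open>e g\<close>. This is the homomorphism to the units modulo
  \<open>r\<close>, with values taken as residues so that equal actions mean equal numbers.\<close>

lemma prime_order_exponent:
  assumes K: "K \<lhd> G" and r: "prime r" "card K = r"
  obtains e :: "'a \<Rightarrow> nat" where
    "\<forall>g\<in>carrier G. 0 < e g \<and> e g < r"
    "\<forall>g\<in>carrier G. \<forall>h\<in>carrier G. e (g \<otimes> h) mod r = (e g * e h) mod r"
    "\<forall>g\<in>carrier G. \<forall>h\<in>carrier G. e g = e h \<longleftrightarrow> (\<forall>u\<in>K. cj g u = cj h u)"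
    "\<forall>u\<in>K. \<forall>v\<in>K. cj u v = v"
proof -
  have sub: "subgroup K G" using K by (rule normal_subgroupD)
  have "K \<noteq> {\<one>}" using r by (auto simp: prime_nat_iff)
  then obtain x where x: "x \<in> K" "x \<noteq> \<one>" using subgroup.one_closed[OF sub] by blast
  have xc: "x \<in> carrier G" using subgroup.mem_carrier[OF sub x(1)] .
  note ord = prime_order_powers(1)[OF sub r x] and pow = prime_order_powers(2)[OF sub r x]
  have pow_eq: "x [^] i = x [^] j \<longleftrightarrow> i mod r = j mod r" for i j :: nat
    using nat_pow_eq_iff[OF xc] ord by simp
  define e where "e g = (SOME i. i < r \<and> cj g x = x [^] i)" for g
  have e: "e g < r" "cj g x = x [^] e g" if "g \<in> carrier G" for g
  proof -
    have "\<exists>i<r. cj g x = x [^] i" using pow normal_cj[OF K that x(1)] by blast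
    then have "e g < r \<and> cj g x = x [^] e g" unfolding e_def by (rule someI_ex)
    then show "e g < r" "cj g x = x [^] e g" by auto
  qed
  have "0 < e g \<and> e g < r" if g: "g \<in> carrier G" for g
  proof -
    have "e g \<noteq> 0"
    proof
      assume "e g = 0"
      then have "cj g x = cj g \<one>" using e(2)[OF g] g by simp
      then show False using x xc g by (simp add: cj_eq_iff del: cj_one)
    qed
    then show ?thesis using e(1)[OF g] by simp
  qed
  moreover have "e (g \<otimes> h) mod r = (e g * e h) mod r" if "g \<in> carrier G" "h \<in> carrier G" for g h
  proof -
    have "x [^] e (g \<otimes> h) = cj g (cj h x)" using e(2)[of "g \<otimes> h"] that xc by (simp add: cj_mult_left)
    also have "\<dots> = x [^] (e g * e h)" using e(2) that xc by (simp add: cj_pow nat_pow_pow)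
    finally show ?thesis using pow_eq by blast
  qed
  moreover have "e g = e h \<longleftrightarrow> (\<forall>u\<in>K. cj g u = cj h u)" if gh: "g \<in> carrier G" "h \<in> carrier G" for g h
  proof
    assume "e g = e h"
    then have eq: "cj g x = cj h x" using e gh by simp
    show "\<forall>u\<in>K. cj g u = cj h u"
    proof
      fix u assume "u \<in> K"
      then obtain i :: nat where "u = x [^] i" using pow by blast
      then show "cj g u = cj h u" using eq gh xc by (simp add: cj_pow)
    qed
  next
    assume "\<forall>u\<in>K. cj g u = cj h u"
    then have "x [^] e g = x [^] e h" using e(2)[OF gh(1)] e(2)[OF gh(2)] x(1) by metis
    then show "e g = e h" using pow_eq e(1) gh by simp
  qed
  moreover have "cj u v = v" if "u \<in> K" "v \<in> K" for u v
  proof -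
    obtain i j :: nat where "u = x [^] i" "v = x [^] j"
      using pow[OF \<open>u \<in> K\<close>] pow[OF \<open>v \<in> K\<close>] by blast
    then show ?thesis using xc by (simp add: cj_eq_self_iff nat_pow_mult add.commute)
  qed
  ultimately show ?thesis using that[of e] by simp
qed

lemma rcoset_eq_iff:
  assumes "L \<lhd> G" "x \<in> carrier G" "y \<in> carrier G"
  shows "L #> x = L #> y \<longleftrightarrow> inv x \<otimes> y \<in> L"
proof -
  interpret L: normal L G by fact
  have "L #> x = L #> y \<longleftrightarrow> x <# L = y <# L" using L.coset_eq assms(2,3) by simp
  then show ?thesis using lcoset_eq_iff[OF L.subgroup_axioms assms(2,3)] by simp
qed

lemma factor_centralizer_normal:
  assumes L: "L \<lhd> G" and K: "K \<lhd> G"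
  shows "factor_centralizer G L K \<lhd> G"
proof -
  let ?Q = "G Mod L"
  interpret \<pi>: finite_group_hom G ?Q "\<lambda>a. L #> a" by (rule quotient_hom(1)[OF normal_subgroupD[OF L]])
  have Kc: "x \<in> carrier G" if "x \<in> K" for x
    using subgroup.mem_carrier[OF normal_subgroupD(1)[OF K] that] .
  let ?Z = "{g \<in> carrier ?Q. \<forall>u\<in>(\<lambda>a. L #> a) ` K. \<pi>.H.cj g u = u}"
  have "(\<lambda>a. L #> a) ` K \<lhd> ?Q"
    using \<pi>.subgroup_img_is_subgroup[OF normal_subgroupD(1)[OF K]]
      \<pi>.normalizes_image[OF subgroup_self subgroup.subset normal_subgroupD(2)[OF K]] K \<pi>.surj
    by (simp add: \<pi>.H.normal_iff_normalizes normal_subgroupD)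
  then have Z: "?Z \<lhd> ?Q" by (rule \<pi>.H.centralizer_normal)
  have "{g \<in> carrier G. L #> g \<in> ?Z} = factor_centralizer G L K"
  proof -
    have "(\<forall>u\<in>(\<lambda>a. L #> a) ` K. \<pi>.H.cj (L #> g) u = u) \<longleftrightarrow> (\<forall>x\<in>K. inv x \<otimes> cj g x \<in> L)"
      if g: "g \<in> carrier G" for g
    proof -
      have "\<pi>.H.cj (L #> g) (L #> x) = L #> x \<longleftrightarrow> inv x \<otimes> cj g x \<in> L" if x: "x \<in> K" for x
        using rcoset_eq_iff[OF L, of x "cj g x"] \<pi>.hom_cj[OF g Kc[OF x]] g Kc[OF x] by (auto simp: eq_commute)
      then show ?thesis by auto
    qed
    then show ?thesis unfolding factor_centralizer_def by auto
  qed
  then show ?thesis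
    using \<pi>.subgroup_preimage[OF \<pi>.H.normal_subgroupD(1)[OF Z]]
      normalizes_mono[OF \<pi>.normalizes_preimage[OF \<pi>.H.normal_subgroupD(2)[OF Z]], of "carrier G"]
    by (simp add: normal_iff_normalizes \<pi>.hom_closed subset_iff)
qed

text \<open>The exponent map of \<open>K / L\<close> in \<open>G Mod L\<close>, pulled back to
  \<open>G\<close>; its kernel is the centraliser of the factor. The facts below on factors of prime
  order are read off from it.\<close>

lemma factor_exponent:
  assumes L: "L \<lhd> G" and K: "K \<lhd> G" and r: "L \<subseteq> K" "prime r" "card K = r * card L"
  obtains e :: "'a \<Rightarrow> nat" where
    "\<forall>g\<in>carrier G. 0 < e g \<and> e g < r"
    "\<forall>g\<in>carrier G. \<forall>h\<in>carrier G. e (g \<otimes> h) mod r = (e g * e h) mod r"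
    "\<forall>g\<in>carrier G. \<forall>h\<in>carrier G. e g = e h \<longleftrightarrow> inv g \<otimes> h \<in> factor_centralizer G L K"
    "K \<subseteq> factor_centralizer G L K"
proof -
  let ?Q = "G Mod L"
  let ?p = "\<lambda>a. L #> a"
  interpret \<pi>: finite_group_hom G ?Q ?p by (rule quotient_hom(1)[OF normal_subgroupD[OF L]])
  have sK: "subgroup K G" using K by (rule normal_subgroupD)
  have Kc: "x \<in> carrier G" if "x \<in> K" for x using subgroup.mem_carrier[OF sK that] .
  have pK: "?p ` K \<lhd> ?Q"
    using \<pi>.subgroup_img_is_subgroup[OF sK]
      \<pi>.normalizes_image[OF subgroup_self subgroup.subset[OF sK] normal_subgroupD(2)[OF K]] \<pi>.surj
    by (simp add: \<pi>.H.normal_iff_normalizes)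
  have "K \<inter> kernel G ?Q ?p = L"
    using quotient_hom(2)[OF normal_subgroupD[OF L]] r(1) by auto
  then have "card (?p ` K) * card L = r * card L" using \<pi>.card_image_kernel[OF sK] r(3) by auto
  then have card: "card (?p ` K) = r" using card_subgroup_pos[OF normal_subgroupD(1)[OF L]] by simp
  obtain e' :: "'a set \<Rightarrow> nat" where e0':
    "\<forall>g\<in>carrier ?Q. 0 < e' g \<and> e' g < r"
    "\<forall>g\<in>carrier ?Q. \<forall>h\<in>carrier ?Q. e' (g \<otimes>\<^bsub>?Q\<^esub> h) mod r = (e' g * e' h) mod r"
    "\<forall>g\<in>carrier ?Q. \<forall>h\<in>carrier ?Q. e' g = e' h \<longleftrightarrow> (\<forall>u\<in>?p ` K. \<pi>.H.cj g u = \<pi>.H.cj h u)"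
    "\<forall>u\<in>?p ` K. \<forall>v\<in>?p ` K. \<pi>.H.cj u v = v"
    using \<pi>.fH.prime_order_exponent[OF pK r(2) card] .
  note e' = e0'(1,2,4)[rule_format] e0'(3)[rule_format]
  define e where "e g = e' (?p g)" for g
  have "0 < e g \<and> e g < r" if "g \<in> carrier G" for g
      unfolding e_def using e'(1) \<pi>.hom_closed[OF that] .
  moreover have "e (g \<otimes> h) mod r = (e g * e h) mod r" if gh: "g \<in> carrier G" "h \<in> carrier G" for g h
      unfolding e_def \<pi>.hom_mult[OF gh] using e'(2) \<pi>.hom_closed gh by blast
  moreover have "e g = e h \<longleftrightarrow> inv g \<otimes> h \<in> factor_centralizer G L K"
      if gh: "g \<in> carrier G" "h \<in> carrier G" for g h
    proof -
      have "\<pi>.H.cj (?p g) (?p x) = \<pi>.H.cj (?p h) (?p x) \<longleftrightarrow> inv x \<otimes> cj (inv g \<otimes> h) x \<in> L"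
        if x: "x \<in> K" for x
      proof -
        have "\<pi>.H.cj (?p g) (?p x) = \<pi>.H.cj (?p h) (?p x) \<longleftrightarrow> ?p (cj g x) = ?p (cj h x)"
          using \<pi>.hom_cj gh Kc[OF x] by simp
        also have "\<dots> \<longleftrightarrow> inv (cj g x) \<otimes> cj h x \<in> L"
          using gh Kc[OF x] by (intro rcoset_eq_iff[OF L]) auto
        also have "\<dots> \<longleftrightarrow> cj (inv g) (inv (cj g x) \<otimes> cj h x) \<in> L"
          using normal_cj[OF L, of "inv g" "inv (cj g x) \<otimes> cj h x"]
            normal_cj[OF L, of g "cj (inv g) (inv (cj g x) \<otimes> cj h x)"] gh Kc[OF x] by auto
        also have "cj (inv g) (inv (cj g x) \<otimes> cj h x) = inv x \<otimes> cj (inv g \<otimes> h) x"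
          using gh Kc[OF x] by (simp add: cj_def group_word_simps)
        finally show ?thesis .
      qed
      then show ?thesis
        unfolding e_def using e'(4)[of "?p g" "?p h"] \<pi>.hom_closed gh
        by (auto simp: factor_centralizer_def)
    qed
  moreover have "K \<subseteq> factor_centralizer G L K"
    proof
      fix k assume k: "k \<in> K"
      have "inv x \<otimes> cj k x \<in> L" if x: "x \<in> K" for x
        using e'(3)[of "?p k" "?p x"] rcoset_eq_iff[OF L, of x "cj k x"] \<pi>.hom_cj[OF Kc[OF k] Kc[OF x]]
          Kc[OF k] Kc[OF x] k x by auto
      then show "k \<in> factor_centralizer G L K" using Kc[OF k] by (simp add: factor_centralizer_def)
    qed
  ultimately show ?thesis using that[of e] by simp
qed

text \<open>Multiplication modulo \<open>r\<close> is commutative, so \<open>gh\<close> and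
  \<open>hg\<close> have the same exponent.\<close>

lemma factor_centralizer_contains_commutators:
  assumes "L \<lhd> G" "K \<lhd> G" "L \<subseteq> K" "prime r" "card K = r * card L"
    and gh: "g \<in> carrier G" "h \<in> carrier G"
  shows "inv (h \<otimes> g) \<otimes> (g \<otimes> h) \<in> factor_centralizer G L K"
proof -
  obtain e :: "'a \<Rightarrow> nat" where e0:
    "\<forall>g\<in>carrier G. 0 < e g \<and> e g < r"
    "\<forall>g\<in>carrier G. \<forall>h\<in>carrier G. e (g \<otimes> h) mod r = (e g * e h) mod r"
    "\<forall>g\<in>carrier G. \<forall>h\<in>carrier G. e g = e h \<longleftrightarrow> inv g \<otimes> h \<in> factor_centralizer G L K"
    by (rule factor_exponent[OF assms(1-5)]) (rule that; assumption)
  note e = e0[rule_format]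
  have "e (h \<otimes> g) mod r = e (g \<otimes> h) mod r" using e(2) gh by (simp add: mult.commute)
  then have "e (h \<otimes> g) = e (g \<otimes> h)" using e(1) gh by simp
  then show ?thesis using e(3) gh by simp
qed

lemma factor_centralizer_contains_factor:
  assumes "L \<lhd> G" "K \<lhd> G" "L \<subseteq> K" "prime r" "card K = r * card L"
  shows "K \<subseteq> factor_centralizer G L K"
  by (rule factor_exponent[OF assms])

text \<open>The index counts the exponents that occur on \<open>H\<close>, and there are only
  \<open>r - 1\<close> candidates.\<close>

lemma factor_centralizer_index:
  assumes "L \<lhd> G" "K \<lhd> G" "L \<subseteq> K" "prime r" "card K = r * card L" and H: "subgroup H G"
  obtains n where "card H = n * card (H \<inter> factor_centralizer G L K)" "0 < n" "n < r"
proof -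
  let ?F = "factor_centralizer G L K"
  obtain e :: "'a \<Rightarrow> nat" where e0:
    "\<forall>g\<in>carrier G. 0 < e g \<and> e g < r"
    "\<forall>g\<in>carrier G. \<forall>h\<in>carrier G. e g = e h \<longleftrightarrow> inv g \<otimes> h \<in> ?F"
    by (rule factor_exponent[OF assms(1-5)]) (rule that; assumption)
  note e = e0[rule_format]
  have Hc: "g \<in> carrier G" if "g \<in> H" for g using subgroup.mem_carrier[OF H that] .
  have F: "subgroup ?F G" using factor_centralizer_normal[OF assms(1,2)] normal_subgroupD by blast
  have "card H = card (e ` H) * card (H \<inter> ?F)"
    using e(2) Hc H by (intro card_fibres subgroup_int F) (auto simp: subgroup.m_closed subgroup.m_inv_closed)
  moreover have "card (e ` H) \<le> card {1..<r}"
    using e(1) Hc by (intro card_mono) (auto simp: Suc_le_eq)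
  moreover have "card (e ` H) > 0"
    using H by (simp add: card_gt_0_iff) (use subgroup.one_closed in blast)
  moreover have "card {1..<r} < r" using prime_gt_1_nat[OF assms(4)] by simp
  ultimately show ?thesis using that[of "card (e ` H)"] by linarith
qed

text \<open>The order of the induced group is a power of \<open>p\<close> below \<open>r\<close>,
  and \<open>r \<le> p\<close> leaves only 1.\<close>

lemma p_subgroup_centralizes_factor:
  assumes "L \<lhd> G" "K \<lhd> G" "L \<subseteq> K" "prime r" "card K = r * card L"
    and H: "subgroup H G" "prime p" "card H = p ^ a" "r \<le> p"
  shows "H \<subseteq> factor_centralizer G L K"
proof -
  obtain n where n: "card H = n * card (H \<inter> factor_centralizer G L K)" "0 < n" "n < r"
    using factor_centralizer_index[OF assms(1-5) H(1)] .
  then obtain i where i: "n = p ^ i" using power_of_prime_divisor[OF H(2)] H(3) by metis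
  have "i = 0"
  proof (rule ccontr)
    assume "i \<noteq> 0"
    then have "p \<le> n" using i n(2) by (intro dvd_imp_le) (auto simp: dvd_power)
    then show False using n(3) H(4) by simp
  qed
  then have "H \<inter> factor_centralizer G L K = H" using n i card_eq_imp_eq[OF H(1)] by simp
  then show ?thesis by blast
qed

lemma pow_index_mem:
  assumes "subgroup C G" "subgroup P G" "C \<subseteq> P" "normalizes G P C" "card P = n * card C" "g \<in> P"
  shows "g [^] n \<in> C"
proof -
  let ?P = "G\<lparr>carrier := P\<rparr>"
  have gP: "group ?P" using assms(2) by (rule subgroup_imp_group)
  interpret C: normal C ?P
    using assms(1-4) subgroup_incl group.normal_iff_normalizes[OF gP]
    by (simp add: normalizes_def)
  interpret Q: group "?P Mod C" by (rule C.factorgroup_is_group)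
  have "card (rcosets\<^bsub>?P\<^esub> C) * card C = card P"
    using C.lagrange[OF C.subgroup_axioms] by (simp add: order_def)
  then have ord: "order (?P Mod C) = n"
    using assms(5) card_subgroup_pos[OF assms(1)] by (simp add: order_def FactGroup_def)
  have "(C #>\<^bsub>?P\<^esub> g) [^]\<^bsub>?P Mod C\<^esub> n = C"
    using Q.pow_order_eq_1[of "C #>\<^bsub>?P\<^esub> g"] assms(6) ord by (simp add: carrier_FactGroup)
  then have "C #>\<^bsub>?P\<^esub> (g [^]\<^bsub>?P\<^esub> n) = C" using C.FactGroup_pow[of g n] assms(6) by simp
  then have "g [^]\<^bsub>?P\<^esub> n \<in> C"
    using C.coset_join1[OF _ _ C.subgroup_axioms] assms(6) C.nat_pow_closed[of g n] by simp
  then show ?thesis by (simp add: nat_pow_consistent [symmetric])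
qed

text \<open>The group induced on a factor of prime order is cyclic, so its \<open>p\<close>-subgroups form a chain.\<close>

lemma p_subgroups_on_factor_comparable:
  assumes LK: "L \<lhd> G" "K \<lhd> G" "L \<subseteq> K" "prime r" "card K = r * card L" and p: "prime p"
    and P: "subgroup P G" "card P = p ^ a * card (P \<inter> factor_centralizer G L K)"
    and P': "subgroup P' G" "card P' = p ^ b * card (P' \<inter> factor_centralizer G L K)"
    and "a \<le> b" "g \<in> P"
  obtains h where "h \<in> P'" "inv h \<otimes> g \<in> factor_centralizer G L K"
proof -
  let ?F = "factor_centralizer G L K"
  obtain e :: "'a \<Rightarrow> nat" where e0:
    "\<forall>g\<in>carrier G. 0 < e g \<and> e g < r"
    "\<forall>g\<in>carrier G. \<forall>h\<in>carrier G. e (g \<otimes> h) mod r = (e g * e h) mod r"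
    "\<forall>g\<in>carrier G. \<forall>h\<in>carrier G. e g = e h \<longleftrightarrow> inv g \<otimes> h \<in> ?F"
    by (rule factor_exponent[OF LK]) (rule that; assumption)
  note e = e0[rule_format]
  have nF: "?F \<lhd> G" by (rule factor_centralizer_normal[OF LK(1,2)])
  have F: "subgroup ?F G" by (rule normal_subgroupD[OF nF])
  have e_one: "e \<one> = 1"
  proof -
    have "e \<one> mod r * 1 = (e \<one> * e \<one>) mod r" using e(2)[of \<one> \<one>] by simp
    then have "[e \<one> * e \<one> = e \<one> * 1] (mod r)" by (simp add: cong_def)
    moreover have "coprime (e \<one>) r"
      using e(1)[of \<one>] prime_imp_coprime[OF LK(4), of "e \<one>"] nat_dvd_not_less[of "e \<one>" r]
      by (auto simp: coprime_commute)
    ultimately have "[e \<one> = 1] (mod r)" using cong_mult_lcancel_nat by blast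
    then show ?thesis using e(1)[of \<one>] prime_gt_1_nat[OF LK(4)] by (simp add: cong_def)
  qed
  have e_pow: "e (x [^] n) mod r = e x ^ n mod r" if x: "x \<in> carrier G" for x and n :: nat
  proof (induction n)
    case (Suc n)
    have "e (x [^] Suc n) mod r = (e (x [^] n) mod r) * e x mod r"
      using e(2)[of "x [^] n" x] x by (simp add: mod_mult_left_eq)
    then show ?case using Suc by (simp add: mod_mult_right_eq mult.commute)
  qed (simp add: e_one)
  have root: "e x ^ (p ^ b) mod r = 1 mod r"
    if "subgroup H G" "card H = p ^ i * card (H \<inter> ?F)" "i \<le> b" "x \<in> H" for H i x
  proof -
    have xc: "x \<in> carrier G" using subgroup.mem_carrier[OF that(1,4)] .
    have "normalizes G H (H \<inter> ?F)"
      using normalizes_int[OF normalizes_self[OF that(1)]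
          normalizes_mono[OF normal_subgroupD(2)[OF nF] subgroup.subset[OF that(1)]]] .
    then have "x [^] (p ^ i) \<in> H \<inter> ?F"
      using pow_index_mem[OF subgroup_int[OF that(1) F] that(1) _ _ that(2,4)] by simp
    then have "e \<one> = e (x [^] (p ^ i))" using e(3)[of \<one> "x [^] (p ^ i)"] xc by simp
    then have "e x ^ (p ^ i) mod r = 1 mod r" using e_pow[OF xc, of "p ^ i"] e_one by simp
    then have "(e x ^ (p ^ i)) ^ (p ^ (b - i)) mod r = 1 mod r"
      by (metis power_mod power_one)
    moreover have "p ^ i * p ^ (b - i) = p ^ b" using that(3) by (simp add: power_add [symmetric])
    ultimately show ?thesis by (simp add: power_mult [symmetric])
  qed
  \<comment> \<open>Modulo the prime \<open>r\<close> there are at most \<open>p ^ b\<close> roots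
    of this equation. The exponents of \<open>P'\<close> are \<open>p ^ b\<close> of them, hence
    all, and those of \<open>P\<close> are among them because \<open>a \<le> b\<close>.\<close>
  let ?T = "{y \<in> {..<r}. [y ^ (p ^ b) = 1] (mod r)}"
  have inT: "e x \<in> ?T"
    if "subgroup H G" "card H = p ^ i * card (H \<inter> ?F)" "i \<le> b" "x \<in> H" for H i x
    using root[OF that] e(1) subgroup.mem_carrier[OF that(1,4)] by (simp add: cong_def)
  have Pc: "x \<in> carrier G" if "x \<in> P'" for x using subgroup.mem_carrier[OF P'(1) that] .
  have "card P' = card (e ` P') * card (P' \<inter> ?F)"
    using e(3) Pc P'(1)
    by (intro card_fibres subgroup_int F) (auto simp: subgroup.m_closed subgroup.m_inv_closed)
  then have "card (e ` P') = p ^ b"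
    using P'(2) card_subgroup_pos[OF subgroup_int[OF P'(1) F]] by (simp del: card_0_eq)
  moreover have "card ?T \<le> p ^ b"
    using prime_gt_0_nat[OF p] by (intro roots_mod_prime_bound LK(4)) simp
  moreover have sub: "e ` P' \<subseteq> ?T" using inT[OF P' order_refl] by auto
  ultimately have "e ` P' = ?T" by (intro card_seteq) auto
  then have "e g \<in> e ` P'" using inT[OF P assms(11,12)] by simp
  then obtain h where "h \<in> P'" "e h = e g" by auto
  then show ?thesis using that e(3) Pc subgroup.mem_carrier[OF P(1) assms(12)] by blast
qed

end

section \<open>Minimal normal subgroups and nilpotent modular subgroups\<close>

context finite_group
begin

text \<open>\<open>\<Phi>\<close> is a parameter because two kinds of minimality occur below: among
  normal subgroups of \<open>G\<close> and among subgroups invariant under one factor.\<close>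

lemma minimal_subgroup_exists:
  assumes "\<And>X. \<Phi> X \<Longrightarrow> subgroup X G" and "\<Phi> R" "R \<noteq> {\<one>}"
  obtains V where "\<Phi> V" "V \<subseteq> R" "V \<noteq> {\<one>}" "\<forall>N. \<Phi> N \<and> N \<subseteq> V \<longrightarrow> N = {\<one>} \<or> N = V"
proof -
  have "\<exists>V. (\<Phi> V \<and> V \<subseteq> R \<and> V \<noteq> {\<one>}) \<and> (\<forall>N. \<Phi> N \<and> N \<subseteq> R \<and> N \<noteq> {\<one>} \<longrightarrow> card V \<le> card N)"
    by (rule ex_has_least_nat[of _ R]) (use assms in simp)
  then obtain V where V: "\<Phi> V" "V \<subseteq> R" "V \<noteq> {\<one>}"
    and min: "\<And>N. \<lbrakk>\<Phi> N; N \<subseteq> R; N \<noteq> {\<one>}\<rbrakk> \<Longrightarrow> card V \<le> card N" by auto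
  have "N = {\<one>} \<or> N = V" if N: "\<Phi> N" "N \<subseteq> V" for N
  proof (rule disjCI)
    assume "N \<noteq> V"
    show "N = {\<one>}"
    proof (rule ccontr)
      assume "N \<noteq> {\<one>}"
      then have "card V \<le> card N" using min N V(2) by auto
      then have "N = V" using card_seteq[OF finite_subgroup[OF assms(1)[OF V(1)]] N(2)] by simp
      then show False using \<open>N \<noteq> V\<close> by simp
    qed
  qed
  then show ?thesis using that V by simp
qed

lemma maximal_subgroup_exists:
  assumes "\<And>X. \<Phi> X \<Longrightarrow> subgroup X G" and "\<Phi> X" "X \<subset> R" "R \<subseteq> carrier G"
  obtains M where "\<Phi> M" "X \<subseteq> M" "M \<subset> R" "\<forall>N. \<Phi> N \<and> M \<subseteq> N \<and> N \<subseteq> R \<longrightarrow> N = M \<or> N = R"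
proof -
  have fR: "finite R" using assms(4) finite_subset by blast
  have "\<exists>M. (\<Phi> M \<and> X \<subseteq> M \<and> M \<subset> R) \<and> (\<forall>N. \<Phi> N \<and> X \<subseteq> N \<and> N \<subset> R \<longrightarrow> card N \<le> card M)"
  proof (rule ex_has_greatest_nat[of _ X _ "Suc (card R)"])
    show "\<forall>N. \<Phi> N \<and> X \<subseteq> N \<and> N \<subset> R \<longrightarrow> card N < Suc (card R)"
      using psubset_card_mono[OF fR] less_SucI by blast
  qed (use assms in simp)
  then obtain M where M: "\<Phi> M" "X \<subseteq> M" "M \<subset> R"
    and max: "\<forall>N. \<Phi> N \<and> X \<subseteq> N \<and> N \<subset> R \<longrightarrow> card N \<le> card M" by blast
  have "N = M \<or> N = R" if N: "\<Phi> N" "M \<subseteq> N" "N \<subseteq> R" for N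
  proof (rule disjCI)
    assume "N \<noteq> R"
    then have "card N \<le> card M" using max N M(2) by auto
    then show "N = M" using card_seteq[OF finite_subgroup[OF assms(1)[OF N(1)]] N(2)] by simp
  qed
  then show ?thesis using that M by simp
qed

lemma fixed_points_normal:
  assumes R: "R \<lhd> G" and V: "V \<lhd> G"
  shows "{v \<in> V. \<forall>g\<in>R. cj g v = v} \<lhd> G"
proof -
  let ?F = "{v \<in> V. \<forall>g\<in>R. cj g v = v}"
  have sR: "subgroup R G" and sV: "subgroup V G" using R V normal_subgroupD by auto
  have "cj g v \<in> ?F" if g: "g \<in> carrier G" and v: "v \<in> ?F" for g v
  proof -
    have vc: "v \<in> carrier G" using v subgroup.mem_carrier[OF sV] by blast
    have "cj d (cj g v) = cj g v" if d: "d \<in> R" for d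
    proof -
      have dc: "d \<in> carrier G" using subgroup.mem_carrier[OF sR d] .
      have "cj (inv g) d \<in> R" using normal_cj[OF R _ d] g by simp
      then have "cj g (cj (cj (inv g) d) v) = cj g v" using v by simp
      moreover have "cj g (cj (cj (inv g) d) v) = cj (cj g (cj (inv g) d)) (cj g v)"
        using g dc vc by (intro cj_cj) auto
      ultimately show ?thesis using g dc by simp
    qed
    then show ?thesis using normal_cj[OF V g] v by simp
  qed
  then have "normalizes G (carrier G) ?F" unfolding normalizes_iff by blast
  then show ?thesis
    using subgroup_fixed_points[OF sV subgroup.subset[OF sR]] by (simp add: normal_iff_normalizes)
qed

text \<open>The fixed points of \<open>R\<close> in \<open>V\<close> form a normal subgroup of
  \<open>G\<close>, which is nontrivial because \<open>R\<close> and \<open>V\<close> are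
  \<open>r\<close>-groups.\<close>

lemma p_group_centralizes_minimal_normal:
  assumes R: "R \<lhd> G" "card R = r ^ a" "prime r" and V: "V \<lhd> G" "V \<subseteq> R" "V \<noteq> {\<one>}"
    and min: "\<forall>N. N \<lhd> G \<and> N \<subseteq> V \<longrightarrow> N = {\<one>} \<or> N = V"
  shows "\<forall>g\<in>R. \<forall>v\<in>V. cj g v = v"
proof -
  have sR: "subgroup R G" and sV: "subgroup V G" using R(1) V(1) normal_subgroupD by auto
  have Rc: "g \<in> carrier G" if "g \<in> R" for g using subgroup.mem_carrier[OF sR that] .
  have Vc: "g \<in> carrier G" if "g \<in> V" for g using subgroup.mem_carrier[OF sV that] .
  let ?F = "{v \<in> V. \<forall>g\<in>R. cj g v = v}"
  have "?F \<lhd> G" by (rule fixed_points_normal[OF R(1) V(1)])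
  then have F: "?F = {\<one>} \<or> ?F = V" using min by blast
  have "card V dvd r ^ a" using card_subgroup_dvd[OF sV sR V(2)] R(2) by simp
  then obtain b where b: "card V = r ^ b" using R(3) divides_primepow_nat by blast
  have "normalizes G R V" using normalizes_mono[OF normal_subgroupD(2)[OF V(1)] subgroup.subset[OF sR]] .
  then obtain v where "v \<in> V" "v \<noteq> \<one>" "\<forall>d\<in>R. cj d v = v"
    by (rule p_group_centralizes_nontrivial[OF sR sV R(3,2) b V(3)])
  then have "?F \<noteq> {\<one>}" by blast
  then have "?F = V" using F by blast
  then show ?thesis by blast
qed

text \<open>The commutator of \<open>x\<close> and \<open>y\<close> lies in
  \<open>X \<inter> Y\<close>, which is trivial by coprime orders.\<close>

lemma coprime_order_commute:
  assumes X: "subgroup X G" "card X = s ^ i" and Y: "subgroup Y G" "card Y = t ^ j"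
    and st: "prime s" "prime t" "s \<noteq> t"
    and nrm: "normalizes G X Y" "normalizes G Y X" and xy: "x \<in> X" "y \<in> Y"
  shows "cj x y = y"
proof -
  have c: "x \<in> carrier G" "y \<in> carrier G"
    using subgroup.mem_carrier[OF X(1) xy(1)] subgroup.mem_carrier[OF Y(1) xy(2)] .
  have sub: "subgroup (X \<inter> Y) G" using X(1) Y(1) by (rule subgroup_int)
  have "card (X \<inter> Y) dvd s ^ i" "card (X \<inter> Y) dvd t ^ j"
    using card_subgroup_dvd[OF sub X(1)] card_subgroup_dvd[OF sub Y(1)] X(2) Y(2) by auto
  then have "X \<inter> Y = {\<one>}"
    using prime_power_dvd_cases[OF st] card_one_iff[OF sub] by blast
  moreover have "cj x y \<otimes> inv y \<in> Y"
    using normalizesD[OF nrm(1) xy] xy(2) Y(1) by (simp add: subgroup.m_closed subgroup.m_inv_closed)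
  moreover have "cj x y \<otimes> inv y = x \<otimes> cj y (inv x)" using c by (simp add: cj_def group_word_simps)
  then have "cj x y \<otimes> inv y \<in> X"
    using normalizesD[OF nrm(2) xy(2), of "inv x"] xy(1) X(1) by (simp add: subgroup.m_closed subgroup.m_inv_closed)
  ultimately have "cj x y \<otimes> inv y = \<one>" by blast
  then show ?thesis using c by (simp add: inv_solve_right')
qed

lemma prime_order_subgroup_exists:
  assumes "subgroup K G" "prime r" "r dvd card K"
  obtains D where "subgroup D G" "D \<subseteq> K" "card D = r"
proof -
  have gK: "group (G\<lparr>carrier := K\<rparr>)" using assms(1) by (rule subgroup_imp_group)
  obtain m where "order (G\<lparr>carrier := K\<rparr>) = r ^ 1 * m" using assms(3) by (auto simp: order_def)
  then obtain D where D: "subgroup D (G\<lparr>carrier := K\<rparr>)" "card D = r ^ 1"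
    using sylow_thm[OF assms(2) gK, of 1 m] assms(1) by auto
  then show ?thesis
    using that incl_subgroup[OF assms(1) D(1)] subgroup.subset[OF D(1)] by auto
qed

text \<open>Minimality of \<open>V\<close> leaves two cases. If \<open>V\<close> lies in
  \<open>A\<close>, it meets the centre of \<open>A\<close>, so its \<open>A\<close>-fixed points
  are all of \<open>V\<close>. If \<open>A \<inter> V\<close> is trivial, \<open>A\<close> is
  maximal in \<open>AV\<close>, hence a modular step: a normal step puts the commutators of
  \<open>A\<close> and \<open>V\<close> into \<open>A \<inter> V\<close>, and a step of prime index
  has index \<open>|V|\<close>.\<close>

lemma nilpotent_irreducible:
  assumes A: "subgroup A G" "nilpotent_over G {\<one>} A" "modular_chain k G A (carrier G)"
    and V: "subgroup V G" "V \<noteq> {\<one>}" "normalizes G A V"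
    and min: "\<forall>X. (subgroup X G \<and> normalizes G A X) \<and> X \<subseteq> V \<longrightarrow> X = {\<one>} \<or> X = V"
  shows "prime (card V) \<or> (\<forall>a\<in>A. \<forall>v\<in>V. cj a v = v)"
proof -
  have Ac: "a \<in> carrier G" if "a \<in> A" for a using subgroup.mem_carrier[OF A(1) that] .
  have Vc: "v \<in> carrier G" if "v \<in> V" for v using subgroup.mem_carrier[OF V(1) that] .
  have "A \<inter> V = {\<one>} \<or> A \<inter> V = V"
    using min subgroup_int[OF A(1) V(1)] normalizes_int[OF normalizes_self[OF A(1)] V(3)] by blast
  then show ?thesis
  proof
    assume "A \<inter> V = V"
    then have "V \<subseteq> A" by blast
    then obtain v where v: "v \<in> V" "v \<noteq> \<one>" "\<forall>a\<in>A. cj a v = v"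
      by (rule nilpotent_normal_meets_centre[OF A(2) V(1) _ V(3,2)])
    let ?F = "{v \<in> V. \<forall>a\<in>A. cj a v = v}"
    have "subgroup ?F G" using subgroup_fixed_points[OF V(1) subgroup.subset[OF A(1)]] .
    moreover have "normalizes G A ?F" unfolding normalizes_iff by auto
    ultimately have "?F = {\<one>} \<or> ?F = V" using min by blast
    then have "?F = V" using v by blast
    then show ?thesis by blast
  next
    assume AV: "A \<inter> V = {\<one>}"
    let ?U = "A <#> V"
    have U: "subgroup ?U G" by (rule subgroup_set_mult[OF A(1) V(1,3)])
    have AU: "A \<subseteq> ?U" and VU: "V \<subseteq> ?U"
      using set_mult_superset_left[OF A(1) V(1)] set_mult_superset_right[OF A(1) V(1)] .
    have one: "\<one> \<in> V" using V(1) by (rule subgroup.one_closed)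
    have "A \<noteq> ?U"
    proof
      assume "A = ?U"
      then have "V \<subseteq> A" using VU by simp
      then show False using AV V(2) by blast
    qed
    then have AU': "A \<subset> ?U" using AU by blast
    have "Z = A \<or> Z = ?U" if Z: "subgroup Z G" "A \<subseteq> Z" "Z \<subseteq> ?U" for Z
    proof -
      have "subgroup (Z \<inter> V) G" using Z(1) V(1) by (rule subgroup_int)
      moreover have "normalizes G A (Z \<inter> V)"
        using normalizes_int[OF normalizes_mono[OF normalizes_self[OF Z(1)] Z(2)] V(3)] .
      ultimately have "Z \<inter> V = {\<one>} \<or> Z \<inter> V = V" using min by blast
      then show ?thesis
      proof
        assume ZV: "Z \<inter> V = {\<one>}"
        have "z \<in> A" if z: "z \<in> Z" for z
        proof -
          obtain a v where av: "a \<in> A" "v \<in> V" "z = a \<otimes> v" using z Z(3) by (auto simp: set_mult_def)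
          then have "v = inv a \<otimes> z" using Ac Vc by simp
          then have "v \<in> Z" using av(1) z Z by (auto intro: subgroup.m_closed subgroup.m_inv_closed)
          then have "v = \<one>" using ZV av(2) by blast
          then show ?thesis using av Ac by simp
        qed
        then show ?thesis using Z(2) by blast
      next
        assume "Z \<inter> V = V"
        then have "?U \<subseteq> Z" using set_mult_subset[OF Z(1,2)] by blast
        then show ?thesis using Z(3) by blast
      qed
    qed
    then have "modular_step k G A ?U" by (rule maximal_modular_step[OF A(3,1) U AU'])
    then show ?thesis
    proof (cases rule: modular_stepE)
      case normal
      have "cj a v = v" if av: "a \<in> A" "v \<in> V" for a v
      proof -
        have "inv v \<otimes> cj a v \<in> V"
          using normalizesD[OF V(3) av] av(2) V(1) by (simp add: subgroup.m_closed subgroup.m_inv_closed)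
        moreover have "inv v \<in> ?U" using av(2) VU U by (auto intro: subgroup.m_inv_closed)
        then have "cj (inv v) a \<otimes> inv a \<in> A"
          using normalizesD[OF normal(4) _ av(1)] av(1) A(1) by (simp add: subgroup.m_closed subgroup.m_inv_closed)
        moreover have "cj (inv v) a \<otimes> inv a = inv v \<otimes> cj a v"
          using Ac[OF av(1)] Vc[OF av(2)] by (simp add: cj_def group_word_simps)
        ultimately have "inv v \<otimes> cj a v = \<one>" using AV by auto
        then show ?thesis using Ac[OF av(1)] Vc[OF av(2)] by (metis cj_closed inv_closed inv_inv inv_equality)
      qed
      then show ?thesis by blast
    next
      case (prime_index p q m C)
      have "card ?U * card (A \<inter> V) = card A * card V" by (rule card_set_mult[OF A(1) V(1)])
      then have "p * card A = card A * card V" using AV prime_index(7) by simp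
      then have "card V = p" using card_subgroup_pos[OF A(1)] by simp
      then show ?thesis using prime_index(4) by simp
    qed
  qed
qed

lemma sylow_subset_imp_index:
  assumes sub: "subgroup W G" "subgroup Z G" "W \<subseteq> Z" and s: "prime s" "card Z = s * card W"
    and T: "subgroup T G" "card T = s ^ multiplicity s (card Z)"
  shows "\<not> T \<subseteq> W"
proof
  assume "T \<subseteq> W"
  then have "s ^ multiplicity s (card Z) dvd card W" using card_subgroup_dvd[OF T(1) sub(1)] T(2) by simp
  then have "multiplicity s (card Z) \<le> multiplicity s (card W)"
    using card_subgroup_pos[OF sub(1)] s(1) not_prime_unit by (intro multiplicity_geI) auto
  moreover have "multiplicity s (card Z) = Suc (multiplicity s (card W))"
    unfolding s(2) using card_subgroup_pos[OF sub(1)] prime_gt_1_nat[OF s(1)]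
    by (intro multiplicity_times_same) auto
  ultimately show False by simp
qed

lemma normal_sylow_index_coprime:
  assumes R: "subgroup R G" "card R = r ^ multiplicity r (order G)" "prime r"
    and WZ: "subgroup W G" "subgroup Z G" "R \<subseteq> W" "card Z = s * card W"
  shows "s \<noteq> r"
proof
  assume "s = r"
  have "r ^ multiplicity r (order G) dvd card W" using card_subgroup_dvd[OF R(1) WZ(1,3)] R(2) by simp
  then have "r * r ^ multiplicity r (order G) dvd card Z" using WZ(4) \<open>s = r\<close> by (simp add: mult_dvd_mono)
  also have "card Z dvd order G"
    using card_subgroup_dvd[OF WZ(2) subgroup_self subgroup.subset[OF WZ(2)]] by (simp add: order_def)
  finally have "r ^ Suc (multiplicity r (order G)) dvd order G" by simp
  then have "Suc (multiplicity r (order G)) \<le> multiplicity r (order G)"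
    using order_gt_0_iff_finite R(3) not_prime_unit by (intro multiplicity_geI) auto
  then show False by simp
qed

end

section \<open>Products of two nilpotent modular subgroups\<close>

text \<open>The hypotheses of the theorem in the relative form that surjective homomorphisms
  preserve, so that the locale can be reinterpreted in quotients.\<close>

locale factorised_group = finite_group +
  fixes A B :: "'a set" and k :: nat
  assumes A: "subgroup A G" "nilpotent_over G {\<one>} A" "modular_chain k G A (carrier G)"
    and B: "subgroup B G" "nilpotent_over G {\<one>} B" "modular_chain k G B (carrier G)"
    and AB: "carrier G = A <#> B"
begin

lemma A_carrier [simp]: "a \<in> A \<Longrightarrow> a \<in> carrier G"
  by (rule subgroup.mem_carrier[OF A(1)])

lemma B_carrier [simp]: "b \<in> B \<Longrightarrow> b \<in> carrier G"
  by (rule subgroup.mem_carrier[OF B(1)])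

lemma factorise: 
  assumes "g \<in> carrier G" obtains a b where "a \<in> A" "b \<in> B" "g = a \<otimes> b"
  using assms unfolding AB by (auto simp: set_mult_def)

text \<open>Inverting a factorisation reverses its order; arguments about one factor thereby apply
  to the other.\<close>

lemma swap: "factorised_group G B A k"
proof (intro factorised_group.intro finite_group_axioms factorised_group_axioms.intro A B)
  show "carrier G = B <#> A"
  proof
    show "carrier G \<subseteq> B <#> A"
    proof
      fix g assume g: "g \<in> carrier G"
      then obtain a b where ab: "a \<in> A" "b \<in> B" "inv g = a \<otimes> b" using factorise[of "inv g"] by auto
      then have "g = inv b \<otimes> inv a" using g by (metis A_carrier B_carrier inv_inv inv_mult_group)
      then show "g \<in> B <#> A"
        using ab A(1) B(1) set_multI[of "inv b" B "inv a" A] by (simp add: subgroup.m_inv_closed)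
    qed
    show "B <#> A \<subseteq> carrier G"
      using setmult_subset_G subgroup.subset A(1) B(1) by blast
  qed
qed

lemma factors_normalize:
  assumes "normalizes G A X" "normalizes G B X" "X \<subseteq> carrier G"
  shows "normalizes G (carrier G) X"
  unfolding normalizes_iff
proof (intro ballI)
  fix g x assume g: "g \<in> carrier G" and x: "x \<in> X"
  obtain a b where ab: "a \<in> A" "b \<in> B" "g = a \<otimes> b" using factorise[OF g] .
  have "cj g x = cj a (cj b x)" using ab x assms(3) by (simp add: cj_mult_left subsetD)
  then show "cj g x \<in> X"
    using normalizesD[OF assms(1) ab(1) normalizesD[OF assms(2) ab(2) x]] by simp
qed

text \<open>A Sylow subgroup containing \<open>As\<close> has a conjugate by an element of \<open>A\<close> that contains both
  \<open>As\<close> and \<open>Bs\<close>, since conjugation by elements of \<open>A\<close> and \<open>B\<close> fixes \<open>As\<close> and \<open>Bs\<close>, respectively.\<close>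

lemma product_of_sylows:
  assumes s: "prime s"
    and As: "subgroup As G" "As \<subseteq> A" "card As = s ^ multiplicity s (card A)" "normalizes G A As"
    and Bs: "subgroup Bs G" "Bs \<subseteq> B" "card Bs = s ^ multiplicity s (card B)" "normalizes G B Bs"
  shows "subgroup (As <#> Bs) G" "card (As <#> Bs) = s ^ multiplicity s (order G)"
proof -
  obtain S where S: "subgroup S G" "S \<subseteq> carrier G" "card S = s ^ multiplicity s (order G)"
    using sylow_exists[OF subgroup_self s] unfolding order_def .
  have Sylow: "subgroup (cj g ` S) G" "cj g ` S \<subseteq> carrier G" "card (cj g ` S) = s ^ multiplicity s (card (carrier G))"
    if "g \<in> carrier G" for g
    using subgroup_cj_image[OF that S(1)] card_cj_image[OF that S(2)] S(3) subgroup.subset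
    by (auto simp: order_def)
  obtain g where g: "g \<in> carrier G" "As \<subseteq> cj g ` S"
    using sylow_contains_conjugate[OF As(1) S(1) subgroup_self subgroup.subset[OF As(1)] S(2) s As(3)]
      S(3) unfolding order_def by blast
  obtain x where x: "x \<in> carrier G" "Bs \<subseteq> cj x ` cj g ` S"
    using sylow_contains_conjugate[OF Bs(1) Sylow(1)[OF g(1)] subgroup_self subgroup.subset[OF Bs(1)]
        Sylow(2)[OF g(1)] s Bs(3) Sylow(3)[OF g(1)]] by blast
  obtain b a where ab: "b \<in> B" "a \<in> A" "x = b \<otimes> a"
    using factorised_group.factorise[OF swap x(1)] .
  let ?T = "cj (a \<otimes> g) ` S"
  have T: "subgroup ?T G" "card ?T = s ^ multiplicity s (order G)"
    using Sylow[of "a \<otimes> g"] ab g by (auto simp: order_def)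
  have Sc: "y \<in> carrier G" if "y \<in> S" for y using S(2) that by auto
  have "As \<subseteq> ?T"
  proof
    fix y assume y: "y \<in> As"
    have "cj (inv a) y \<in> As" using normalizesD[OF As(4) _ y] ab(2) A(1) by (simp add: subgroup.m_inv_closed)
    then obtain z where z: "z \<in> S" "cj (inv a) y = cj g z" using g(2) by blast
    have "y = cj a (cj (inv a) y)" using ab(2) subgroup.mem_carrier[OF As(1) y] by simp
    also have "\<dots> = cj (a \<otimes> g) z" using z ab(2) g(1) Sc by (simp add: cj_mult_left)
    finally show "y \<in> ?T" using z(1) by blast
  qed
  moreover have "Bs \<subseteq> ?T"
  proof
    fix y assume y: "y \<in> Bs"
    have "cj b y \<in> Bs" using normalizesD[OF Bs(4) ab(1) y] .
    then obtain z where z: "z \<in> S" "cj b y = cj x (cj g z)" using x(2) by blast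
    have "y = cj (inv b) (cj b y)" using ab(1) subgroup.mem_carrier[OF Bs(1) y] by simp
    also have "\<dots> = cj (a \<otimes> g) z"
      using z ab g(1) Sc by (simp add: cj_mult_left)
    finally show "y \<in> ?T" using z(1) by blast
  qed
  ultimately have sub: "As <#> Bs \<subseteq> ?T" by (rule set_mult_subset[OF T(1)])
  \<comment> \<open>Compare \<open>s\<close>-parts in \<open>|G| |A \<inter> B| = |A| |B|\<close>.
    As \<open>As \<inter> Bs\<close> is an \<open>s\<close>-subgroup of \<open>A \<inter> B\<close>,
    its order is at most the \<open>s\<close>-part of \<open>|A \<inter> B|\<close>, so the product
    set is as large as a Sylow subgroup.\<close>
  have "card ?T \<le> card (As <#> Bs)"
  proof -
    have AsBs: "subgroup (As \<inter> Bs) G" and AiB: "subgroup (A \<inter> B) G"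
      using As(1) Bs(1) A(1) B(1) subgroup_int by auto
    have pos: "card A \<noteq> 0" "card B \<noteq> 0" "card (A \<inter> B) \<noteq> 0" "order G \<noteq> 0"
      using card_subgroup_pos[OF A(1)] card_subgroup_pos[OF B(1)] card_subgroup_pos[OF AiB]
        order_gt_0_iff_finite by (auto simp del: card_0_eq)
    have ps: "prime_elem s" using s by simp
    have "order G * card (A \<inter> B) = card A * card B"
      using card_set_mult[OF A(1) B(1)] AB by (simp add: order_def)
    then have "multiplicity s (order G * card (A \<inter> B)) = multiplicity s (card A * card B)" by simp
    then have mult: "multiplicity s (order G) + multiplicity s (card (A \<inter> B)) =
      multiplicity s (card A) + multiplicity s (card B)"
      using pos prime_elem_multiplicity_mult_distrib[OF ps] by metis
    have eq: "card (As <#> Bs) * card (As \<inter> Bs) = s ^ (multiplicity s (card A) + multiplicity s (card B))"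
      using card_set_mult[OF As(1) Bs(1)] As(3) Bs(3) by (simp add: power_add)
    have "card (As \<inter> Bs) dvd s ^ multiplicity s (card A)"
      using card_subgroup_dvd[OF AsBs As(1)] As(3) by simp
    then obtain i where i: "card (As \<inter> Bs) = s ^ i" using s divides_primepow_nat by blast
    have "s ^ i dvd card (A \<inter> B)"
      using card_subgroup_dvd[OF AsBs AiB] As(2) Bs(2) i by auto
    then have "i \<le> multiplicity s (card (A \<inter> B))"
      using pos(3) s not_prime_unit by (intro multiplicity_geI) auto
    then have "card (As \<inter> Bs) \<le> s ^ multiplicity s (card (A \<inter> B))"
      using i prime_ge_1_nat[OF s] by (simp add: power_increasing)
    then have "card (As <#> Bs) * s ^ multiplicity s (card (A \<inter> B)) \<ge>
      s ^ multiplicity s (order G) * s ^ multiplicity s (card (A \<inter> B))"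
      using eq mult by (metis mult_le_mono2 power_add)
    then show ?thesis using T(2) prime_gt_0_nat[OF s] by simp
  qed
  then have eq: "As <#> Bs = ?T" using card_seteq[OF finite_subgroup[OF T(1)] sub] by simp
  show "subgroup (As <#> Bs) G" "card (As <#> Bs) = s ^ multiplicity s (order G)"
    using T eq by simp_all
qed

end

text \<open>The inductive form of having chief factors of prime order: if \<open>N' / N\<close> is a
  chief factor, \<open>L\<close> can only be \<open>N'\<close>.\<close>

definition prime_factor_between :: "('a, 'b) monoid_scheme \<Rightarrow> 'a set \<Rightarrow> 'a set \<Rightarrow> bool" where
  "prime_factor_between G N N' \<longleftrightarrow>
     (\<exists>L p. L \<lhd> G \<and> N \<subseteq> L \<and> L \<subseteq> N' \<and> prime (p :: nat) \<and> card L = p * card N)"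

section \<open>A minimal normal subgroup that is a Sylow subgroup\<close>

context factorised_group
begin

text \<open>\<open>B\<close> centralises \<open>R\<close>: its Sylow \<open>r\<close>-subgroup is
  the abelian group \<open>R\<close>, and its other Sylow subgroups commute with \<open>R\<close> by
  nilpotency. So \<open>A\<close>-invariant subgroups of \<open>R\<close> are normal in
  \<open>G\<close>, and \<open>A\<close> acts irreducibly on \<open>R\<close>.\<close>

lemma minimal_normal_in_factor:
  assumes R: "R \<lhd> G" "R \<noteq> {\<one>}" "prime r" "card R = r ^ a"
    and min: "\<forall>N. N \<lhd> G \<and> N \<subseteq> R \<longrightarrow> N = {\<one>} \<or> N = R"
    and RB: "R \<subseteq> B" "card R = r ^ multiplicity r (card B)"
  shows "prime (card R)"
proof -
  have sR: "subgroup R G" by (rule normal_subgroupD[OF R(1)])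
  have Rc: "R \<subseteq> carrier G" by (rule subgroup.subset[OF sR])
  have abel: "\<forall>g\<in>R. \<forall>v\<in>R. cj g v = v"
    by (rule p_group_centralizes_minimal_normal[OF R(1,4,3,1) subset_refl R(2) min])
  have nR: "normalizes G X R" if "X \<subseteq> carrier G" for X
    using normal_subgroupD(2)[OF R(1)] that by (rule normalizes_mono)
  have "{b \<in> B. \<forall>u\<in>R. cj b u = u} = B"
  proof (rule subgroup_eq_by_sylow[OF subgroup_fixator[OF B(1) Rc] B(1)])
    fix t :: nat assume t: "prime t"
    show "\<exists>S. subgroup S G \<and> S \<subseteq> {b \<in> B. \<forall>u\<in>R. cj b u = u} \<and> card S = t ^ multiplicity t (card B)"
    proof (cases "t = r")
      case True
      then show ?thesis using sR RB abel by (intro exI[of _ R]) auto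
    next
      case False
      obtain S where S: "subgroup S G" "S \<subseteq> B" "card S = t ^ multiplicity t (card B)" "normalizes G B S"
        using nilpotent_sylow_normal[OF B(1,2) t] .
      have "cj x u = u" if "x \<in> S" "u \<in> R" for x u
        by (rule coprime_order_commute[OF S(1,3) sR R(4) t R(3) False nR[OF subgroup.subset[OF S(1)]]
              normalizes_mono[OF S(4) RB(1)] that])
      then show ?thesis using S by (intro exI[of _ S]) auto
    qed
  qed auto
  then have Bcent: "cj b u = u" if "b \<in> B" "u \<in> R" for b u using that by blast
  have normal: "X \<lhd> G" if X: "subgroup X G" "normalizes G A X" "X \<subseteq> R" for X
  proof -
    have "normalizes G B X" unfolding normalizes_iff using Bcent X(3) by auto
    then show ?thesis
      using factors_normalize[OF X(2) _ subgroup.subset[OF X(1)]] X(1) by (simp add: normal_iff_normalizes)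
  qed
  have "prime (card R) \<or> (\<forall>a\<in>A. \<forall>v\<in>R. cj a v = v)"
    using normal min by (intro nilpotent_irreducible[OF A sR R(2) nR[OF subgroup.subset[OF A(1)]]]) blast
  then show ?thesis
  proof
    \<comment> \<open>Now every subgroup of \<open>R\<close> is normal in \<open>G\<close>, in
      particular one of order \<open>r\<close>.\<close>
    assume Acent: "\<forall>a\<in>A. \<forall>v\<in>R. cj a v = v"
    have "card R \<noteq> 1" using R(2) card_one_iff[OF sR] by simp
    then have "r dvd card R" using R(4) by (cases a) auto
    then obtain D where D: "subgroup D G" "D \<subseteq> R" "card D = r"
      using prime_order_subgroup_exists[OF sR R(3)] by blast
    have "normalizes G A D" unfolding normalizes_iff using Acent D(2) by auto
    then have "D = {\<one>} \<or> D = R" using normal[OF D(1) _ D(2)] min D(2) by blast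
    moreover have "D \<noteq> {\<one>}" using D(3) R(3) by (auto simp: prime_nat_iff)
    ultimately show ?thesis using D(3) R(3) by simp
  qed
qed

text \<open>Here \<open>z\<close> generates a normal subgroup of prime order \<open>s\<close> in the group induced on \<open>R\<close>. It
  acts without fixed points, and a decomposition \<open>z = ab\<close> inside a Sylow \<open>s\<close>-subgroup shows that
  \<open>R \<inter> B = [R, a]\<close> is invariant under \<open>A\<close>.\<close>

lemma minimal_normal_sylow:
  assumes R: "R \<lhd> G" "R \<noteq> {\<one>}" "prime r" "card R = r ^ multiplicity r (order G)"
    and min: "\<forall>N. N \<lhd> G \<and> N \<subseteq> R \<longrightarrow> N = {\<one>} \<or> N = R"
    and factors: "\<And>N N'. \<lbrakk>N \<lhd> G; N' \<lhd> G; N \<subset> N'; N \<noteq> {\<one>}\<rbrakk> \<Longrightarrow> prime_factor_between G N N'"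
  shows "prime (card R)"
proof -
  have sR: "subgroup R G" by (rule normal_subgroupD[OF R(1)])
  have Rsub: "R \<subseteq> carrier G" by (rule subgroup.subset[OF sR])
  have Rc [simp]: "u \<in> carrier G" if "u \<in> R" for u using Rsub that by auto
  have abel: "\<forall>g\<in>R. \<forall>v\<in>R. cj g v = v"
    by (rule p_group_centralizes_minimal_normal[OF R(1,4,3,1) subset_refl R(2) min])
  have comm: "u \<otimes> v = v \<otimes> u" if "u \<in> R" "v \<in> R" for u v
    using abel that cj_eq_self_iff[of u v] by simp
  have nR: "normalizes G X R" if "X \<subseteq> carrier G" for X
    using normal_subgroupD(2)[OF R(1)] that by (rule normalizes_mono)
  have cjR [simp]: "cj g u \<in> R" if "g \<in> carrier G" "u \<in> R" for g u
    using normal_cj[OF R(1) that] .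
  obtain Ar where Ar: "subgroup Ar G" "Ar \<subseteq> A" "card Ar = r ^ multiplicity r (card A)" "normalizes G A Ar"
    using nilpotent_sylow_normal[OF A(1,2) R(3)] .
  obtain Br where Br: "subgroup Br G" "Br \<subseteq> B" "card Br = r ^ multiplicity r (card B)" "normalizes G B Br"
    using nilpotent_sylow_normal[OF B(1,2) R(3)] .
  note prod = product_of_sylows[OF R(3) Ar Br]
  have "Ar <#> Br \<subseteq> R"
    by (rule p_subgroup_subset_normal_sylow[OF prod(1) sR subgroup_self subgroup.subset[OF prod(1)] Rsub R(3)
          prod(2) _ normal_subgroupD(2)[OF R(1)]]) (use R(4) in \<open>simp add: order_def\<close>)
  then have ArBr: "Ar <#> Br = R" using card_eq_imp_eq[OF sR] prod(2) R(4) by simp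
  have ArR: "Ar \<subseteq> R" and BrR: "Br \<subseteq> R"
    using set_mult_superset_left[OF Ar(1) Br(1)] set_mult_superset_right[OF Ar(1) Br(1)] ArBr by auto
  have dec: "\<exists>x\<in>Ar. \<exists>y\<in>Br. u = x \<otimes> y" if "u \<in> R" for u
    using that ArBr by (auto simp: set_mult_def)
  have done_B: ?thesis if "Br = R"
    using minimal_normal_in_factor[OF R min] that Br by simp
  have done_A: ?thesis if "Ar = R"
    using factorised_group.minimal_normal_in_factor[OF swap R min] that Ar by simp
  let ?C = "{g \<in> carrier G. \<forall>u\<in>R. cj g u = u}"
  have C: "?C \<lhd> G" by (rule centralizer_normal[OF R(1)])
  have sC: "subgroup ?C G" by (rule normal_subgroupD[OF C])
  have RC: "R \<subseteq> ?C" using abel by auto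
  show ?thesis
  proof (cases "?C = carrier G")
    \<comment> \<open>Here \<open>R\<close> is central, so already \<open>Br\<close> is normal and
      minimality decides.\<close>
    case True
    have "cj g u = u" if "g \<in> carrier G" "u \<in> R" for g u
    proof -
      have "g \<in> ?C" using True that(1) by simp
      then show ?thesis using that(2) by blast
    qed
    then have "normalizes G (carrier G) Br"
      unfolding normalizes_iff using BrR by auto
    then have "Br \<lhd> G" using Br(1) by (simp add: normal_iff_normalizes)
    then have "Br = {\<one>} \<or> Br = R" using min BrR by blast
    then show ?thesis
    proof
      assume "Br = {\<one>}"
      then have "Ar <#> Br = Ar"
        using subgroup.mem_carrier[OF Ar(1)] by (force simp: set_mult_def)
      then show ?thesis using ArBr done_A by simp
    qed (rule done_B)
  next
    case False
    then have "?C \<subset> carrier G" by auto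
    moreover have "?C \<noteq> {\<one>}" using RC R(2) subgroup.one_closed[OF sR] by auto
    ultimately have "prime_factor_between G ?C (carrier G)"
      using factors[OF C, of "carrier G"] subgroup_self
      by (simp add: normal_iff_normalizes normalizes_self)
    then obtain Z s where Z: "Z \<lhd> G" "?C \<subseteq> Z" "prime (s :: nat)" "card Z = s * card ?C"
      unfolding prime_factor_between_def by blast
    have sZ: "subgroup Z G" by (rule normal_subgroupD[OF Z(1)])
    have sr: "s \<noteq> r" by (rule normal_sylow_index_coprime[OF sR R(4,3) sC sZ RC Z(4)])
    obtain As where As: "subgroup As G" "As \<subseteq> A" "card As = s ^ multiplicity s (card A)" "normalizes G A As"
      using nilpotent_sylow_normal[OF A(1,2) Z(3)] .
    obtain Bs where Bs: "subgroup Bs G" "Bs \<subseteq> B" "card Bs = s ^ multiplicity s (card B)" "normalizes G B Bs"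
      using nilpotent_sylow_normal[OF B(1,2) Z(3)] .
    let ?S = "As <#> Bs"
    note S = product_of_sylows[OF Z(3) As Bs]
    have Sc: "g \<in> carrier G" if "g \<in> ?S" for g using subgroup.mem_carrier[OF S(1) that] .
    have AsS: "As \<subseteq> ?S" and BsS: "Bs \<subseteq> ?S"
      using set_mult_superset_left[OF As(1) Bs(1)] set_mult_superset_right[OF As(1) Bs(1)] .
    have As_Ar: "cj a u = u" if "a \<in> As" "u \<in> Ar" for a u
      by (rule coprime_order_commute[OF As(1,3) Ar(1,3) Z(3) R(3) sr
            normalizes_mono[OF Ar(4) As(2)] normalizes_mono[OF As(4) Ar(2)] that])
    have Bs_Br: "cj b u = u" if "b \<in> Bs" "u \<in> Br" for b u
      by (rule coprime_order_commute[OF Bs(1,3) Br(1,3) Z(3) R(3) sr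
            normalizes_mono[OF Br(4) Bs(2)] normalizes_mono[OF Bs(4) Br(2)] that])
    \<comment> \<open>A Sylow \<open>s\<close>-subgroup of \<open>Z\<close> acts nontrivially on
      \<open>R\<close>, and a conjugate of it lies in \<open>?S\<close>. Since \<open>Z\<close> and
      \<open>?C\<close> are normal, conjugation keeps an element inside \<open>Z\<close> and outside
      \<open>?C\<close>.\<close>
    have "\<exists>z. z \<in> ?S \<and> z \<in> Z \<and> z \<notin> ?C"
    proof -
      obtain T where T: "subgroup T G" "T \<subseteq> Z" "card T = s ^ multiplicity s (card Z)"
        using sylow_exists[OF sZ Z(3)] .
      have "\<not> T \<subseteq> ?C" by (rule sylow_subset_imp_index[OF sC sZ Z(2,3,4) T(1,3)])
      then obtain x where x: "x \<in> T" "x \<notin> ?C" by blast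
      have "card ?S = s ^ multiplicity s (card (carrier G))" using S(2) by (simp add: order_def)
      then obtain g where g: "g \<in> carrier G" "T \<subseteq> cj g ` ?S"
        using sylow_contains_conjugate[OF T(1) S(1) subgroup_self subgroup.subset[OF T(1)]
            subgroup.subset[OF S(1)] Z(3) T(3)] by blast
      then obtain y where y: "y \<in> ?S" "x = cj g y" using x(1) by blast
      have xZ: "x \<in> Z" using x(1) T(2) by blast
      then have "y = cj (inv g) x" using y(2) g(1) Sc[OF y(1)] by simp
      then have "y \<in> Z" using normal_cj[OF Z(1) _ xZ] g(1) by simp
      moreover have "y \<notin> ?C" using normal_cj[OF C g(1)] y(2) x(2) by blast
      ultimately show ?thesis using y(1) by blast
    qed
    then obtain z where z: "z \<in> ?S" "z \<in> Z" "z \<notin> ?C" by blast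
    have zc [simp]: "z \<in> carrier G" using Sc[OF z(1)] .
    obtain a b where ab: "a \<in> As" "b \<in> Bs" "z = a \<otimes> b" using z(1) by (auto simp: set_mult_def)
    have abA: "a \<in> A" "b \<in> B" using ab As(2) Bs(2) by auto
    have abc [simp]: "a \<in> carrier G" "b \<in> carrier G" using abA by auto
    \<comment> \<open>The factor \<open>Z / C\<close> has order \<open>s\<close>, so the
      \<open>s\<close>-group \<open>?S\<close> centralises it; as \<open>?C\<close> acts trivially
      on \<open>R\<close>, this lets \<open>z\<close> commute with \<open>?S\<close> on
      \<open>R\<close>.\<close>
    have z_comm: "cj g (cj z w) = cj z (cj g w)" if g: "g \<in> ?S" and w: "w \<in> R" for g w
    proof -
      have "?S \<subseteq> factor_centralizer G ?C Z"
        by (rule p_subgroup_centralizes_factor[OF C Z(1,2,3,4) S(1) Z(3) S(2) order_refl])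
      then have "inv z \<otimes> cj g z \<in> ?C" using g z(2) unfolding factor_centralizer_def by blast
      then have "cj (inv z \<otimes> cj g z) (cj g w) = cj g w" using Sc[OF g] w by simp
      then have "cj z (cj (inv z \<otimes> cj g z) (cj g w)) = cj z (cj g w)" by simp
      moreover have "cj z (cj (inv z \<otimes> cj g z) (cj g w)) = cj g (cj z w)"
        using Sc[OF g] w cj_cj[of g z w] cj_mult_left[of z "inv z \<otimes> cj g z" "cj g w"] by simp
      ultimately show ?thesis by simp
    qed
    \<comment> \<open>The stabiliser of \<open>u\<close> in \<open>Z\<close> contains
      \<open>?C\<close>, which has prime index, so a \<open>u\<close> fixed by \<open>z\<close> is
      fixed by \<open>Z\<close>. The fixed points of \<open>Z\<close> in \<open>R\<close> form a
      normal subgroup, trivial by minimality because \<open>z\<close> moves something.\<close>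
    have z_free: "u = \<one>" if u: "u \<in> R" "cj z u = u" for u
    proof -
      let ?F = "{u \<in> R. \<forall>x\<in>Z. cj x u = u}"
      have sub: "subgroup {x \<in> Z. cj x u = u} G"
        using subgroup_fixator[OF sZ, of "{u}"] u(1) by simp
      have "?C \<subseteq> {x \<in> Z. cj x u = u}" using Z(2) u(1) by auto
      then have "{x \<in> Z. cj x u = u} = ?C \<or> {x \<in> Z. cj x u = u} = Z"
        by (intro subgroup_between_prime_index[OF sC sZ sub _ _ Z(3,4)]) auto
      then have uF: "u \<in> ?F" using u z by blast
      have "?F \<lhd> G" by (rule fixed_points_normal[OF Z(1) R(1)])
      then have "?F = {\<one>} \<or> ?F = R" using min by blast
      moreover obtain v where "v \<in> R" "cj z v \<noteq> v" using z(3) zc by auto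
      then have "?F \<noteq> R" using z(2) by blast
      ultimately show ?thesis using uF by blast
    qed
    \<comment> \<open>With \<open>Bs_Br\<close> this identifies \<open>Br\<close> as the fixed
      points of \<open>Bs\<close> in \<open>R\<close>: the \<open>Ar\<close>-part of such a
      \<open>u\<close> is fixed by \<open>b\<close>, also by \<open>a\<close>, hence by
      \<open>z\<close>.\<close>
    have fix_Bs: "u \<in> Br" if u: "u \<in> R" "\<forall>b\<in>Bs. cj b u = u" for u
    proof -
      obtain x y where xy: "x \<in> Ar" "y \<in> Br" "u = x \<otimes> y" using dec[OF u(1)] by blast
      have R': "x \<in> R" "y \<in> R" using xy ArR BrR by auto
      have "cj b x \<otimes> y = x \<otimes> y"
        using bspec[OF u(2) ab(2)] xy(3) R' Bs_Br[OF ab(2) xy(2)] by (simp add: cj_mult)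
      then have "cj b x = x" using R' by simp
      then have "cj z x = x" using ab(3) As_Ar[OF ab(1) xy(1)] R' by (simp add: cj_mult_left)
      then have "x = \<one>" by (rule z_free[OF R'(1)])
      then show ?thesis using R' xy by simp
    qed
    have fix_As: "u \<in> Ar" if u: "u \<in> R" "\<forall>a\<in>As. cj a u = u" for u
    proof -
      obtain x y where xy: "x \<in> Ar" "y \<in> Br" "u = x \<otimes> y" using dec[OF u(1)] by blast
      have R': "x \<in> R" "y \<in> R" using xy ArR BrR by auto
      have "x \<otimes> cj a y = x \<otimes> y"
        using bspec[OF u(2) ab(1)] xy(3) R' As_Ar[OF ab(1) xy(1)] by (simp add: cj_mult)
      then have "cj a y = y" using R' by simp
      then have "cj z y = y" using ab(3) Bs_Br[OF ab(2) xy(2)] R' by (simp add: cj_mult_left)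
      then have "y = \<one>" by (rule z_free[OF R'(2)])
      then show ?thesis using R' xy by simp
    qed
    \<comment> \<open>As \<open>z\<close> commutes with \<open>Bs\<close> on \<open>R\<close>, it
      preserves the fixed points of \<open>Bs\<close>, which are \<open>Br\<close>.\<close>
    have z_Br: "cj z w \<in> Br" if w: "w \<in> Br" for w
    proof (rule fix_Bs)
      have wR: "w \<in> R" using w BrR by auto
      then show "cj z w \<in> R" by simp
      show "\<forall>b\<in>Bs. cj b (cj z w) = cj z w"
        using z_comm[OF _ wR] BsS Bs_Br[OF _ w] by (metis subsetD)
    qed
    have z_Ar: "cj z w \<in> Ar" if w: "w \<in> Ar" for w
    proof (rule fix_As)
      have wR: "w \<in> R" using w ArR by auto
      then show "cj z w \<in> R" by simp
      show "\<forall>a\<in>As. cj a (cj z w) = cj z w"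
        using z_comm[OF _ wR] AsS As_Ar[OF _ w] by (metis subsetD)
    qed
    have a_Br: "cj a w = cj z w" if w: "w \<in> Br" for w
      using ab(3) Bs_Br[OF ab(2) w] w BrR by (simp add: cj_mult_left subsetD)
    \<comment> \<open>On \<open>Br\<close> the elements \<open>a\<close> and \<open>z\<close> act
      alike, so \<open>a\<close> has no nontrivial fixed point there and the commutator map is
      injective on the finite set \<open>Br\<close>. Thus \<open>Br = [Br, a]\<close>.\<close>
    have surj: "\<exists>w'\<in>Br. w = inv w' \<otimes> cj a w'" if w: "w \<in> Br" for w
    proof -
      let ?f = "\<lambda>w. inv w \<otimes> cj a w"
      have "?f ` Br \<subseteq> Br"
        using a_Br z_Br Br(1) by (auto simp: subgroup.m_closed subgroup.m_inv_closed)
      moreover have "inj_on ?f Br"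
      proof (rule inj_onI)
        fix u v assume uv: "u \<in> Br" "v \<in> Br" "?f u = ?f v"
        have R': "u \<in> R" "v \<in> R" using uv BrR by auto
        have "cj a u = u \<otimes> (inv v \<otimes> cj a v)" using uv(3) R' by (metis Rc abc(1) cj_closed inv_closed l_cancel_inv)
        also have "\<dots> = (u \<otimes> inv v) \<otimes> cj a v" using R' by (simp add: m_assoc)
        finally have "cj a (u \<otimes> inv v) = u \<otimes> inv v" using R' by (simp add: cj_mult cj_inv m_assoc)
        moreover have uvB: "u \<otimes> inv v \<in> Br" using uv Br(1) by (simp add: subgroup.m_closed subgroup.m_inv_closed)
        ultimately have "cj z (u \<otimes> inv v) = u \<otimes> inv v" using a_Br by simp
        then have "u \<otimes> inv v = \<one>" using z_free uvB BrR by blast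
        then show "u = v" using R' by (metis Rc inv_closed inv_equality inv_inv)
      qed
      ultimately have "?f ` Br = Br" by (intro endo_inj_surj finite_subgroup[OF Br(1)])
      then show ?thesis using w by blast
    qed
    have a_shift: "inv u \<otimes> cj a u \<in> Br" if u: "u \<in> R" for u
    proof -
      obtain x y where xy: "x \<in> Ar" "y \<in> Br" "u = x \<otimes> y" using dec[OF u] by blast
      have R': "x \<in> R" "y \<in> R" using xy ArR BrR by auto
      have "inv u \<otimes> cj a u = inv y \<otimes> cj a y"
        using xy R' As_Ar[OF ab(1) xy(1)] by (simp add: cj_mult group_word_simps)
      then show ?thesis
        using a_Br z_Br xy(2) Br(1) by (simp add: subgroup.m_closed subgroup.m_inv_closed)
    qed
    \<comment> \<open>With \<open>a_shift\<close>, \<open>Br\<close> equals \<open>[R, a]\<close>,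
      which every \<open>g\<close> commuting with \<open>a\<close> on \<open>R\<close> must
      preserve.\<close>
    have shift_Br: "cj g ` Br = Br"
      if g: "g \<in> carrier G" and g_comm: "\<And>u. u \<in> R \<Longrightarrow> cj g (cj a u) = cj a (cj g u)" for g
    proof (rule cj_image_eq[OF g subgroup.subset[OF Br(1)] finite_subgroup[OF Br(1)]])
      show "cj g ` Br \<subseteq> Br"
      proof clarify
        fix w assume "w \<in> Br"
        then obtain w' where w': "w' \<in> Br" "w = inv w' \<otimes> cj a w'" using surj by blast
        have "w' \<in> R" using w'(1) BrR by auto
        then have "cj g w = inv (cj g w') \<otimes> cj a (cj g w')"
          using w'(2) g g_comm by (simp add: cj_mult cj_inv)
        then show "cj g w \<in> Br" using a_shift[of "cj g w'"] g \<open>w' \<in> R\<close> by simp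
      qed
    qed
    \<comment> \<open>\<open>As\<close> may be non-abelian, so only commutation of the actions on
      \<open>R\<close> is claimed. It is enough that the commutator \<open>?c\<close> acts
      trivially.\<close>
    have As_comm: "cj g (cj a u) = cj a (cj g u)" if g: "g \<in> As" and u: "u \<in> R" for g u
    proof -
      have gA: "g \<in> A" and gc [simp]: "g \<in> carrier G" using g As(2) by auto
      \<comment> \<open>Modulo \<open>Ar\<close>, \<open>a\<close> acts like \<open>z\<close>, which
        commutes with \<open>g\<close>; so \<open>?c\<close> will act trivially modulo
        \<open>Ar\<close>.\<close>
      have az: "\<exists>x\<in>Ar. cj a v = x \<otimes> cj z v" if v: "v \<in> R" for v
      proof -
        obtain x y where xy: "x \<in> Ar" "y \<in> Br" "v = x \<otimes> y" using dec[OF v] by blast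
        have R': "x \<in> R" "y \<in> R" using xy ArR BrR by auto
        have "cj a v = x \<otimes> cj z y" using xy R' As_Ar[OF ab(1) xy(1)] a_Br by (simp add: cj_mult)
        also have "\<dots> = (x \<otimes> inv (cj z x)) \<otimes> cj z v"
          using xy R' by (simp add: cj_mult group_word_simps)
        finally show ?thesis
          using xy(1) z_Ar[OF xy(1)] Ar(1) by (meson subgroup.m_closed subgroup.m_inv_closed)
      qed
      let ?c = "inv a \<otimes> cj g a"
      have cAs: "?c \<in> As"
        using normalizesD[OF As(4) gA ab(1)] ab(1) As(1) by (simp add: subgroup.m_closed subgroup.m_inv_closed)
      have c_mod: "inv v \<otimes> cj ?c v \<in> Ar" if v: "v \<in> R" for v
      proof -
        obtain x where x: "x \<in> Ar" "cj a (cj (inv g) v) = x \<otimes> cj z (cj (inv g) v)"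
          using az[of "cj (inv g) v"] v by auto
        obtain x' where x': "x' \<in> Ar" "cj a v = x' \<otimes> cj z v" using az[OF v] by auto
        have xR: "x \<in> R" "x' \<in> R" using x(1) x'(1) ArR by auto
        have gx: "cj g x \<in> Ar" using normalizesD[OF Ar(4) gA x(1)] .
        have gS: "g \<in> ?S" using g AsS by auto
        have "cj (cj g a) v = cj g (cj a (cj (inv g) v))"
          using v cj_cj[of g a "cj (inv g) v"] by simp
        also have "\<dots> = cj g x \<otimes> cj g (cj z (cj (inv g) v))" using x(2) xR v by (simp add: cj_mult)
        also have "cj g (cj z (cj (inv g) v)) = cj z v" using z_comm[OF gS, of "cj (inv g) v"] v by simp
        also have "cj g x \<otimes> cj z v = (cj g x \<otimes> inv x') \<otimes> cj a v"
          using x'(2) xR v by (simp add: m_assoc)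
        finally have eq: "cj (cj g a) v = (cj g x \<otimes> inv x') \<otimes> cj a v" .
        have y: "cj g x \<otimes> inv x' \<in> Ar" using gx x'(1) Ar(1) by (simp add: subgroup.m_closed subgroup.m_inv_closed)
        have yR: "cj g x \<otimes> inv x' \<in> R" using y ArR by auto
        have "cj ?c v = cj (inv a) (cj (cj g a) v)" using v by (simp add: cj_mult_left)
        also have "\<dots> = cj (inv a) (cj g x \<otimes> inv x') \<otimes> v"
          unfolding eq using v Rc[OF yR] xR by (simp add: cj_mult m_assoc)
        also have "cj (inv a) (cj g x \<otimes> inv x') = cj g x \<otimes> inv x'"
          using As_Ar[OF _ y, of "inv a"] ab(1) As(1) by (simp add: subgroup.m_inv_closed)
        also have "(cj g x \<otimes> inv x') \<otimes> v = v \<otimes> (cj g x \<otimes> inv x')" using comm[OF yR v] .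
        finally show ?thesis using y v Rc[OF yR] by simp
      qed
      \<comment> \<open>\<open>?c\<close> multiplies \<open>v\<close> by some \<open>x\<close> in
        \<open>Ar\<close> and fixes \<open>x\<close>, so its \<open>n\<close>-th power multiplies
        \<open>v\<close> by \<open>x [^] n\<close>. The order of \<open>?c\<close> is a power of
        \<open>s\<close>, that of \<open>x\<close> a power of \<open>r\<close>, and \<open>x\<close>
        must be trivial.\<close>
      have c_triv: "cj ?c v = v" if v: "v \<in> R" for v
      proof -
        define x where "x = inv v \<otimes> cj ?c v"
        have x: "x \<in> Ar" unfolding x_def by (rule c_mod[OF v])
        then have xR: "x \<in> R" using ArR by auto
        have cc: "?c \<in> carrier G" by simp
        have c_pow: "?c [^] n \<in> As" for n :: nat
          using cAs As(1) by (induction n) (auto simp: subgroup.m_closed subgroup.one_closed)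
        have cv: "cj ?c v = v \<otimes> x" unfolding x_def using v by simp
        have pow: "cj (?c [^] n) v = v \<otimes> x [^] n" for n :: nat
        proof (induction n)
          case (Suc n)
          have "cj (?c [^] Suc n) v = cj (?c [^] n) (cj ?c v)" using v cc by (simp add: cj_mult_left)
          also have "\<dots> = cj (?c [^] n) v \<otimes> cj (?c [^] n) x"
            unfolding cv using v xR cc by (intro cj_mult) auto
          also have "cj (?c [^] n) x = x" by (rule As_Ar[OF c_pow x])
          finally show ?case using Suc v xR by (simp add: m_assoc)
        qed (use v in simp)
        have pow_card: "y [^] card Y = \<one>" if "subgroup Y G" "y \<in> Y" for y Y
          using pow_index_mem[OF triv_subgroup that(1) _ _ _ that(2), of "card Y"] that(1)
            subgroup.mem_carrier[OF that(1)]
          by (auto simp: subgroup.one_closed normalizes_iff)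
        have "v \<otimes> x [^] card As = v" using pow[of "card As"] pow_card[OF As(1) cAs] v by simp
        then have "x [^] card As = \<one>" using v xR by simp
        then have "ord x dvd s ^ multiplicity s (card A)" using As(3) xR by (simp add: pow_eq_id)
        moreover have "ord x dvd r ^ multiplicity r (card A)"
          using pow_card[OF Ar(1) x] Ar(3) xR by (simp add: pow_eq_id)
        ultimately have "ord x = 1" by (rule prime_power_dvd_cases[OF Z(3) R(3) sr])
        then have "x = \<one>" using ord_eq_1 xR by simp
        then show ?thesis using cv v by simp
      qed
      have "cj g (cj a u) = cj (cj g a) (cj g u)" using u by (intro cj_cj) auto
      also have "\<dots> = cj a (cj ?c (cj g u))" using u cj_mult_left[of a ?c "cj g u"] by simp
      also have "\<dots> = cj a (cj g u)" using c_triv u by simp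
      finally show ?thesis .
    qed
    \<comment> \<open>\<open>As\<close> commutes with \<open>a\<close> on \<open>R\<close> by the
      preceding step, and the Sylow subgroups of \<open>A\<close> for other primes commute with
      \<open>a\<close> itself because \<open>A\<close> is nilpotent.\<close>
    have "{g \<in> A. cj g ` Br = Br} = A"
    proof (rule subgroup_eq_by_sylow[OF subgroup_normalizer[OF A(1) subgroup.subset[OF Br(1)]] A(1)])
      fix t :: nat assume t: "prime t"
      show "\<exists>S. subgroup S G \<and> S \<subseteq> {g \<in> A. cj g ` Br = Br} \<and> card S = t ^ multiplicity t (card A)"
      proof (cases "t = s")
        case True
        have "cj g ` Br = Br" if "g \<in> As" for g
          by (rule shift_Br[OF subgroup.mem_carrier[OF As(1) that] As_comm[OF that]])
        then show ?thesis using As True by (intro exI[of _ As]) auto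
      next
        case False
        obtain At where At: "subgroup At G" "At \<subseteq> A" "card At = t ^ multiplicity t (card A)" "normalizes G A At"
          using nilpotent_sylow_normal[OF A(1,2) t] .
        have "cj g ` Br = Br" if g: "g \<in> At" for g
        proof (rule shift_Br)
          show gc: "g \<in> carrier G" using g At(2) by auto
          have ga: "cj g a = a"
            by (rule coprime_order_commute[OF At(1,3) As(1,3) t Z(3) False
                  normalizes_mono[OF As(4) At(2)] normalizes_mono[OF At(4) As(2)] g ab(1)])
          show "cj g (cj a u) = cj a (cj g u)" if "u \<in> R" for u
            using cj_cj[of g a u] ga gc that by simp
        qed
        then show ?thesis using At by (intro exI[of _ At]) auto
      qed
    qed auto
    then have "normalizes G A Br" unfolding normalizes_iff by blast
    then have "Br \<lhd> G"
      using factors_normalize[OF _ Br(4) subgroup.subset[OF Br(1)]] Br(1) by (simp add: normal_iff_normalizes)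
    then have "Br = {\<one>} \<or> Br = R" using min BrR by blast
    then show ?thesis
    proof
      assume "Br = {\<one>}"
      then have "Ar <#> Br = Ar"
        using subgroup.mem_carrier[OF Ar(1)] by (force simp: set_mult_def)
      then show ?thesis using ArBr done_A by simp
    qed (rule done_B)
  qed
qed

end

section \<open>A minimal normal subgroup properly inside the normal Sylow subgroup\<close>

context group
begin

lemma normal_inter_family:
  assumes "\<And>X. X \<in> \<X> \<Longrightarrow> X \<lhd> G"
  shows "{g \<in> carrier G. \<forall>X\<in>\<X>. g \<in> X} \<lhd> G"
proof -
  have "subgroup {g \<in> carrier G. \<forall>X\<in>\<X>. g \<in> X} G"
    using assms normal_subgroupD(1)
    by (intro subgroupI) (auto simp: subgroup.m_closed subgroup.m_inv_closed intro: subgroup.one_closed)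
  moreover have "normalizes G (carrier G) {g \<in> carrier G. \<forall>X\<in>\<X>. g \<in> X}"
    unfolding normalizes_iff using assms normal_cj by auto
  ultimately show ?thesis by (simp add: normal_iff_normalizes)
qed

lemma normal_set_mult:
  assumes "M \<lhd> G" "N \<lhd> G"
  shows "M <#> N \<lhd> G"
proof -
  have sub: "subgroup M G" "subgroup N G" using assms normal_subgroupD(1) by auto
  have "normalizes G M N"
    by (rule normalizes_mono[OF normal_subgroupD(2)[OF assms(2)] subgroup.subset[OF sub(1)]])
  then have "subgroup (M <#> N) G" by (rule subgroup_set_mult[OF sub])
  moreover have "normalizes G (carrier G) (M <#> N)"
    by (rule normalizes_set_mult[OF subset_refl subgroup.subset[OF sub(1)] subgroup.subset[OF sub(2)]
          normal_subgroupD(2)[OF assms(1)] normal_subgroupD(2)[OF assms(2)]])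
  ultimately show ?thesis by (simp add: normal_iff_normalizes)
qed

end

context finite_group
begin

text \<open>Frattini: if \<open>Z = T R C\<close> with \<open>T\<close> a Sylow subgroup of \<open>Z\<close> and \<open>C\<close> centralising \<open>R\<close>, then a
  subgroup of \<open>R\<close> is normal in \<open>G\<close> as soon as it is normalised by \<open>R\<close>, \<open>T\<close> and \<open>N(T)\<close>. Among the
  proper subgroups of \<open>R\<close> that contain \<open>C\<^sub>R(T)\<close> and are invariant under \<open>N(T)\<close>, a maximal one is
  normal in \<open>R\<close>.\<close>

lemma coprime_action_normal_subgroup:
  assumes R: "R \<lhd> G" "prime r" "card R = r ^ a"
    and Z: "Z \<lhd> G" and T: "subgroup T G" "T \<subseteq> Z" "prime s" "card T = s ^ multiplicity s (card Z)"
    and dec: "Z = T <#> (R <#> {g \<in> carrier G. \<forall>u\<in>R. cj g u = u})"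
    and nt: "\<not> T \<subseteq> {g \<in> carrier G. \<forall>u\<in>R. cj g u = u}"
  obtains Y where "Y \<lhd> G" "{u \<in> R. \<forall>t\<in>T. cj t u = u} \<subseteq> Y" "Y \<subset> R"
proof -
  let ?C = "{g \<in> carrier G. \<forall>u\<in>R. cj g u = u}"
  let ?N = "{g \<in> carrier G. cj g ` T = T}"
  let ?X = "{u \<in> R. \<forall>t\<in>T. cj t u = u}"
  have sR: "subgroup R G" and sZ: "subgroup Z G" using R(1) Z normal_subgroupD(1) by auto
  have Tsub: "T \<subseteq> carrier G" by (rule subgroup.subset[OF T(1)])
  have Tc: "t \<in> carrier G" if "t \<in> T" for t using that Tsub by auto
  have Rc: "u \<in> carrier G" if "u \<in> R" for u using subgroup.mem_carrier[OF sR that] .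
  have sN: "subgroup ?N G" by (rule subgroup_normalizer[OF subgroup_self Tsub])
  have TN: "T \<subseteq> ?N"
    by (rule subgroup_subset_normalizer[OF T(1) Tsub])
  have frattini: "\<exists>x\<in>Z. \<exists>n\<in>?N. g = x \<otimes> n" if g: "g \<in> carrier G" for g
  proof -
    have sub: "cj g ` T \<subseteq> Z" using normal_cj[OF Z g] T(2) by auto
    obtain x where x: "x \<in> Z" "cj g ` T \<subseteq> cj x ` T"
      using sylow_contains_conjugate[OF subgroup_cj_image[OF g T(1)] T(1) sZ sub T(2,3) _ T(4)]
        card_cj_image[OF g Tsub] T(4) by auto
    have xc: "x \<in> carrier G" using subgroup.mem_carrier[OF sZ x(1)] .
    have "cj (inv x \<otimes> g) ` T \<subseteq> T"
    proof clarify
      fix t assume t: "t \<in> T"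
      then obtain t' where t': "t' \<in> T" "cj g t = cj x t'" using x(2) by blast
      have "cj (inv x \<otimes> g) t = t'" using t'(2) Tc[OF t] Tc[OF t'(1)] g xc by (simp add: cj_mult_left)
      then show "cj (inv x \<otimes> g) t \<in> T" using t'(1) by simp
    qed
    then have "cj (inv x \<otimes> g) ` T = T" using g xc Tsub T(1) by (intro cj_image_eq) auto
    then have "inv x \<otimes> g \<in> ?N" using g xc by simp
    moreover have "g = x \<otimes> (inv x \<otimes> g)" using g xc by simp
    ultimately show ?thesis using x(1) by blast
  qed
  have sX: "subgroup ?X G" by (rule subgroup_fixed_points[OF sR Tsub])
  have "cj n u \<in> ?X" if n: "n \<in> ?N" and u: "u \<in> ?X" for n u
  proof -
    have nc: "n \<in> carrier G" and uR: "u \<in> R" using n u by auto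
    have "cj t (cj n u) = cj n u" if t: "t \<in> T" for t
    proof -
      obtain t' where t': "t' \<in> T" "t = cj n t'" using n t by blast
      have "cj t (cj n u) = cj n (cj t' u)"
        unfolding t'(2) using nc Tc[OF t'(1)] Rc[OF uR] by (intro cj_cj[symmetric])
      then show ?thesis using u t'(1) by simp
    qed
    then show ?thesis using normal_cj[OF R(1) nc uR] by simp
  qed
  then have nX: "normalizes G ?N ?X" unfolding normalizes_iff by blast
  have "?X \<noteq> R"
  proof
    assume "?X = R"
    then have "cj t u = u" if "t \<in> T" "u \<in> R" for t u using that by blast
    then show False using nt Tc by blast
  qed
  then have XR: "?X \<subset> R" by blast
  obtain Y where Y: "subgroup Y G \<and> normalizes G ?N Y" "?X \<subseteq> Y" "Y \<subset> R"
    and max: "\<forall>N. (subgroup N G \<and> normalizes G ?N N) \<and> Y \<subseteq> N \<and> N \<subseteq> R \<longrightarrow> N = Y \<or> N = R"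
    using maximal_subgroup_exists[of "\<lambda>Y. subgroup Y G \<and> normalizes G ?N Y" ?X R]
      sX nX XR subgroup.subset[OF sR] by blast
  have sY: "subgroup Y G" and nY: "normalizes G ?N Y" using Y(1) by auto
  have Ysub: "Y \<subseteq> carrier G" by (rule subgroup.subset[OF sY])
  have Yc: "y \<in> carrier G" if "y \<in> Y" for y using that Ysub by auto
  \<comment> \<open>The normaliser of \<open>Y\<close> in \<open>R\<close> is again invariant under
    \<open>?N\<close> and exceeds \<open>Y\<close> because \<open>R\<close> is an
    \<open>r\<close>-group; maximality of \<open>Y\<close> leaves only \<open>R\<close>.\<close>
  let ?M = "{u \<in> R. cj u ` Y = Y}"
  have sM: "subgroup ?M G" by (rule subgroup_normalizer[OF sR Ysub])
  have YM: "Y \<subseteq> ?M"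
    by (rule subgroup_subset_normalizer[OF sY psubset_imp_subset[OF Y(3)]])
  have "cj n u \<in> ?M" if n: "n \<in> ?N" and u: "u \<in> ?M" for n u
  proof -
    have nc: "n \<in> carrier G" and uR: "u \<in> R" using n u by auto
    have "cj (cj n u) ` Y \<subseteq> Y"
    proof clarify
      fix y assume y: "y \<in> Y"
      have "inv n \<in> ?N" using n sN by (rule subgroup.m_inv_closed[rotated])
      then have "cj (inv n) y \<in> Y" using normalizesD[OF nY _ y] by blast
      then have "cj u (cj (inv n) y) \<in> Y" using u by blast
      then have "cj n (cj u (cj (inv n) y)) \<in> Y" using normalizesD[OF nY n] by blast
      moreover have "cj n (cj u (cj (inv n) y)) = cj (cj n u) y"
        using cj_cj[of n u "cj (inv n) y"] nc Rc[OF uR] Yc[OF y] by simp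
      ultimately show "cj (cj n u) y \<in> Y" by simp
    qed
    then have "cj (cj n u) ` Y = Y" using nc Rc[OF uR] Ysub sY by (intro cj_image_eq) auto
    then show ?thesis using normal_cj[OF R(1) nc uR] by simp
  qed
  then have "normalizes G ?N ?M" unfolding normalizes_iff by blast
  then have "?M = Y \<or> ?M = R" using max sM YM by blast
  moreover have "?M \<noteq> Y"
  proof -
    have "{\<one>} \<subseteq> Y" using subgroup.one_closed[OF sY] by simp
    moreover have "normalizes G R {\<one>}" using Rc by (simp add: normalizes_iff)
    moreover have "card R = r ^ a * card {\<one>}" using R(3) by simp
    ultimately obtain y where "y \<in> R" "y \<notin> Y" "cj y ` Y = Y"
      using normalizer_grows[OF sY sR Y(3) triv_subgroup _ _ R(2)] by blast
    then show ?thesis by blast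
  qed
  ultimately have MR: "?M = R" by blast
  have "cj g y \<in> Y" if g: "g \<in> carrier G" and y: "y \<in> Y" for g y
  proof -
    obtain x n where xn: "x \<in> Z" "n \<in> ?N" "g = x \<otimes> n" using frattini[OF g] by blast
    obtain t w where tw: "t \<in> T" "w \<in> R <#> ?C" "x = t \<otimes> w" using xn(1) dec by (auto simp: set_mult_def)
    obtain u c where uc: "u \<in> R" "c \<in> ?C" "w = u \<otimes> c" using tw(2) by (auto simp: set_mult_def)
    have c: "t \<in> carrier G" "u \<in> carrier G" "c \<in> carrier G" "n \<in> carrier G"
      using Tc[OF tw(1)] Rc[OF uc(1)] uc(2) xn(2) by auto
    have ny: "cj n y \<in> Y" by (rule normalizesD[OF nY xn(2) y])
    have "cj g y = cj t (cj u (cj c (cj n y)))"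
      using xn(3) tw(3) uc(3) c Yc[OF y] by (simp add: cj_mult_left m_assoc)
    also have "cj c (cj n y) = cj n y" using uc(2) ny Y(3) by blast
    finally have "cj g y = cj t (cj u (cj n y))" .
    moreover have "cj u (cj n y) \<in> Y" using uc(1) ny MR by blast
    ultimately show ?thesis using normalizesD[OF nY] tw(1) TN by auto
  qed
  then have "normalizes G (carrier G) Y" unfolding normalizes_iff by blast
  then have "Y \<lhd> G" using sY by (simp add: normal_iff_normalizes)
  then show ?thesis using that Y(2,3) by blast
qed

end

context factorised_group
begin

text \<open>Commutators of \<open>G\<close> lie in \<open>?D\<close>, which turns out to be the
  product of \<open>R\<close> and its centraliser; both fix \<open>V\<close>, so \<open>G\<close>
  acts on \<open>V\<close> as an abelian group. Then elements of \<open>A\<close> and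
  \<open>B\<close> act on \<open>V\<close> by powers and every subgroup of \<open>V\<close> is
  normal.\<close>

lemma minimal_normal_below_sylow:
  assumes R: "R \<lhd> G" "prime r" "card R = r ^ multiplicity r (order G)"
    and V: "V \<lhd> G" "V \<noteq> {\<one>}" "V \<subset> R"
    and min: "\<forall>N. N \<lhd> G \<and> N \<subseteq> V \<longrightarrow> N = {\<one>} \<or> N = V"
    and factors: "\<And>N N'. \<lbrakk>N \<lhd> G; N' \<lhd> G; N \<subset> N'; N \<noteq> {\<one>}\<rbrakk> \<Longrightarrow> prime_factor_between G N N'"
  shows "prime (card V)"
proof -
  have sR: "subgroup R G" and sV: "subgroup V G" using R(1) V(1) normal_subgroupD(1) by auto
  have Rc: "u \<in> carrier G" if "u \<in> R" for u using subgroup.mem_carrier[OF sR that] .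
  have VR: "V \<subseteq> R" using V(3) by auto
  have Vc: "v \<in> carrier G" if "v \<in> V" for v using subgroup.mem_carrier[OF sV that] .
  have RV: "\<forall>g\<in>R. \<forall>v\<in>V. cj g v = v"
    by (rule p_group_centralizes_minimal_normal[OF R(1,3,2) V(1) VR V(2) min])
  let ?C = "{g \<in> carrier G. \<forall>u\<in>R. cj g u = u}"
  have C: "?C \<lhd> G" by (rule centralizer_normal[OF R(1)])
  have sC: "subgroup ?C G" by (rule normal_subgroupD[OF C])
  let ?W = "R <#> ?C"
  have W: "?W \<lhd> G" by (rule normal_set_mult[OF R(1) C])
  have sW: "subgroup ?W G" by (rule normal_subgroupD[OF W])
  have RW: "R \<subseteq> ?W" and CW: "?C \<subseteq> ?W"
    using set_mult_superset_left[OF sR sC] set_mult_superset_right[OF sR sC] .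
  have "R \<noteq> {\<one>}" using VR V(2) subgroup.one_closed[OF sV] by blast
  then have "?W \<noteq> {\<one>}" using RW subgroup.one_closed[OF sR] by blast
  let ?P = "\<lambda>M p. M \<lhd> G \<and> M \<subseteq> R \<and> prime (p :: nat) \<and> card R = p * card M"
  \<comment> \<open>The elements acting trivially on every \<open>G\<close>-invariant quotient of
    \<open>R\<close> of prime order. An excess of \<open>?D\<close> over \<open>?W\<close> would
    give a nontrivial coprime action on \<open>R\<close> that is trivial on all these
    quotients.\<close>
  let ?D = "{g \<in> carrier G. \<forall>X\<in>{factor_centralizer G M R |M. \<exists>p. ?P M p}. g \<in> X}"
  have D: "?D \<lhd> G"
    using factor_centralizer_normal[OF _ R(1)] by (intro normal_inter_family) blast
  have sD: "subgroup ?D G" by (rule normal_subgroupD[OF D])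
  have "R \<subseteq> ?D"
    using factor_centralizer_contains_factor[OF _ R(1)] Rc by blast
  moreover have "?C \<subseteq> ?D"
  proof
    fix g assume g: "g \<in> ?C"
    have "inv u \<otimes> cj g u = \<one>" if "u \<in> R" for u using g that Rc[OF that] by auto
    then have "g \<in> factor_centralizer G M R" if "M \<lhd> G" for M
      using g subgroup.one_closed[OF normal_subgroupD(1)[OF that]] by (simp add: factor_centralizer_def)
    then show "g \<in> ?D" using g by blast
  qed
  ultimately have WD: "?W \<subseteq> ?D" by (rule set_mult_subset[OF sD])
  have DW: "?D = ?W"
  proof (rule ccontr)
    assume "?D \<noteq> ?W"
    then have "?W \<subset> ?D" using WD by blast
    then have "prime_factor_between G ?W ?D" using factors[OF W D] \<open>?W \<noteq> {\<one>}\<close> by blast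
    then obtain Z s where Z: "Z \<lhd> G" "?W \<subseteq> Z" "Z \<subseteq> ?D" "prime (s :: nat)" "card Z = s * card ?W"
      unfolding prime_factor_between_def by blast
    have sZ: "subgroup Z G" by (rule normal_subgroupD[OF Z(1)])
    have sr: "s \<noteq> r" by (rule normal_sylow_index_coprime[OF sR R(3,2) sW sZ RW Z(5)])
    obtain T where T: "subgroup T G" "T \<subseteq> Z" "card T = s ^ multiplicity s (card Z)"
      using sylow_exists[OF sZ Z(4)] .
    have TW: "\<not> T \<subseteq> ?W" by (rule sylow_subset_imp_index[OF sW sZ Z(2,4,5) T(1,3)])
    have Tsub: "T \<subseteq> carrier G" by (rule subgroup.subset[OF T(1)])
    have sTW: "subgroup (T <#> ?W) G"
      by (rule subgroup_set_mult[OF T(1) sW normalizes_mono[OF normal_subgroupD(2)[OF W] Tsub]])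
    have "T <#> ?W = ?W \<or> T <#> ?W = Z"
      by (rule subgroup_between_prime_index[OF sW sZ sTW set_mult_superset_right[OF T(1) sW]
            set_mult_subset[OF sZ T(2) Z(2)] Z(4,5)])
    moreover have "T \<subseteq> T <#> ?W" by (rule set_mult_superset_left[OF T(1) sW])
    ultimately have dec: "Z = T <#> ?W" using TW by auto
    have "\<not> T \<subseteq> ?C" using TW CW by blast
    then obtain Y where Y: "Y \<lhd> G" "{u \<in> R. \<forall>t\<in>T. cj t u = u} \<subseteq> Y" "Y \<subset> R"
      by (rule coprime_action_normal_subgroup[OF R(1,2,3) Z(1) T(1,2) Z(4) T(3) dec])
    obtain M where M: "M \<lhd> G" "Y \<subseteq> M" "M \<subset> R"
      and max: "\<forall>N. N \<lhd> G \<and> M \<subseteq> N \<and> N \<subseteq> R \<longrightarrow> N = M \<or> N = R"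
      using maximal_subgroup_exists[of "\<lambda>N. N \<lhd> G" Y R] normal_subgroupD(1) Y(1,3)
        subgroup.subset[OF sR] by metis
    have sM: "subgroup M G" by (rule normal_subgroupD[OF M(1)])
    \<comment> \<open>This is where \<open>V\<close> lies properly between 1 and \<open>R\<close>;
      it makes \<open>factors\<close> applicable to \<open>M\<close> and \<open>R\<close>.\<close>
    have "M \<noteq> {\<one>}"
    proof
      assume "M = {\<one>}"
      then have "V = M \<or> V = R" using max V(1) VR subgroup.one_closed[OF sV] by blast
      then show False using V \<open>M = {\<one>}\<close> by blast
    qed
    then have "prime_factor_between G M R" using factors[OF M(1) R(1) M(3)] by simp
    then obtain L p where L: "L \<lhd> G" "M \<subseteq> L" "L \<subseteq> R" "prime (p :: nat)" "card L = p * card M"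
      unfolding prime_factor_between_def by blast
    have "L \<noteq> M" using L(4,5) card_subgroup_pos[OF sM] by (auto simp: prime_nat_iff)
    then have "L = R" using max L(1,2,3) by blast
    then have P: "?P M p" using L(4,5) M(1,3) by blast
    have "R \<subseteq> M"
    proof
      fix u assume u: "u \<in> R"
      have tu: "inv u \<otimes> cj t u \<in> M" if "t \<in> T" for t
      proof -
        have "t \<in> ?D" using that T(2) Z(3) by blast
        then have "t \<in> factor_centralizer G M R" using P by blast
        then show ?thesis using u by (simp add: factor_centralizer_def)
      qed
      \<comment> \<open>\<open>T\<close> acts on this coset, whose size is a power of
        \<open>r\<close> and so prime to \<open>s\<close>. A fixed element lies in
        \<open>C\<^sub>R(T) \<le> Y \<le> M\<close>, which forces \<open>u\<close> into
        \<open>M\<close>.\<close>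
      let ?E = "u <# M"
      have Ec: "?E \<subseteq> carrier G" using Rc[OF u] subgroup.subset[OF sM] by (rule l_coset_subset_G[rotated])
      have E: "cj t e \<in> ?E" if te: "t \<in> T" "e \<in> ?E" for t e
      proof -
        obtain m where m: "m \<in> M" "e = u \<otimes> m" using te(2) by (auto simp: l_coset_def)
        have c: "t \<in> carrier G" "m \<in> carrier G"
          using Tsub te(1) subgroup.mem_carrier[OF sM m(1)] by auto
        have "cj t e = u \<otimes> ((inv u \<otimes> cj t u) \<otimes> cj t m)"
          using m(2) c Rc[OF u] by (simp add: cj_mult m_assoc)
        moreover have "(inv u \<otimes> cj t u) \<otimes> cj t m \<in> M"
          using tu[OF te(1)] normal_cj[OF M(1) c(1) m(1)] sM by (simp add: subgroup.m_closed)
        ultimately show ?thesis by (auto simp: l_coset_def)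
      qed
      have "?E = (\<lambda>m. u \<otimes> m) ` M" by (auto simp: l_coset_def)
      moreover have "inj_on (\<lambda>m. u \<otimes> m) M"
        using Rc[OF u] subgroup.mem_carrier[OF sM] by (auto simp: inj_on_def)
      ultimately have cardE: "card ?E = card M" by (simp add: card_image)
      have "card M dvd r ^ multiplicity r (order G)" using card_subgroup_dvd[OF sM sR] M(3) R(3) by auto
      then obtain i where i: "card M = r ^ i" using R(2) divides_primepow_nat by blast
      have "\<not> s dvd card M"
        using i sr Z(4) R(2) by (metis prime_dvd_power primes_dvd_imp_eq)
      moreover have "card ?E mod s = card {e \<in> ?E. \<forall>t\<in>T. cj t e = e} mod s"
        by (rule p_group_fixed_point[OF T(1) Z(4) T(3) finite_subset[OF Ec fin] Ec E])
      ultimately have "card {e \<in> ?E. \<forall>t\<in>T. cj t e = e} \<noteq> 0"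
        using cardE by (metis dvd_eq_mod_eq_0 mod_0)
      then have "{e \<in> ?E. \<forall>t\<in>T. cj t e = e} \<noteq> {}" by (metis card.empty)
      then obtain m where m: "m \<in> M" "\<forall>t\<in>T. cj t (u \<otimes> m) = u \<otimes> m" by (auto simp: l_coset_def)
      have "u \<otimes> m \<in> R" using u m(1) M(3) sR by (auto intro: subgroup.m_closed)
      then have "u \<otimes> m \<in> M" using m(2) Y(2) M(2) by blast
      then have "(u \<otimes> m) \<otimes> inv m \<in> M" using m(1) sM by (simp add: subgroup.m_closed subgroup.m_inv_closed)
      then show "u \<in> M" using Rc[OF u] subgroup.mem_carrier[OF sM m(1)] by (simp add: m_assoc)
    qed
    then show False using M(3) by blast
  qed
  have comm: "cj g (cj h v) = cj h (cj g v)" if gh: "g \<in> carrier G" "h \<in> carrier G" and v: "v \<in> V" for g h v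
  proof -
    let ?c = "inv (h \<otimes> g) \<otimes> (g \<otimes> h)"
    have cD: "?c \<in> ?D"
      using factor_centralizer_contains_commutators[OF _ R(1) _ _ _ gh] gh by blast
    obtain u c where uc: "u \<in> R" "c \<in> ?C" "?c = u \<otimes> c"
      using subsetD[OF equalityD1[OF DW] cD] by (auto simp: set_mult_def)
    have "cj c v = v" using uc(2) v VR by blast
    then have "cj ?c v = v" using uc Rc[OF uc(1)] Vc[OF v] RV v by (simp add: cj_mult_left)
    then have "cj (h \<otimes> g) (cj ?c v) = cj (h \<otimes> g) v" by simp
    moreover have "cj (h \<otimes> g) (cj ?c v) = cj (g \<otimes> h) v"
      using gh Vc[OF v] cj_mult_left[of "h \<otimes> g" ?c v] by simp
    ultimately show ?thesis using gh Vc[OF v] by (simp add: cj_mult_left)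
  qed
  have power_action: "\<exists>i :: nat. \<forall>v\<in>V. cj x v = v [^] i"
    if X: "subgroup X G" "nilpotent_over G {\<one>} X" "modular_chain k G X (carrier G)" and x: "x \<in> X" for X x
  proof -
    have xc: "x \<in> carrier G" using subgroup.mem_carrier[OF X(1) x] .
    have nXV: "normalizes G X V"
      by (rule normalizes_mono[OF normal_subgroupD(2)[OF V(1)] subgroup.subset[OF X(1)]])
    obtain V0 where V0: "subgroup V0 G \<and> normalizes G X V0" "V0 \<subseteq> V" "V0 \<noteq> {\<one>}"
      and min0: "\<forall>N. (subgroup N G \<and> normalizes G X N) \<and> N \<subseteq> V0 \<longrightarrow> N = {\<one>} \<or> N = V0"
      using minimal_subgroup_exists[of "\<lambda>Y. subgroup Y G \<and> normalizes G X Y" V] sV nXV V(2) by blast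
    have sV0: "subgroup V0 G" and nV0: "normalizes G X V0" using V0(1) by auto
    obtain w where w: "w \<in> V0" "w \<noteq> \<one>" using V0(3) subgroup.one_closed[OF sV0] by blast
    have "prime (card V0) \<or> (\<forall>a\<in>X. \<forall>v\<in>V0. cj a v = v)"
      by (rule nilpotent_irreducible[OF X sV0 V0(3) nV0 min0])
    then have "\<exists>i :: nat. cj x w = w [^] i"
    proof
      assume "prime (card V0)"
      then show ?thesis
        using prime_order_powers(2)[OF sV0 _ refl w] normalizesD[OF nV0 x w(1)] by blast
    next
      assume "\<forall>a\<in>X. \<forall>v\<in>V0. cj a v = v"
      then have "cj x w = w [^] (1 :: nat)" using x w(1) V0(2) Vc by auto
      then show ?thesis by blast
    qed
    then obtain i :: nat where i: "cj x w = w [^] i" by blast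
    have Vcomm: "u \<otimes> v = v \<otimes> u" if "u \<in> V" "v \<in> V" for u v
      using RV that VR Vc cj_eq_self_iff[of u v] by blast
    \<comment> \<open>One nontrivial \<open>w\<close> suffices: \<open>V\<close> is abelian and
      \<open>G\<close> acts commutatively on it, so the elements that \<open>x\<close> raises to the
      power \<open>i\<close> form a normal subgroup of \<open>G\<close>.\<close>
    let ?E = "{v \<in> V. cj x v = v [^] i}"
    have "subgroup ?E G"
    proof (rule subgroupI)
      show "?E \<noteq> {}" using subgroup.one_closed[OF sV] xc by auto
      show "inv v \<in> ?E" if "v \<in> ?E" for v
        using that xc Vc sV by (simp add: cj_inv nat_pow_inv subgroup.m_inv_closed)
      show "u \<otimes> v \<in> ?E" if "u \<in> ?E" "v \<in> ?E" for u v
        using that xc Vc sV pow_mult_distrib[OF Vcomm, of u v] by (simp add: cj_mult subgroup.m_closed)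
    qed (use Vc in auto)
    moreover have "normalizes G (carrier G) ?E"
      unfolding normalizes_iff
    proof clarify
      fix g v assume g: "g \<in> carrier G" and v: "v \<in> V" "cj x v = v [^] i"
      have "cj x (cj g v) = cj g v [^] i" using comm[OF xc g v(1)] v Vc[OF v(1)] g by (simp add: cj_pow)
      then show "cj g v \<in> V \<and> cj x (cj g v) = cj g v [^] i" using normal_cj[OF V(1) g v(1)] by simp
    qed
    ultimately have "?E = {\<one>} \<or> ?E = V" using min by (simp add: normal_iff_normalizes)
    moreover have "w \<in> ?E" using w(1) V0(2) i by auto
    ultimately have "?E = V" using w(2) by blast
    then show ?thesis by blast
  qed
  have power_normal: "normalizes G X D0"
    if X: "subgroup X G" "nilpotent_over G {\<one>} X" "modular_chain k G X (carrier G)"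
      and D0: "subgroup D0 G" "D0 \<subseteq> V" for X D0
    unfolding normalizes_iff
  proof (intro ballI)
    fix x d assume x: "x \<in> X" and d: "d \<in> D0"
    obtain i :: nat where "\<forall>v\<in>V. cj x v = v [^] i" using power_action[OF X x] by blast
    then have "cj x d = d [^] i" using d D0(2) by blast
    moreover have "d [^] i \<in> D0"
      using d D0(1) by (induction i) (auto simp: subgroup.m_closed subgroup.one_closed)
    ultimately show "cj x d \<in> D0" by simp
  qed
  have "card V dvd r ^ multiplicity r (order G)" using card_subgroup_dvd[OF sV sR VR] R(3) by simp
  then obtain j where j: "card V = r ^ j" using R(2) divides_primepow_nat by blast
  have "card V \<noteq> 1" using V(2) card_one_iff[OF sV] by simp
  then have "r dvd card V" using j by (cases j) auto
  then obtain D0 where D0: "subgroup D0 G" "D0 \<subseteq> V" "card D0 = r"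
    using prime_order_subgroup_exists[OF sV R(2)] by blast
  have "normalizes G (carrier G) D0"
    by (rule factors_normalize[OF power_normal[OF A D0(1,2)] power_normal[OF B D0(1,2)]
          subgroup.subset[OF D0(1)]])
  then have "D0 = {\<one>} \<or> D0 = V" using min D0 by (simp add: normal_iff_normalizes)
  moreover have "D0 \<noteq> {\<one>}" using D0(3) R(2) by (auto simp: prime_nat_iff)
  ultimately show ?thesis using D0(3) R(2) by simp
qed

text \<open>\<open>factors\<close> carries the induction hypothesis about proper quotients. The
  subgroup found is minimal normal inside the normal Sylow subgroup; the two cases above are
  distinguished by whether it is all of it.\<close>

lemma normal_subgroup_of_prime_order:
  assumes "1 < order G"
    and factors: "\<And>N N'. \<lbrakk>N \<lhd> G; N' \<lhd> G; N \<subset> N'; N \<noteq> {\<one>}\<rbrakk> \<Longrightarrow> prime_factor_between G N N'"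
  obtains L where "L \<lhd> G" "prime (card L)"
proof -
  have pos: "order G > 0" using assms(1) by simp
  define r where "r = Max (prime_factors (order G))"
  have "prime_factors (order G) \<noteq> {}" using assms(1) by (simp add: prime_factorization_empty_iff)
  then have "r \<in> prime_factors (order G)" unfolding r_def by (intro Max_in) auto
  then have r: "prime r" "r dvd order G" by auto
  have rmax: "p \<le> r" if "prime p" "p dvd order G" for p
    unfolding r_def using that pos by (intro Max_ge) (auto simp: prime_factors_dvd)
  obtain Ar where Ar: "subgroup Ar G" "Ar \<subseteq> A" "card Ar = r ^ multiplicity r (card A)" "normalizes G A Ar"
    using nilpotent_sylow_normal[OF A(1,2) r(1)] .
  obtain Br where Br: "subgroup Br G" "Br \<subseteq> B" "card Br = r ^ multiplicity r (card B)" "normalizes G B Br"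
    using nilpotent_sylow_normal[OF B(1,2) r(1)] .
  note prod = product_of_sylows[OF r(1) Ar Br]
  \<comment> \<open>Being normal in the factors, their Sylow subgroups inherit modular
    chains.\<close>
  have "modular_step k G Ar A" "modular_step k G Br B"
    using Ar Br A(1) B(1) by (simp_all add: modular_step_def)
  then have chains: "modular_chain k G Ar (carrier G)" "modular_chain k G Br (carrier G)"
    using A(3) B(3) converse_rtranclp_into_rtranclp by metis+
  obtain MA b where MA: "subgroup MA G" "Ar \<subseteq> MA" "normalizes G (carrier G) MA" "card MA = r ^ b"
    using p_subgroup_chain_in_normal[OF chains(1) Ar(1,3) r(1) rmax] .
  obtain MB c where MB: "subgroup MB G" "Br \<subseteq> MB" "normalizes G (carrier G) MB" "card MB = r ^ c"
    using p_subgroup_chain_in_normal[OF chains(2) Br(1,3) r(1) rmax] .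
  let ?R = "MA <#> MB"
  have R: "?R \<lhd> G" using MA(1,3) MB(1,3) by (intro normal_set_mult) (simp_all add: normal_iff_normalizes)
  have sR: "subgroup ?R G" by (rule normal_subgroupD[OF R])
  have "card ?R * card (MA \<inter> MB) = r ^ (b + c)"
    using card_set_mult[OF MA(1) MB(1)] MA(4) MB(4) by (simp add: power_add)
  then obtain i where i: "card ?R = r ^ i" by (rule power_of_prime_divisor[OF r(1)])
  \<comment> \<open>The normal \<open>r\<close>-subgroup \<open>?R\<close> contains a product of
    full Sylow order, so it is itself a Sylow subgroup.\<close>
  have sub: "Ar <#> Br \<subseteq> ?R" using MA(2) MB(2) by (rule mono_set_mult)
  have "card ?R dvd order G"
    using card_subgroup_dvd[OF sR subgroup_self subgroup.subset[OF sR]] by (simp add: order_def)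
  then have "i \<le> multiplicity r (order G)"
    using i pos r(1) not_prime_unit by (intro multiplicity_geI) auto
  moreover have "r ^ multiplicity r (order G) \<le> r ^ i"
    using card_mono[OF finite_subgroup[OF sR] sub] prod(2) i by simp
  then have "multiplicity r (order G) \<le> i"
    using prime_gt_1_nat[OF r(1)] by (simp add: power_increasing_iff)
  ultimately have cardR: "card ?R = r ^ multiplicity r (order G)" using i by simp
  have "multiplicity r (order G) \<noteq> 0"
    using r pos by (simp add: prime_multiplicity_gt_zero_iff)
  then have "card ?R \<noteq> 1" using cardR prime_gt_1_nat[OF r(1)] by simp
  then have "?R \<noteq> {\<one>}" using card_one_iff[OF sR] by blast
  then obtain V where V: "V \<lhd> G" "V \<subseteq> ?R" "V \<noteq> {\<one>}"
    and min: "\<forall>N. N \<lhd> G \<and> N \<subseteq> V \<longrightarrow> N = {\<one>} \<or> N = V"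
    using minimal_subgroup_exists[of "\<lambda>N. N \<lhd> G" ?R] R normal_subgroupD(1) by metis
  have "prime (card V)"
  proof (cases "V = ?R")
    case True
    show ?thesis
      using minimal_normal_sylow[OF R _ r(1) cardR _ factors] V(3) min True by blast
  next
    case False
    then have "V \<subset> ?R" using V(2) by blast
    then show ?thesis
      using minimal_normal_below_sylow[OF R r(1) cardR V(1,3) _ min factors] by blast
  qed
  then show ?thesis using that V(1) by blast
qed

end

section \<open>Supersolubility\<close>

lemma (in finite_group_hom) factorised_group_image:
  assumes "factorised_group G A B k"
  shows "factorised_group H (h ` A) (h ` B) k"
proof -
  interpret f: factorised_group G A B k by fact
  show ?thesis
  proof (intro factorised_group.intro fH.finite_group_axioms factorised_group_axioms.intro)
    show "subgroup (h ` A) H" "subgroup (h ` B) H" using subgroup_img_is_subgroup f.A(1) f.B(1) by auto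
    show "nilpotent_over H {\<one>\<^bsub>H\<^esub>} (h ` A)" "nilpotent_over H {\<one>\<^bsub>H\<^esub>} (h ` B)"
      using nilpotent_over_image f.A(2) f.B(2) by auto
    show "modular_chain k H (h ` A) (carrier H)" "modular_chain k H (h ` B) (carrier H)"
      using modular_chain_image[OF f.A(3)] modular_chain_image[OF f.B(3)] surj by auto
    show "carrier H = h ` A <#>\<^bsub>H\<^esub> h ` B"
      using set_mult_hom[OF homh subgroup.subset[OF f.A(1)] subgroup.subset[OF f.B(1)]] f.AB surj by simp
  qed
qed

lemma (in finite_group) prime_order_imp_cyclic:
  assumes "prime (order G)"
  shows "cyclic_group G"
proof -
  have "carrier G \<noteq> {\<one>}" using assms by (auto simp: order_def prime_nat_iff)
  then obtain x where x: "x \<in> carrier G" "x \<noteq> \<one>" using one_closed by blast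
  have "y \<in> range (\<lambda>n :: int. x [^] n)" if y: "y \<in> carrier G" for y
  proof -
    obtain i :: nat where "y = x [^] i"
      using prime_order_powers(2)[OF subgroup_self assms _ x y] by (auto simp: order_def)
    then have "y = x [^] int i" by (simp add: int_pow_int)
    then show ?thesis by blast
  qed
  then have "carrier G = range (\<lambda>n :: int. x [^] n)" using x(1) by auto
  then show ?thesis using x(1) cyclic_group by blast
qed

context factorised_group
begin

text \<open>The case of a trivial bottom is applied to \<open>G Mod N\<close>, a product of the same
  kind; taking preimages translates the hypothesis on subgroups above \<open>N\<close> and the
  subgroup found.\<close>

lemma normal_subgroup_above:
  assumes N: "N \<lhd> G" "N \<noteq> carrier G"
    and factors: "\<And>N1 N2. \<lbrakk>N1 \<lhd> G; N2 \<lhd> G; N \<subset> N1; N1 \<subset> N2\<rbrakk> \<Longrightarrow> prime_factor_between G N1 N2"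
  shows "prime_factor_between G N (carrier G)"
proof -
  let ?Q = "G Mod N"
  let ?p = "\<lambda>a. N #> a"
  interpret \<pi>: finite_group_hom G ?Q ?p by (rule quotient_hom(1)[OF normal_subgroupD[OF N(1)]])
  have ker: "kernel G ?Q ?p = N" by (rule quotient_hom(2)[OF normal_subgroupD[OF N(1)]])
  interpret Q: factorised_group ?Q "?p ` A" "?p ` B" k
    by (rule \<pi>.factorised_group_image) (rule factorised_group_axioms)
  have sN: "subgroup N G" by (rule normal_subgroupD[OF N(1)])
  have posN: "card N > 0" by (rule card_subgroup_pos[OF sN])
  let ?pre = "\<lambda>X. {g \<in> carrier G. N #> g \<in> X}"
  have pre_normal: "?pre X \<lhd> G" if "X \<lhd> ?Q" for X
  proof -
    have "normalizes G {g \<in> carrier G. N #> g \<in> carrier ?Q} (?pre X)"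
      by (rule \<pi>.normalizes_preimage[OF \<pi>.H.normal_subgroupD(2)[OF that]])
    moreover have "{g \<in> carrier G. N #> g \<in> carrier ?Q} = carrier G" using \<pi>.hom_closed by auto
    ultimately show ?thesis
      using \<pi>.subgroup_preimage[OF \<pi>.H.normal_subgroupD(1)[OF that]] by (simp add: normal_iff_normalizes)
  qed
  have pre_card: "card (?pre X) = card X * card N" if "X \<lhd> ?Q" for X
    using \<pi>.card_preimage[OF \<pi>.H.normal_subgroupD(1)[OF that]] ker by simp
  have pre_image: "?p ` ?pre X = X" if "X \<lhd> ?Q" for X
    by (rule \<pi>.image_preimage[OF subgroup.subset[OF \<pi>.H.normal_subgroupD(1)[OF that]]])
  have pre_N: "N \<subseteq> ?pre X" if "X \<lhd> ?Q" for X
  proof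
    fix x assume x: "x \<in> N"
    then have "x \<in> kernel G ?Q ?p" using ker by simp
    then show "x \<in> ?pre X"
      using subgroup.one_closed[OF \<pi>.H.normal_subgroupD(1)[OF that]] by (simp add: kernel_def)
  qed
  have "card (carrier G) = card (?p ` carrier G) * card N"
    using \<pi>.card_image_kernel[OF subgroup_self] ker subgroup.subset[OF sN] by (simp add: inf.absorb2)
  then have "order G = order ?Q * card N" unfolding \<pi>.surj order_def .
  moreover have "order G \<noteq> card N"
    using card_eq_imp_eq[OF subgroup_self subgroup.subset[OF sN]] N(2) by (auto simp: order_def)
  moreover have "order G > 0" by (simp add: order_gt_0_iff_finite)
  ultimately have "order ?Q \<noteq> 0" "order ?Q \<noteq> 1" by auto
  then have "1 < order ?Q" by linarith
  moreover have "prime_factor_between ?Q X Y"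
    if XY: "X \<lhd> ?Q" "Y \<lhd> ?Q" "X \<subset> Y" "X \<noteq> {\<one>\<^bsub>?Q\<^esub>}" for X Y
  proof -
    have "?pre X \<noteq> N"
    proof
      assume "?pre X = N"
      then have "card X * card N = 1 * card N" using pre_card[OF XY(1)] by (metis mult_1)
      then have "card X = 1" using posN by (metis mult_right_cancel neq0_conv)
      then show False using \<pi>.fH.card_one_iff[OF \<pi>.H.normal_subgroupD(1)[OF XY(1)]] XY(4) by blast
    qed
    then have 1: "N \<subset> ?pre X" using pre_N[OF XY(1)] by blast
    have "?pre X \<noteq> ?pre Y"
    proof
      assume "?pre X = ?pre Y"
      then have "?p ` ?pre X = ?p ` ?pre Y" by (rule arg_cong)
      then have "X = Y" unfolding pre_image[OF XY(1)] pre_image[OF XY(2)] .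
      then show False using XY(3) by simp
    qed
    then have 2: "?pre X \<subset> ?pre Y" using XY(3) by auto
    obtain L p where L: "L \<lhd> G" "?pre X \<subseteq> L" "L \<subseteq> ?pre Y" "prime (p :: nat)" "card L = p * card (?pre X)"
      using factors[OF pre_normal[OF XY(1)] pre_normal[OF XY(2)] 1 2]
      unfolding prime_factor_between_def by (elim exE conjE) (rule that)
    have sL: "subgroup L G" by (rule normal_subgroupD[OF L(1)])
    have "?p ` L \<lhd> ?Q"
      using \<pi>.subgroup_img_is_subgroup[OF sL]
        \<pi>.normalizes_image[OF subgroup_self subgroup.subset[OF sL] normal_subgroupD(2)[OF L(1)]] \<pi>.surj
      by (simp add: \<pi>.H.normal_iff_normalizes)
    moreover have "X \<subseteq> ?p ` L" using image_mono[OF L(2), of ?p] unfolding pre_image[OF XY(1)] .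
    moreover have "?p ` L \<subseteq> Y" using image_mono[OF L(3), of ?p] unfolding pre_image[OF XY(2)] .
    moreover have "L \<inter> N = N" using 1 L(2) by blast
    then have "card (?p ` L) * card N = (p * card X) * card N"
      using \<pi>.card_image_kernel[OF sL] ker L(5) pre_card[OF XY(1)] by auto
    then have "card (?p ` L) = p * card X" using posN by (metis mult_right_cancel neq0_conv)
    ultimately show ?thesis using L(4) unfolding prime_factor_between_def by blast
  qed
  ultimately obtain L where L: "L \<lhd> ?Q" "prime (card L)"
    using Q.normal_subgroup_of_prime_order by blast
  then show ?thesis
    unfolding prime_factor_between_def using pre_normal[OF L(1)] pre_N[OF L(1)] pre_card[OF L(1)]
    by (intro exI[of _ "?pre L"] exI[of _ "card L"]) auto
qed

text \<open>Take \<open>L\<close> of prime order over \<open>N\<close>. If \<open>L\<close> is not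
  inside \<open>N'\<close>, then \<open>N' \<inter> L = N\<close>, so \<open>N' / N\<close>
  corresponds to \<open>N'L / L\<close>. There the induction hypothesis supplies \<open>L2\<close>,
  and intersecting with \<open>N'\<close> brings it back.\<close>

lemma prime_factor_between_normal:
  assumes "N \<lhd> G" "N' \<lhd> G" "N \<subset> N'"
  shows "prime_factor_between G N N'"
  using assms
proof (induction "order G - card N" arbitrary: N N' rule: less_induct)
  case less
  have sN: "subgroup N G" and sN': "subgroup N' G" using less.prems normal_subgroupD(1) by auto
  have card_le: "card X \<le> order G" if "subgroup X G" for X
    using card_mono[OF fin subgroup.subset[OF that]] by (simp add: order_def)
  have dec: "order G - card X < order G - card N" if X: "subgroup X G" "N \<subset> X" for X
  proof -
    have "card N < card X" using psubset_card_mono[OF finite_subgroup[OF X(1)] X(2)] .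
    then show ?thesis using card_le[OF X(1)] by linarith
  qed
  have "N \<noteq> carrier G" using less.prems(3) subgroup.subset[OF sN'] by blast
  then have "prime_factor_between G N (carrier G)"
    using less.hyps dec normal_subgroupD(1) by (intro normal_subgroup_above less.prems(1)) blast+
  then obtain L p where L: "L \<lhd> G" "N \<subseteq> L" "prime (p :: nat)" "card L = p * card N"
    unfolding prime_factor_between_def by blast
  have sL: "subgroup L G" by (rule normal_subgroupD[OF L(1)])
  have NL: "N \<subset> L"
    using L(2,3,4) card_subgroup_pos[OF sN] by (auto simp: prime_nat_iff)
  have "N' \<inter> L = N \<or> N' \<inter> L = L"
    using L(2) less.prems(3)
    by (intro subgroup_between_prime_index[OF sN sL subgroup_int[OF sN' sL] _ _ L(3,4)]) auto
  then show ?case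
  proof
    assume "N' \<inter> L = L"
    then show ?thesis unfolding prime_factor_between_def using L by blast
  next
    assume NL': "N' \<inter> L = N"
    let ?U = "N' <#> L"
    have U: "?U \<lhd> G" by (rule normal_set_mult[OF less.prems(2) L(1)])
    have LU: "L \<subseteq> ?U" and NU: "N' \<subseteq> ?U"
      using set_mult_superset_right[OF sN' sL] set_mult_superset_left[OF sN' sL] .
    have "L \<subset> ?U" using LU NU NL' less.prems(3) by blast
    then have "prime_factor_between G L ?U" using less.hyps[OF dec[OF sL NL] L(1) U] by simp
    then obtain L2 q where L2: "L2 \<lhd> G" "L \<subseteq> L2" "L2 \<subseteq> ?U" "prime (q :: nat)" "card L2 = q * card L"
      unfolding prime_factor_between_def by blast
    have sL2: "subgroup L2 G" by (rule normal_subgroupD[OF L2(1)])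
    let ?L3 = "N' \<inter> L2"
    have sL3: "subgroup ?L3 G" by (rule subgroup_int[OF sN' sL2])
    have L3: "?L3 \<lhd> G"
      using sL3 normalizes_int[OF normal_subgroupD(2)[OF less.prems(2)] normal_subgroupD(2)[OF L2(1)]]
      by (simp add: normal_iff_normalizes)
    have "?L3 <#> L = L2"
    proof
      show "?L3 <#> L \<subseteq> L2" using L2(2) by (intro set_mult_subset[OF sL2]) auto
      show "L2 \<subseteq> ?L3 <#> L"
      proof
        fix x assume x: "x \<in> L2"
        then obtain n l where nl: "n \<in> N'" "l \<in> L" "x = n \<otimes> l" using L2(3) by (auto simp: set_mult_def)
        have c: "n \<in> carrier G" "l \<in> carrier G"
          using subgroup.mem_carrier[OF sN' nl(1)] subgroup.mem_carrier[OF sL nl(2)] .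
        then have "n = x \<otimes> inv l" using nl(3) by (simp add: m_assoc)
        then have "n \<in> L2" using x nl(2) L2(2) sL2 by (auto intro: subgroup.m_closed subgroup.m_inv_closed)
        then show "x \<in> ?L3 <#> L" using nl by (auto intro: set_multI)
      qed
    qed
    moreover have "?L3 \<inter> L = N" using NL' L2(2) by blast
    ultimately have "q * card L * card N = card ?L3 * card L"
      using card_set_mult[OF sL3 sL] L2(5) by simp
    then have "(q * card N) * card L = card ?L3 * card L" by (simp add: mult_ac)
    then have "card ?L3 = q * card N"
      using card_subgroup_pos[OF sL] by (metis mult_right_cancel neq0_conv)
    moreover have "N \<subseteq> ?L3" using less.prems(3) L(2) L2(2) by blast
    ultimately show ?thesis unfolding prime_factor_between_def using L3 L2(4) by blast
  qed
qed

lemma prime_series: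
  obtains K :: "nat \<Rightarrow> 'a set" and n where "K 0 = {\<one>}" "K n = carrier G" "\<forall>i\<le>n. K i \<lhd> G"
    "\<forall>i<n. K i \<subseteq> K (Suc i) \<and> (\<exists>p. prime p \<and> card (K (Suc i)) = p * card (K i))"
proof -
  define T where "T N L \<longleftrightarrow> N \<lhd> G \<and> L \<lhd> G \<and> N \<subseteq> L \<and> (\<exists>p. prime p \<and> card L = p * card N)" for N L
  have carrier: "carrier G \<lhd> G" by (simp add: normal_iff_normalizes subgroup_self normalizes_self)
  have "T\<^sup>*\<^sup>* N (carrier G)" if "N \<lhd> G" for N
    using that
  proof (induction "order G - card N" arbitrary: N rule: less_induct)
    case less
    show ?case
    proof (cases "N = carrier G")
      case False
      have sN: "subgroup N G" by (rule normal_subgroupD[OF less.prems])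
      have "N \<subset> carrier G" using False subgroup.subset[OF sN] by blast
      then have "prime_factor_between G N (carrier G)"
        by (rule prime_factor_between_normal[OF less.prems carrier])
      then obtain L p where L: "L \<lhd> G" "N \<subseteq> L" "prime (p :: nat)" "card L = p * card N"
        unfolding prime_factor_between_def by blast
      have "card N < card L" using L(3,4) card_subgroup_pos[OF sN] prime_gt_1_nat[OF L(3)] by simp
      moreover have "card L \<le> order G"
        using card_mono[OF fin subgroup.subset[OF normal_subgroupD(1)[OF L(1)]]] by (simp add: order_def)
      ultimately have "T\<^sup>*\<^sup>* L (carrier G)" using less.hyps[OF _ L(1)] by linarith
      moreover have "T N L" using less.prems L unfolding T_def by blast
      ultimately show ?thesis by (rule converse_rtranclp_into_rtranclp[rotated])
    qed simp
  qed
  moreover have one: "{\<one>} \<lhd> G" by (simp add: normal_iff_normalizes triv_subgroup normalizes_iff)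
  ultimately obtain n where "(T ^^ n) {\<one>} (carrier G)" using rtranclp_imp_relpowp by metis
  then obtain K where K: "K 0 = {\<one>}" "K n = carrier G" "\<forall>i<n. T (K i) (K (Suc i))"
    unfolding relpowp_fun_conv by blast
  have "K i \<lhd> G" if "i \<le> n" for i
  proof (cases "i = n")
    case True
    then show ?thesis using K(2) carrier by simp
  next
    case False
    then show ?thesis using K(3) that unfolding T_def by simp
  qed
  then show ?thesis using K by (intro that[of K n]) (auto simp: T_def)
qed

lemma supersoluble: "supersoluble_group G"
proof -
  obtain K :: "nat \<Rightarrow> 'a set" and n where K: "K 0 = {\<one>}" "K n = carrier G" "\<forall>i\<le>n. K i \<lhd> G"
    "\<forall>i<n. K i \<subseteq> K (Suc i) \<and> (\<exists>p. prime p \<and> card (K (Suc i)) = p * card (K i))"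
    using prime_series .
  have "cyclic_group ((G\<lparr>carrier := K (Suc i)\<rparr>) Mod K i)" if i: "i < n" for i
  proof -
    let ?Y = "G\<lparr>carrier := K (Suc i)\<rparr>"
    obtain p where p: "prime p" "card (K (Suc i)) = p * card (K i)" "K i \<subseteq> K (Suc i)" using K(4) i by blast
    have N: "K i \<lhd> G" "K (Suc i) \<lhd> G" using K(3) i by auto
    have sub: "subgroup (K i) G" "subgroup (K (Suc i)) G" using N normal_subgroupD(1) by auto
    have gY: "group ?Y" using sub(2) by (rule subgroup_imp_group)
    have KY: "subgroup (K i) ?Y" by (rule subgroup_incl[OF sub p(3)])
    interpret Y: finite_group ?Y using gY sub(2) by (simp add: finite_group_def finite_group_axioms_def)
    have "normalizes G (K (Suc i)) (K i)"
      by (rule normalizes_mono[OF normal_subgroupD(2)[OF N(1)] subgroup.subset[OF sub(2)]])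
    then have nrm: "normalizes ?Y (carrier ?Y) (K i)" using sub(2) by (simp add: normalizes_def)
    interpret \<pi>: finite_group_hom ?Y "?Y Mod K i" "\<lambda>a. K i #>\<^bsub>?Y\<^esub> a" by (rule Y.quotient_hom(1)[OF KY nrm])
    have "card (K (Suc i)) = card (rcosets\<^bsub>?Y\<^esub> (K i)) * card (K i)"
      using Y.lagrange[OF KY] by (simp add: order_def)
    then have "order (?Y Mod K i) = p"
      using p(2) card_subgroup_pos[OF sub(1)] by (simp add: order_def FactGroup_def)
    then show ?thesis using \<pi>.fH.prime_order_imp_cyclic p(1) by simp
  qed
  then show ?thesis
    unfolding supersoluble_group_def using K by (intro exI[of _ K] exI[of _ n]) auto
qed

end

section \<open>Sylow subgroups\<close>

context finite_group
begin

text \<open>By the modular law \<open>HL \<inter> F = (H \<inter> F)L\<close>, so multiplying by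
  \<open>L\<close> keeps the order of the induced group.\<close>

lemma index_set_mult_normal:
  assumes H: "subgroup H G" and L: "L \<lhd> G" and F: "F \<lhd> G" "L \<subseteq> F"
    and n: "card H = n * card (H \<inter> F)"
  shows "card (H <#> L) = n * card ((H <#> L) \<inter> F)"
proof -
  have sL: "subgroup L G" and sF: "subgroup F G" using L F normal_subgroupD(1) by auto
  have sHF: "subgroup (H \<inter> F) G" by (rule subgroup_int[OF H sF])
  have eq: "(H <#> L) \<inter> F = (H \<inter> F) <#> L"
  proof
    show "(H <#> L) \<inter> F \<subseteq> (H \<inter> F) <#> L"
    proof
      fix x assume x: "x \<in> (H <#> L) \<inter> F"
      then obtain h l where hl: "h \<in> H" "l \<in> L" "x = h \<otimes> l" by (auto simp: set_mult_def)
      have "h = x \<otimes> inv l"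
        using hl subgroup.mem_carrier[OF H hl(1)] subgroup.mem_carrier[OF sL hl(2)] by (simp add: m_assoc)
      then have "h \<in> F" using x hl(2) F(2) sF by (auto intro: subgroup.m_closed subgroup.m_inv_closed)
      then show "x \<in> (H \<inter> F) <#> L" using hl by (auto intro: set_multI)
    qed
    show "(H \<inter> F) <#> L \<subseteq> (H <#> L) \<inter> F"
      using mono_set_mult[of "H \<inter> F" H L L] set_mult_subset[OF sF _ F(2), of "H \<inter> F"] by blast
  qed
  have "(H \<inter> F) \<inter> L = H \<inter> L" using F(2) by blast
  then have "card (H <#> L) * card (H \<inter> L) = (n * card ((H <#> L) \<inter> F)) * card (H \<inter> L)"
    using card_set_mult[OF H sL] card_set_mult[OF sHF sL] n eq by (simp add: mult.assoc)
  then show ?thesis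
    using card_subgroup_pos[OF subgroup_int[OF H sL]] by (metis mult_right_cancel neq0_conv)
qed

text \<open>\<open>HL \<inter> K\<close> lies between \<open>L\<close> and \<open>K\<close>, whose
  index is prime, and equals \<open>K\<close> only if \<open>HL = HK\<close>.\<close>

lemma set_mult_prime_factor_card:
  assumes H: "subgroup H G" and L: "L \<lhd> G" and K: "K \<lhd> G" and r: "L \<subseteq> K" "prime r" "card K = r * card L"
    and ne: "H <#> L \<noteq> H <#> K"
  shows "card (H <#> K) = r * card (H <#> L)" "(H <#> L) \<inter> K = L"
proof -
  have sL: "subgroup L G" and sK: "subgroup K G" using L K normal_subgroupD(1) by auto
  have Hsub: "H \<subseteq> carrier G" by (rule subgroup.subset[OF H])
  have sHL: "subgroup (H <#> L) G"
    by (rule subgroup_set_mult[OF H sL normalizes_mono[OF normal_subgroupD(2)[OF L] Hsub]])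
  have HL: "H \<subseteq> H <#> L" "L \<subseteq> H <#> L"
    using set_mult_superset_left[OF H sL] set_mult_superset_right[OF H sL] .
  have "(H <#> L) \<inter> K \<noteq> K"
  proof
    assume "(H <#> L) \<inter> K = K"
    then have "H <#> K \<subseteq> H <#> L" using HL(1) by (intro set_mult_subset[OF sHL]) auto
    moreover have "H <#> L \<subseteq> H <#> K" using r(1) by (intro mono_set_mult) auto
    ultimately show False using ne by blast
  qed
  then show int: "(H <#> L) \<inter> K = L"
    using subgroup_between_prime_index[OF sL sK subgroup_int[OF sHL sK] _ _ r(2,3)] HL(2) r(1) by blast
  have "(H <#> L) <#> K = H <#> (L <#> K)"
    by (rule set_mult_assoc[OF Hsub subgroup.subset[OF sL] subgroup.subset[OF sK]])
  also have "L <#> K = K"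
    using set_mult_subset[OF sK r(1) subset_refl] set_mult_superset_right[OF sL sK] by blast
  finally have "card (H <#> K) * card L = (r * card (H <#> L)) * card L"
    using card_set_mult[OF sHL sK] int r(3) by (simp add: mult_ac)
  then show "card (H <#> K) = r * card (H <#> L)"
    using card_subgroup_pos[OF sL] by (metis mult_right_cancel neq0_conv)
qed

text \<open>If \<open>r \<le> p\<close>, the induced group is trivial. Otherwise \<open>HL\<close>
  is maximal in \<open>HK\<close>, so this inclusion is a modular step; its subgroup
  \<open>C\<close> centralises \<open>K / L\<close>, and the order of the induced group divides the
  index of \<open>C\<close> in \<open>HL\<close>.\<close>

lemma modular_p_subgroup_on_factor:
  assumes H: "subgroup H G" "card H = p ^ a" "prime p" "modular_chain k G H (carrier G)"
    and L: "L \<lhd> G" and K: "K \<lhd> G" and r: "L \<subseteq> K" "prime r" "card K = r * card L"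
  obtains m where "m \<le> k" "card H = p ^ m * card (H \<inter> factor_centralizer G L K)"
proof (cases "r \<le> p")
  case True
  have "H \<subseteq> factor_centralizer G L K"
    by (rule p_subgroup_centralizes_factor[OF L K r H(1,3,2) True])
  then have "H \<inter> factor_centralizer G L K = H" by blast
  then show ?thesis using that[of 0] by simp
next
  case False
  let ?F = "factor_centralizer G L K"
  have F: "?F \<lhd> G" by (rule factor_centralizer_normal[OF L K])
  have sL: "subgroup L G" and sK: "subgroup K G" and sF: "subgroup ?F G"
    using L K F normal_subgroupD(1) by auto
  have LF: "L \<subseteq> ?F" using factor_centralizer_contains_factor[OF L K r] r(1) by blast
  obtain n where n: "card H = n * card (H \<inter> ?F)" using factor_centralizer_index[OF L K r H(1)] .
  then obtain m where m: "n = p ^ m" using power_of_prime_divisor[OF H(3)] H(2) by metis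
  let ?X = "H <#> L" and ?U = "H <#> K"
  have Hsub: "H \<subseteq> carrier G" by (rule subgroup.subset[OF H(1)])
  have sX: "subgroup ?X G"
    by (rule subgroup_set_mult[OF H(1) sL normalizes_mono[OF normal_subgroupD(2)[OF L] Hsub]])
  have sU: "subgroup ?U G"
    by (rule subgroup_set_mult[OF H(1) sK normalizes_mono[OF normal_subgroupD(2)[OF K] Hsub]])
  have XU: "?X \<subseteq> ?U" using r(1) by (intro mono_set_mult) auto
  have KU: "K \<subseteq> ?U" by (rule set_mult_superset_right[OF H(1) sK])
  have ne: "?X \<noteq> ?U"
  proof
    assume "?X = ?U"
    then have "r * card L dvd card ?X" using card_subgroup_dvd[OF sK sU KU] r(3) by simp
    also have "card ?X dvd card H * card L" using card_set_mult[OF H(1) sL] by (metis dvd_triv_left)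
    finally have "r dvd p ^ a" using card_subgroup_pos[OF sL] H(2) by (simp del: card_0_eq)
    then have "r = p" using r(2) H(3) by (metis prime_dvd_power primes_dvd_imp_eq)
    then show False using False by simp
  qed
  note card = set_mult_prime_factor_card[OF H(1) L K r ne]
  have idx: "card ?X = n * card (?X \<inter> ?F)" by (rule index_set_mult_normal[OF H(1) L F LF n])
  \<comment> \<open>Commutators of \<open>D\<close> with \<open>K\<close> lie in
    \<open>HL \<inter> K\<close>, which is \<open>L\<close>.\<close>
  have in_F: "D \<subseteq> ?F" if D: "D \<subseteq> ?X" "normalizes G ?U D" for D
  proof
    fix d assume d: "d \<in> D"
    have dX: "d \<in> ?X" using d D(1) by blast
    have dc: "d \<in> carrier G" using subgroup.mem_carrier[OF sX dX] .
    have "inv x \<otimes> cj d x \<in> L" if x: "x \<in> K" for x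
    proof -
      have xc: "x \<in> carrier G" using subgroup.mem_carrier[OF sK x] .
      have "inv x \<in> ?U" using x KU sU by (auto intro: subgroup.m_inv_closed)
      then have "cj (inv x) d \<in> ?X" using normalizesD[OF D(2) _ d] D(1) by blast
      then have "cj (inv x) d \<otimes> inv d \<in> ?X" using dX sX by (simp add: subgroup.m_closed subgroup.m_inv_closed)
      moreover have "cj (inv x) d \<otimes> inv d = inv x \<otimes> cj d x"
        using dc xc by (simp add: cj_def group_word_simps)
      moreover have "inv x \<otimes> cj d x \<in> K"
        using x normal_cj[OF K dc x] sK by (simp add: subgroup.m_closed subgroup.m_inv_closed)
      ultimately show ?thesis using card(2) by auto
    qed
    then show "d \<in> ?F" using dc by (simp add: factor_centralizer_def)
  qed
  have chain: "modular_chain k G ?X (carrier G)"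
    by (rule modular_chain_set_mult_normal[OF H(4,1) sL normal_subgroupD(2)[OF L]])
  have "Z = ?X \<or> Z = ?U" if "subgroup Z G" "?X \<subseteq> Z" "Z \<subseteq> ?U" for Z
    by (rule subgroup_between_prime_index[OF sX sU that r(2) card(1)])
  then have "modular_step k G ?X ?U"
    using XU ne by (intro maximal_modular_step[OF chain sX sU]) auto
  then show ?thesis
  proof (cases rule: modular_stepE)
    case normal
    then have "H \<inter> ?F = H"
      using in_F[OF subset_refl normal(4)] set_mult_superset_left[OF H(1) sL] by blast
    then show ?thesis using that[of 0] by simp
  next
    case (prime_index p' q m' C)
    have "C \<subseteq> ?X \<inter> ?F" using in_F[OF prime_index(9,10)] prime_index(9) by blast
    then obtain l where l: "card (?X \<inter> ?F) = l * card C"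
      using coset_card[OF prime_index(8) subgroup_int[OF sX sF]] by blast
    have "n * l * card C = q ^ m' * card C" using idx l prime_index(11) by (metis mult.assoc)
    then have "n * l = q ^ m'" using card_subgroup_pos[OF prime_index(8)] by (metis mult_right_cancel neq0_conv)
    then obtain j where j: "n = q ^ j" "j \<le> m'" using power_of_prime_divisor[OF prime_index(5)] by blast
    \<comment> \<open>A nontrivial \<open>p ^ m\<close> that is also a power of \<open>q\<close>
      forces \<open>p = q\<close>, so the exponents agree and the bound of the step applies.\<close>
    have "m \<le> k"
    proof (cases "m = 0")
      case False
      then have "p dvd q ^ j" using m j by (metis dvd_power neq0_conv)
      then have "p = q" using H(3) prime_index(5) by (metis prime_dvd_power primes_dvd_imp_eq)
      then have "m = j" using m j prime_gt_1_nat[OF H(3)] by (metis power_inject_exp)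
      then show ?thesis using j(2) prime_index(6) by simp
    qed simp
    then show ?thesis using that n m by blast
  qed
qed

text \<open>From \<open>PL\<close> to \<open>PK\<close> the index is 1 or the prime
  \<open>r\<close>. In the latter case \<open>PL \<inter> F\<close>, for \<open>F\<close> the
  centraliser of \<open>K / L\<close>, is the normal subgroup needed for a modular step, and
  \<open>bound\<close> gives its index in \<open>PL\<close>.\<close>

lemma sylow_chain_along_series:
  assumes P: "subgroup P G"
    and K: "K 0 = {\<one>}" "K n = carrier G" "\<forall>i\<le>n. K i \<lhd> G"
      "\<forall>i<n. K i \<subseteq> K (Suc i) \<and> (\<exists>p. prime p \<and> card (K (Suc i)) = p * card (K i))"
    and p: "prime p"
    and bound: "\<And>L K r. \<lbrakk>L \<lhd> G; K \<lhd> G; L \<subseteq> K; prime r; card K = r * card L\<rbrakk> \<Longrightarrow>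
      \<exists>m\<le>k. card P = p ^ m * card (P \<inter> factor_centralizer G L K)"
  shows "modular_chain k G P (carrier G)"
proof -
  have Psub: "P \<subseteq> carrier G" by (rule subgroup.subset[OF P])
  have "modular_chain k G P (P <#> K i)" if "i \<le> n" for i
    using that
  proof (induction i)
    case 0
    have "P <#> K 0 = P" using K(1) Psub by (force simp: set_mult_def)
    then show ?case by simp
  next
    case (Suc i)
    let ?L = "K i" and ?K = "K (Suc i)"
    have L: "?L \<lhd> G" and K': "?K \<lhd> G" using K(3) Suc.prems by auto
    have "i < n" using Suc.prems by simp
    then obtain r where r: "?L \<subseteq> ?K" "prime (r :: nat)" "card ?K = r * card ?L" using K(4) by blast
    have sL: "subgroup ?L G" and sK: "subgroup ?K G" using L K' normal_subgroupD(1) by auto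
    let ?X = "P <#> ?L" and ?U = "P <#> ?K"
    have sX: "subgroup ?X G"
      by (rule subgroup_set_mult[OF P sL normalizes_mono[OF normal_subgroupD(2)[OF L] Psub]])
    have sU: "subgroup ?U G"
      by (rule subgroup_set_mult[OF P sK normalizes_mono[OF normal_subgroupD(2)[OF K'] Psub]])
    have XU: "?X \<subseteq> ?U" using r(1) by (intro mono_set_mult) auto
    have "modular_step k G ?X ?U"
    proof (cases "?X = ?U")
      case True
      then show ?thesis using sX sU normalizes_self[OF sU] unfolding modular_step_def by simp
    next
      case False
      let ?F = "factor_centralizer G ?L ?K"
      have F: "?F \<lhd> G" by (rule factor_centralizer_normal[OF L K'])
      have sF: "subgroup ?F G" by (rule normal_subgroupD[OF F])
      have LF: "?L \<subseteq> ?F" using factor_centralizer_contains_factor[OF L K' r] r(1) by blast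
      obtain m where m: "m \<le> k" "card P = p ^ m * card (P \<inter> ?F)" using bound[OF L K' r] by blast
      have card: "card ?U = r * card ?X" by (rule set_mult_prime_factor_card(1)[OF P L K' r False])
      have idx: "card ?X = p ^ m * card (?X \<inter> ?F)" by (rule index_set_mult_normal[OF P L F LF m(2)])
      have sC: "subgroup (?X \<inter> ?F) G" by (rule subgroup_int[OF sX sF])
      \<comment> \<open>An element \<open>x\<close> of \<open>?K\<close> changes \<open>c\<close>
        only by a factor from \<open>?L\<close>, because \<open>c\<close> centralises the factor;
        elements of \<open>P\<close> normalise both \<open>?X\<close> and \<open>?F\<close>.\<close>
      have "normalizes G ?U (?X \<inter> ?F)"
        unfolding normalizes_iff
      proof (intro ballI)
        fix u c assume u: "u \<in> ?U" and c: "c \<in> ?X \<inter> ?F"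
        obtain y x where yx: "y \<in> P" "x \<in> ?K" "u = y \<otimes> x" using u by (auto simp: set_mult_def)
        have car: "y \<in> carrier G" "x \<in> carrier G" "c \<in> carrier G"
          using subgroup.mem_carrier[OF P yx(1)] subgroup.mem_carrier[OF sK yx(2)] subgroup.mem_carrier[OF sC c] .
        have "inv x \<otimes> cj c x \<in> ?L" using c yx(2) by (simp add: factor_centralizer_def)
        then have "cj (inv c) (inv x \<otimes> cj c x) \<in> ?L" by (rule normal_cj[OF L inv_closed[OF car(3)]])
        then have "cj (inv c) (inv x) \<otimes> x \<in> ?L" using car by (simp add: cj_mult)
        then have "inv (cj (inv c) (inv x) \<otimes> x) \<in> ?L" using sL by (rule subgroup.m_inv_closed[rotated])
        moreover have "inv (cj (inv c) (inv x) \<otimes> x) = inv x \<otimes> (inv c \<otimes> x \<otimes> c)"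
          using car by (simp add: cj_def group_word_simps)
        ultimately have "inv x \<otimes> (inv c \<otimes> x \<otimes> c) \<in> ?L" by simp
        then have "cj x (inv x \<otimes> (inv c \<otimes> x \<otimes> c)) \<in> ?L" by (rule normal_cj[OF L car(2)])
        moreover have "cj x (inv x \<otimes> (inv c \<otimes> x \<otimes> c)) = inv c \<otimes> cj x c"
          using car by (simp add: cj_def group_word_simps)
        ultimately have l: "inv c \<otimes> cj x c \<in> ?L" by simp
        have "c \<otimes> (inv c \<otimes> cj x c) \<in> ?X"
          using c l set_mult_superset_right[OF P sL] sX by (auto intro: subgroup.m_closed)
        then have "cj x c \<in> ?X" using car by simp
        then have "cj y (cj x c) \<in> ?X"
          using normalizesD[OF normalizes_self[OF sX]] yx(1) set_mult_superset_left[OF P sL] by blast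
        moreover have "cj y (cj x c) \<in> ?F" using c car normal_cj[OF F] by blast
        ultimately show "cj u c \<in> ?X \<inter> ?F" using yx(3) car by (simp add: cj_mult_left)
      qed
      then show ?thesis unfolding modular_step_def
        using sX sU XU p r(2) m(1) card sC idx
        by (intro conjI disjI2 exI[of _ r] exI[of _ p] exI[of _ m] exI[of _ "?X \<inter> ?F"]) auto
    qed
    then show ?case using Suc by (auto intro: rtranclp.rtrancl_into_rtrancl)
  qed
  from this[of n] have "modular_chain k G P (P <#> carrier G)" using K(2) by simp
  moreover have "P <#> carrier G = carrier G"
    using set_mult_superset_right[OF P subgroup_self] setmult_subset_G[OF Psub subset_refl] by blast
  ultimately show ?thesis by simp
qed

end

context factorised_group
begin

text \<open>The claim is proved for the particular Sylow subgroup \<open>?S\<close>, and conjugation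
  carries it to \<open>P\<close> because the centraliser of the factor is normal.\<close>

lemma sylow_on_factor:
  assumes P: "subgroup P G" "card P = p ^ multiplicity p (order G)" "prime p"
    and LK: "L \<lhd> G" "K \<lhd> G" "L \<subseteq> K" "prime r" "card K = r * card L"
  shows "\<exists>m\<le>k. card P = p ^ m * card (P \<inter> factor_centralizer G L K)"
proof -
  let ?F = "factor_centralizer G L K"
  have F: "?F \<lhd> G" by (rule factor_centralizer_normal[OF LK(1,2)])
  have sF: "subgroup ?F G" by (rule normal_subgroupD[OF F])
  obtain Ap where Ap: "subgroup Ap G" "Ap \<subseteq> A" "card Ap = p ^ multiplicity p (card A)" "normalizes G A Ap"
    using nilpotent_sylow_normal[OF A(1,2) P(3)] .
  obtain Bp where Bp: "subgroup Bp G" "Bp \<subseteq> B" "card Bp = p ^ multiplicity p (card B)" "normalizes G B Bp"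
    using nilpotent_sylow_normal[OF B(1,2) P(3)] .
  let ?S = "Ap <#> Bp"
  note S = product_of_sylows[OF P(3) Ap Bp]
  have "modular_step k G Ap A" "modular_step k G Bp B"
    using Ap Bp A(1) B(1) by (simp_all add: modular_step_def)
  then have chains: "modular_chain k G Ap (carrier G)" "modular_chain k G Bp (carrier G)"
    using A(3) B(3) converse_rtranclp_into_rtranclp by metis+
  obtain a where a: "a \<le> k" "card Ap = p ^ a * card (Ap \<inter> ?F)"
    using modular_p_subgroup_on_factor[OF Ap(1,3) P(3) chains(1) LK] .
  obtain b where b: "b \<le> k" "card Bp = p ^ b * card (Bp \<inter> ?F)"
    using modular_p_subgroup_on_factor[OF Bp(1,3) P(3) chains(2) LK] .
  \<comment> \<open>If \<open>X\<close> covers both \<open>Ap\<close> and \<open>Bp\<close> modulo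
    \<open>?F\<close>, then \<open>X\<close> and \<open>?S\<close> have the same product with
    \<open>?F\<close>, hence induce groups of equal order.\<close>
  have transfer: "card ?S = p ^ m * card (?S \<inter> ?F)"
    if X: "subgroup X G" "X \<subseteq> ?S" "card X = p ^ m * card (X \<inter> ?F)"
      and cover: "Ap \<subseteq> X <#> ?F" "Bp \<subseteq> X <#> ?F" for X m
  proof -
    have sXF: "subgroup (X <#> ?F) G"
      by (rule subgroup_set_mult[OF X(1) sF normalizes_mono[OF normal_subgroupD(2)[OF F] subgroup.subset[OF X(1)]]])
    have "?S <#> ?F \<subseteq> X <#> ?F"
      by (intro set_mult_subset[OF sXF] cover set_mult_superset_right[OF X(1) sF])
    moreover have "X <#> ?F \<subseteq> ?S <#> ?F" using X(2) by (intro mono_set_mult) auto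
    ultimately have SF: "?S <#> ?F = X <#> ?F" by (rule equalityI)
    have "card X * card ?F * card (?S \<inter> ?F) = card ?S * card ?F * card (X \<inter> ?F)"
      unfolding card_set_mult[OF S(1) sF, symmetric] card_set_mult[OF X(1) sF, symmetric] SF
      by (simp only: mult_ac)
    then have "(p ^ m * card (?S \<inter> ?F)) * (card (X \<inter> ?F) * card ?F) = card ?S * (card (X \<inter> ?F) * card ?F)"
      using X(3) by (simp add: mult_ac)
    moreover have "card (X \<inter> ?F) * card ?F \<noteq> 0"
      using card_subgroup_pos[OF subgroup_int[OF X(1) sF]] card_subgroup_pos[OF sF] by simp
    ultimately show ?thesis by (metis mult_right_cancel)
  qed
  have cover: "X' \<subseteq> X <#> ?F"
    if X: "subgroup X G" "card X = p ^ j * card (X \<inter> ?F)"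
      and X': "subgroup X' G" "card X' = p ^ i * card (X' \<inter> ?F)" and "i \<le> j" for X X' i j
  proof
    fix g assume g: "g \<in> X'"
    obtain h where h: "h \<in> X" "inv h \<otimes> g \<in> ?F"
      using p_subgroups_on_factor_comparable[OF LK P(3) X' X \<open>i \<le> j\<close> g] .
    have "h \<otimes> (inv h \<otimes> g) \<in> X <#> ?F" using h by (rule set_multI)
    then show "g \<in> X <#> ?F"
      using subgroup.mem_carrier[OF X(1) h(1)] subgroup.mem_carrier[OF X'(1) g] by simp
  qed
  have "\<exists>m\<le>k. card ?S = p ^ m * card (?S \<inter> ?F)"
  proof (cases "a \<le> b")
    case True
    have "card ?S = p ^ b * card (?S \<inter> ?F)"
      by (rule transfer[OF Bp(1) set_mult_superset_right[OF Ap(1) Bp(1)] b(2)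
            cover[OF Bp(1) b(2) Ap(1) a(2) True] set_mult_superset_left[OF Bp(1) sF]])
    then show ?thesis using b(1) by blast
  next
    case False
    then have "b \<le> a" by simp
    have "card ?S = p ^ a * card (?S \<inter> ?F)"
      by (rule transfer[OF Ap(1) set_mult_superset_left[OF Ap(1) Bp(1)] a(2)
            set_mult_superset_left[OF Ap(1) sF] cover[OF Ap(1) a(2) Bp(1) b(2) \<open>b \<le> a\<close>]])
    then show ?thesis using a(1) by blast
  qed
  then obtain m where m: "m \<le> k" "card ?S = p ^ m * card (?S \<inter> ?F)" by blast
  have Ssub: "?S \<subseteq> carrier G" by (rule subgroup.subset[OF S(1)])
  have "card ?S = p ^ multiplicity p (card (carrier G))" using S(2) by (simp add: order_def)
  then obtain g where g: "g \<in> carrier G" "P \<subseteq> cj g ` ?S"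
    using sylow_contains_conjugate[OF P(1) S(1) subgroup_self subgroup.subset[OF P(1)] Ssub P(3,2)] by blast
  have "P = cj g ` ?S"
    using card_eq_imp_eq[OF subgroup_cj_image[OF g(1) S(1)] g(2)] card_cj_image[OF g(1) Ssub] S(2) P(2) by simp
  moreover have "cj g ` ?S \<inter> ?F = cj g ` (?S \<inter> ?F)"
  proof
    show "cj g ` ?S \<inter> ?F \<subseteq> cj g ` (?S \<inter> ?F)"
    proof clarify
      fix x assume x: "x \<in> ?S" "cj g x \<in> ?F"
      have "cj (inv g) (cj g x) \<in> ?F" using normal_cj[OF F _ x(2)] g(1) by simp
      then have "x \<in> ?F" using g(1) Ssub x(1) by (simp add: subsetD)
      then show "cj g x \<in> cj g ` (?S \<inter> ?F)" using x(1) by blast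
    qed
    show "cj g ` (?S \<inter> ?F) \<subseteq> cj g ` ?S \<inter> ?F" using normal_cj[OF F g(1)] by blast
  qed
  ultimately have "card (P \<inter> ?F) = card (?S \<inter> ?F)"
    using card_cj_image[OF g(1), of "?S \<inter> ?F"] Ssub by auto
  then show ?thesis using m S(2) P(2) by auto
qed

lemma sylow_chain:
  assumes "subgroup P G" "card P = p ^ multiplicity p (order G)" "prime p"
  shows "modular_chain k G P (carrier G)"
proof -
  obtain K :: "nat \<Rightarrow> 'a set" and n where K: "K 0 = {\<one>}" "K n = carrier G" "\<forall>i\<le>n. K i \<lhd> G"
    "\<forall>i<n. K i \<subseteq> K (Suc i) \<and> (\<exists>p. prime p \<and> card (K (Suc i)) = p * card (K i))"
    using prime_series .
  show ?thesis by (rule sylow_chain_along_series[OF assms(1) K assms(3) sylow_on_factor[OF assms]])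
qed

end

theorem theorem6:
  fixes G :: "('a, 'b) monoid_scheme" and A B :: "'a set" and k :: nat
  assumes "1 \<le> k"
    and "group G" and "finite (carrier G)"
    and "subgroup A G" and "subgroup B G"
    and "carrier G = A <#>\<^bsub>G\<^esub> B"
    and "nilpotent_group (G\<lparr>carrier := A\<rparr>)" and "nilpotent_group (G\<lparr>carrier := B\<rparr>)"
    and "submodular k G A" and "submodular k G B"
  shows "supersoluble_group G \<and> (\<forall>p P. sylow_subgroup G p P \<longrightarrow> submodular k G P)"
proof -
  interpret finite_group G using assms(2,3) by (simp add: finite_group_def finite_group_axioms_def)
  interpret factorised_group G A B k
    by (intro factorised_group.intro finite_group_axioms factorised_group_axioms.intro assms
        nilpotent_subgroup_imp_over submodular_imp_chain)
  show ?thesis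
  proof (intro conjI allI impI)
    show "supersoluble_group G" by (rule supersoluble)
    show "submodular k G P" if "sylow_subgroup G p P" for p P
      using that sylow_chain[of P p] chain_imp_submodular[OF _ _ assms(1)]
      by (auto simp: sylow_subgroup_def)
  qed
qed

end
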